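(* Let $\pi$ be uniform on $\mathrm{PF}_n$. Then $$\max_{1\le k\le n}\frac{\#\{i:\pi_i\le k\}-k}{\sqrt n}\Longrightarrow M\qquad(n\to\infty),$$ where $M$ is a random variable with $P\{M\le t\}=\sum_{k=-\infty}^{\infty}(1-4k^2t^2)e^{-2k^2t^2}$ for $t>0$.
   Context: A parking function of length $n$ is a sequence $(\pi_1,\dots,\pi_n)$ with $1\le\pi_i\le n$ such that $\#\{t:\pi_t\le i\}\ge i$ for all $1\le i\le n$; $\mathrm{PF}_n$ denotes the set of these. $\Longrightarrow$ denotes convergence in distribution. *)

theory Defs
  imports "HOL-Probability.Probability"
begin

text \<open>Parking functions of length n, as lists (index t < n stands for position t+1).\<close>
definition PF :: "nat \<Rightarrow> nat list set" where
  "PF n = {p. length p = n \<and> (\<forall>t<n. 1 \<le> p ! t \<and> p ! t \<le> n) \<and>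
              (\<forall>i\<in>{1..n}. card {t. t < n \<and> p ! t \<le> i} \<ge> i)}"

definition pf_stat :: "nat \<Rightarrow> nat list \<Rightarrow> real" where
  "pf_stat n p = Max ((\<lambda>k. (real (card {t. t < n \<and> p ! t \<le> k}) - real k) / sqrt (real n)) ` {1..n})"

definition pf_stat_distr :: "nat \<Rightarrow> real measure" where
  "pf_stat_distr n = measure_pmf (map_pmf (pf_stat n) (pmf_of_set (PF n)))"

text \<open>The limiting distribution function (for t > 0).\<close>
definition M_cdf :: "real \<Rightarrow> real" where
  "M_cdf t = (\<Sum>\<^sub>\<infinity>k::int. (1 - 4 * real_of_int k ^ 2 * t ^ 2) * exp (- 2 * real_of_int k ^ 2 * t ^ 2))"

end

theory Submission
  imports Defs "HOL-Real_Asymp.Real_Asymp"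
begin

text \<open>Rotating the preferences of $n$ cars on a circle of $n + 1$ spots (Pollak) makes the parking
  functions a system of representatives, and turns the maximal excess, up to an error of 1, into the
  spread (maximum minus minimum) of the walk $1 + \#\{t. f(t) < k\} - k$ of a uniform map $f$.  Summing
  over the position of a strip of width $t$ gives, after scaling by $s = \sqrt{n + 1}$,
  $E (t - \mbox{spread}/s)^+ = \int_0^t P(\mbox{the walk stays in } [-x s, (t - x) s])\, dx$.
  The strip probability converges to the alternating image sum for the Brownian bridge: the functions
  $\exp (z (x - z/2)/\tau)$ are almost harmonic for the one-cell transition, which is binomial, and an
  image sum vanishing at the boundary is compared with the survival probability, with an error term
  that absorbs the behaviour near the end of the bridge.  Integrating the image sums gives
  $t\,\theta(t) - \int e^{-2u^2} du$ with $\theta(t) = \sum_k e^{-2k^2t^2}$; by convexity in $t$ the distribution functions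
  converge to the derivative of this limit, which is the claimed series.\<close>

section \<open>Image sums for the Brownian bridge in a strip\<close>

text \<open>\<open>kern z \<tau> x\<close> is the Gaussian density with variance \<tau> centred at z
  divided by the one centred at 0, both at x. As a function of the position x and the remaining time
  \<tau> it is harmonic for the Brownian bridge ending at 0. The walk is such a bridge: with r cells
  and j cars left it stands at r - j and must reach 0. With s = sqrt (n + 1), one cell spoils
  harmonicity by O(1/s^3), which is harmless over s^2 cells. The obstacle is the end of the bridge,
  where the exponents z s / r are no longer small. The comparison therefore stops when a small
  fraction \<epsilon> of the cells is left; there survival probability and image sum are both near 1
  at positions near 0, and the walk is unlikely to be elsewhere. Here \<epsilon> depends on the
  truncation K of the image sum, and n is chosen last.

  A rotation rereads the same closed path from another starting point. A closed path has the same
  spread from every starting point; the error of 1 is the total descent of the walk in one round.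
  Integrating over the strip is the link to the spread: a strip bounds minimum and maximum
  separately, while the spread sees only their difference.\<close>

definition kern :: "real \<Rightarrow> real \<Rightarrow> real \<Rightarrow> real" where
  "kern z \<tau> x = exp (z * (x - z / 2) / \<tau>)"

text \<open>Repeated reflection of 0 in the walls b and -a: an even number of reflections gives 2k(a
  + b) with sign plus, an odd number 2b + 2k(a + b) with sign minus. Truncating at K keeps the sum
  finite.\<close>

definition images :: "nat \<Rightarrow> real \<Rightarrow> real \<Rightarrow> real \<Rightarrow> real \<Rightarrow> real" where
  "images K a b \<tau> x = (\<Sum>k\<in>{- int K..int K}.
     kern (2 * of_int k * (a + b)) \<tau> x - kern (2 * b + 2 * of_int k * (a + b)) \<tau> x)"

text \<open>A relaxation of being an image: the estimates only use that a nonzero image is at least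
  as far out as the first reflections 2b and -2a.\<close>

definition is_image :: "real \<Rightarrow> real \<Rightarrow> real \<Rightarrow> bool" where
  "is_image a b z \<longleftrightarrow> z = 0 \<or> z \<ge> 2 * b \<or> z \<le> - (2 * a)"

lemma is_image_even:
  assumes "a > 0" "b > 0"
  shows "is_image a b (2 * of_int k * (a + b))"
proof -
  consider "k = 0" | "k \<ge> 1" | "k \<le> -1" by linarith
  then show ?thesis
  proof cases
    case 2
    then have "(a + b) * 1 \<le> (a + b) * of_int k" using assms by (intro mult_left_mono) auto
    then show ?thesis using assms unfolding is_image_def by (simp add: algebra_simps)
  next
    case 3
    then have "real_of_int k \<le> - 1" by linarith
    then have "(a + b) * of_int k \<le> (a + b) * (-1)" using assms
      by (intro mult_left_mono) auto
    then show ?thesis using assms unfolding is_image_def by (simp add: algebra_simps)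
  qed (auto simp: is_image_def)
qed

lemma is_image_odd:
  assumes "a > 0" "b > 0"
  shows "is_image a b (2 * b + 2 * of_int k * (a + b))"
proof -
  consider "k \<ge> 0" | "k \<le> -1" by linarith
  then show ?thesis
  proof cases
    case 1
    then have "0 \<le> (a + b) * of_int k" using assms by simp
    then show ?thesis using assms unfolding is_image_def by (simp add: algebra_simps)
  next
    case 2
    then have "real_of_int k \<le> - 1" by linarith
    then have "(a + b) * of_int k \<le> (a + b) * (-1)" using assms
      by (intro mult_left_mono) auto
    then show ?thesis using assms unfolding is_image_def by (simp add: algebra_simps)
  qed
qed

lemma odd_image_nonzero:
  fixes a b :: real
  assumes "a > 0" "b > 0"
  shows "2 * b + 2 * of_int k * (a + b) \<noteq> 0"
proof -
  consider "k \<ge> 0" | "k \<le> -1" by linarith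
  then show ?thesis
  proof cases
    case 1
    then have "0 \<le> (a + b) * of_int k" using assms by simp
    then show ?thesis using assms by (simp add: algebra_simps)
  next
    case 2
    then have "real_of_int k \<le> - 1" by linarith
    then have "(a + b) * of_int k \<le> (a + b) * (-1)" using assms
      by (intro mult_left_mono) auto
    then show ?thesis using assms by (simp add: algebra_simps)
  qed
qed

text \<open>A point of the strip is at least as close to 0 as to any other image, so the density
  ratio is at most 1.\<close>

lemma kern_le_1:
  assumes "is_image a b z" "- a \<le> x" "x \<le> b" "\<tau> > 0" "a > 0" "b > 0"
  shows "kern z \<tau> x \<le> 1"
proof -
  have "z * (x - z / 2) \<le> 0"
    using assms(1) unfolding is_image_def
  proof (elim disjE)
    assume "z \<ge> 2 * b"
    moreover have "x - z / 2 \<le> 0" using calculation assms by linarith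
    ultimately show ?thesis
      using assms by (intro mult_nonneg_nonpos) auto
  next
    assume "z \<le> - (2 * a)"
    moreover have "x - z / 2 \<ge> 0" using calculation assms by linarith
    ultimately show ?thesis
      using assms by (intro mult_nonpos_nonneg) auto
  qed auto
  then show ?thesis using assms unfolding kern_def
    by (simp add: divide_nonpos_pos)
qed

text \<open>Near the centre the nonzero images die out as \<tau> tends to 0: from \<bar>z\<bar>
  \<ge> 2m and \<bar>x\<bar> \<le> m/2 the numerator is at most \<bar>z\<bar> (m/2 -
  \<bar>z\<bar>/2) \<le> -m^2.\<close>

lemma kern_le_center:
  assumes "is_image a b z" "z \<noteq> 0" "0 < m" "m \<le> a" "m \<le> b" "\<bar>x\<bar> \<le> m / 2" "\<tau> > 0"
  shows "kern z \<tau> x \<le> exp (- (m\<^sup>2 / \<tau>))"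
proof -
  have z: "\<bar>z\<bar> \<ge> 2 * m" using assms(1-5) unfolding is_image_def by (elim disjE) auto
  have "z * x \<le> \<bar>z\<bar> * \<bar>x\<bar>" by (metis abs_ge_self abs_mult)
  also have "\<dots> \<le> \<bar>z\<bar> * (m / 2)" using assms by (intro mult_left_mono) auto
  finally have "z * x \<le> \<bar>z\<bar> * (m / 2)" .
  then have "z * (x - z / 2) \<le> \<bar>z\<bar> * (m / 2) - \<bar>z\<bar> * (\<bar>z\<bar> / 2)" by (simp add: algebra_simps)
  also have "\<dots> = - (\<bar>z\<bar> * (\<bar>z\<bar> / 2 - m / 2))" by (simp add: algebra_simps)
  also have "\<dots> \<le> - ((2 * m) * (m / 2))"
    using z assms by (intro le_imp_neg_le mult_mono) auto
  finally have "z * (x - z / 2) \<le> - m\<^sup>2" by (simp add: power2_eq_square)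
  then have "z * (x - z / 2) / \<tau> \<le> (- m\<^sup>2) / \<tau>" using assms by (intro divide_right_mono) auto
  then show ?thesis unfolding kern_def by simp
qed

lemma images_bound:
  assumes "\<And>z. is_image a b z \<Longrightarrow> kern z \<tau> x \<le> c" "a > 0" "b > 0" "c \<ge> 0"
  shows "\<bar>images K a b \<tau> x\<bar> \<le> (4 * real K + 2) * c"
proof -
  have "\<bar>images K a b \<tau> x\<bar> \<le> (\<Sum>k\<in>{- int K..int K}. 2 * c)"
    unfolding images_def
  proof (rule sum_abs[THEN order_trans], rule sum_mono)
    fix k
    have "0 \<le> kern z \<tau> x" for z by (simp add: kern_def)
    then show "\<bar>kern (2 * of_int k * (a + b)) \<tau> x - kern (2 * b + 2 * of_int k * (a + b)) \<tau> x\<bar> \<le> 2 * c"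
      using assms(1)[OF is_image_even[OF assms(2,3), of k]] assms(1)[OF is_image_odd[OF assms(2,3), of k]]
      by (smt (verit))
  qed
  also have "\<dots> = (4 * real K + 2) * c" by (simp add: algebra_simps of_nat_diff)
  finally show ?thesis .
qed

text \<open>Reflection in b exchanges the odd image of index k with the even image of index -k, and
  the range of k is symmetric, so the cancellation is exact.\<close>

lemma images_at_top: "images K a b \<tau> b = 0"
proof -
  have refl: "kern (2 * b + 2 * of_int k * (a + b)) \<tau> b = kern (2 * of_int (- k) * (a + b)) \<tau> b" for k
    unfolding kern_def by (rule arg_cong[where f = exp], rule arg_cong2[where f = "(/)"])
      (simp_all add: algebra_simps)
  have "(\<Sum>k\<in>{- int K..int K}. kern (2 * of_int (- k) * (a + b)) \<tau> b)
      = (\<Sum>k\<in>{- int K..int K}. kern (2 * of_int k * (a + b)) \<tau> b)"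
    by (rule sum.reindex_bij_witness[where i = uminus and j = uminus]) auto
  then show ?thesis unfolding images_def sum_subtractf refl by simp
qed

text \<open>Reflection in -a pairs the odd index k with the even index -k - 1, which does not
  preserve the range of k. Two outermost even images remain, with opposite signs, and each is at
  most the bound.\<close>

lemma images_at_bottom:
  assumes "0 < \<tau>" "\<tau> \<le> 1" "a > 0" "b > 0"
  shows "\<bar>images K a b \<tau> (- a)\<bar> \<le> exp (- 2 * (real K * (a + b))\<^sup>2)"
proof -
  let ?f = "\<lambda>k::int. kern (2 * of_int k * (a + b)) \<tau> (- a)"
  have refl: "kern (2 * b + 2 * of_int k * (a + b)) \<tau> (- a) = ?f (- k - 1)" for k
    unfolding kern_def by (rule arg_cong[where f = exp], rule arg_cong2[where f = "(/)"])
      (simp_all add: algebra_simps)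
  have "(\<Sum>k\<in>{- int K..int K}. ?f (- k - 1)) = (\<Sum>k\<in>{- int K - 1..int K - 1}. ?f k)"
    by (rule sum.reindex_bij_witness[of _ "\<lambda>k. - k - 1" "\<lambda>k. - k - 1"]) auto
  also have "\<dots> = ?f (- int K - 1) + (\<Sum>k\<in>{- int K..int K - 1}. ?f k)"
  proof -
    have "{- int K - 1..int K - 1} = insert (- int K - 1) {- int K..int K - 1}" by auto
    then show ?thesis by simp
  qed
  finally have 1: "(\<Sum>k\<in>{- int K..int K}. ?f (- k - 1)) = ?f (- int K - 1) + (\<Sum>k\<in>{- int K..int K - 1}. ?f k)" .
  have 2: "(\<Sum>k\<in>{- int K..int K}. ?f k) = ?f (int K) + (\<Sum>k\<in>{- int K..int K - 1}. ?f k)"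
  proof -
    have "{- int K..int K} = insert (int K) {- int K..int K - 1}" by auto
    then show ?thesis by simp
  qed
  have "images K a b \<tau> (- a) = ?f (int K) - ?f (- int K - 1)"
    unfolding images_def sum_subtractf refl 1 2 by simp
  moreover have "?f (int K) \<le> exp (- 2 * (real K * (a + b))\<^sup>2)"
  proof -
    have "2 * (real K * (a + b))\<^sup>2 \<le> 2 * (real K * (a + b))\<^sup>2 + 2 * real K * (a + b) * a" using assms by simp
    also have "\<dots> \<le> (2 * (real K * (a + b))\<^sup>2 + 2 * real K * (a + b) * a) / \<tau>"
      using assms by (simp add: le_divide_eq mult_left_le)
    also have "\<dots> = - (2 * of_int (int K) * (a + b) * (- a - 2 * of_int (int K) * (a + b) / 2) / \<tau>)"
      unfolding minus_divide_left by (simp add: power2_eq_square algebra_simps)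
    finally show ?thesis unfolding kern_def by simp
  qed
  moreover have "?f (- int K - 1) \<le> exp (- 2 * (real K * (a + b))\<^sup>2)"
  proof -
    have "(real K * (a + b)) * (real K * (a + b)) \<le> ((real K + 1) * (a + b)) * ((real K + 1) * (a + b) - a)"
      using assms by (intro mult_mono) (auto simp: algebra_simps)
    then have "2 * (real K * (a + b))\<^sup>2 \<le> 2 * (((real K + 1) * (a + b)) * ((real K + 1) * (a + b) - a))"
      by (simp add: power2_eq_square)
    also have "\<dots> \<le> 2 * (((real K + 1) * (a + b)) * ((real K + 1) * (a + b) - a)) / \<tau>"
    proof -
      have "0 \<le> (real K + 1) * (a + b) - a" using assms by (simp add: algebra_simps)
      then have "0 \<le> 2 * (((real K + 1) * (a + b)) * ((real K + 1) * (a + b) - a))" using assms by simp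
      then show ?thesis using assms by (simp add: le_divide_eq mult_left_le)
    qed
    also have "\<dots> = - (2 * of_int (- int K - 1) * (a + b) * (- a - 2 * of_int (- int K - 1) * (a + b) / 2) / \<tau>)"
      unfolding minus_divide_left by (simp add: algebra_simps)
    finally show ?thesis unfolding kern_def by simp
  qed
  moreover have "?f k \<ge> 0" for k by (simp add: kern_def)
  ultimately show ?thesis by (smt (verit))
qed

lemma images_center:
  assumes "0 < m" "m \<le> a" "m \<le> b" "\<bar>x\<bar> \<le> m / 2" "\<tau> > 0"
  shows "\<bar>images K a b \<tau> x - 1\<bar> \<le> (4 * real K + 2) * exp (- (m\<^sup>2 / \<tau>))"
proof -
  have ab: "a > 0" "b > 0" using assms by auto
  define e where "e = exp (- (m\<^sup>2 / \<tau>))"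
  have e: "e \<ge> 0" by (simp add: e_def)
  have "\<bar>(\<Sum>k\<in>{- int K..int K} - {0}. kern (2 * of_int k * (a + b)) \<tau> x - kern (2 * b + 2 * of_int k * (a + b)) \<tau> x)\<bar>
        \<le> (\<Sum>k\<in>{- int K..int K} - {0}. 2 * e)"
  proof (rule sum_abs[THEN order_trans], rule sum_mono)
    fix k assume k: "k \<in> {- int K..int K} - {0}"
    have "0 \<le> kern z \<tau> x" for z by (simp add: kern_def)
    moreover have "kern (2 * of_int k * (a + b)) \<tau> x \<le> e"
      unfolding e_def using k ab by (intro kern_le_center[OF is_image_even] assms) auto
    moreover have "kern (2 * b + 2 * of_int k * (a + b)) \<tau> x \<le> e"
      unfolding e_def using k ab by (intro kern_le_center[OF is_image_odd] odd_image_nonzero assms) auto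
    ultimately show "\<bar>kern (2 * of_int k * (a + b)) \<tau> x - kern (2 * b + 2 * of_int k * (a + b)) \<tau> x\<bar> \<le> 2 * e"
      using e by (smt (verit))
  qed
  also have "\<dots> = 4 * real K * e" by (simp add: card_Diff_singleton)
  finally have 1: "\<bar>(\<Sum>k\<in>{- int K..int K} - {0}. kern (2 * of_int k * (a + b)) \<tau> x - kern (2 * b + 2 * of_int k * (a + b)) \<tau> x)\<bar> \<le> 4 * real K * e" .
  have "images K a b \<tau> x = 1 - kern (2 * b) \<tau> x + (\<Sum>k\<in>{- int K..int K} - {0}. kern (2 * of_int k * (a + b)) \<tau> x - kern (2 * b + 2 * of_int k * (a + b)) \<tau> x)"
    unfolding images_def by (subst sum.remove[of _ 0]) (auto simp: kern_def)
  moreover have "kern (2 * b) \<tau> x \<le> e"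
    unfolding e_def using ab assms by (intro kern_le_center[of a b]) (auto simp: is_image_def)
  moreover have "kern (2 * b) \<tau> x \<ge> 0" by (simp add: kern_def)
  moreover have "(4 * real K + 2) * e = 4 * real K * e + 2 * e" by (simp add: algebra_simps)
  ultimately show ?thesis using 1 e unfolding e_def[symmetric] by linarith
qed

section \<open>The one-cell transition\<close>

text \<open>When \<open>j\<close> cars are uniform on \<open>r + 1\<close> cells, the number \<open>i\<close> of cars outside the first cell is binomial;
  \<open>step r j h\<close> is the expectation of \<open>h i\<close>.\<close>

definition step :: "nat \<Rightarrow> nat \<Rightarrow> (nat \<Rightarrow> real) \<Rightarrow> real" where
  "step r j h = (\<Sum>i\<le>j. Bernstein j i (real r / real (Suc r)) * h i)"

lemma Bernstein_step_nonneg: "0 \<le> Bernstein j i (real r / real (Suc r))"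
  by (rule Bernstein_nonneg) (auto simp: field_simps)

lemma step_const [simp]: "step r j (\<lambda>i. c) = c"
  by (simp add: step_def flip: sum_distrib_right)

lemma step_add: "step r j (\<lambda>i. f i + g i) = step r j f + step r j g"
  by (simp add: step_def algebra_simps sum.distrib)

lemma step_diff: "step r j (\<lambda>i. f i - g i) = step r j f - step r j g"
  by (simp add: step_def algebra_simps sum_subtractf)

lemma step_cmult: "step r j (\<lambda>i. c * f i) = c * step r j f"
  by (simp add: step_def sum_distrib_left mult_ac)

lemma step_sum: "step r j (\<lambda>i. \<Sum>k\<in>A. f k i) = (\<Sum>k\<in>A. step r j (f k))"
proof -
  have "step r j (\<lambda>i. \<Sum>k\<in>A. f k i) = (\<Sum>i\<le>j. \<Sum>k\<in>A. Bernstein j i (real r / real (Suc r)) * f k i)"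
    by (simp add: step_def sum_distrib_left)
  also have "\<dots> = (\<Sum>k\<in>A. step r j (f k))"
    unfolding step_def by (rule sum.swap)
  finally show ?thesis .
qed

lemma step_mono: "(\<And>i. i \<le> j \<Longrightarrow> f i \<le> g i) \<Longrightarrow> step r j f \<le> step r j g"
  unfolding step_def by (intro sum_mono mult_left_mono Bernstein_step_nonneg) auto

lemma step_cong: "(\<And>i. i \<le> j \<Longrightarrow> f i = g i) \<Longrightarrow> step r j f = step r j g"
  unfolding step_def by (intro sum.cong) auto

lemma step_abs: "\<bar>step r j f\<bar> \<le> step r j (\<lambda>i. \<bar>f i\<bar>)"
  unfolding step_def
  by (rule sum_abs[THEN order_trans]) (simp add: abs_mult abs_of_nonneg[OF Bernstein_step_nonneg[of j _ r, simplified]])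

text \<open>The next position r - i has mean Y r / R and binomial variance j r / R^2, where j / R =
  1 - Y / R.\<close>

lemma step_square:
  fixes r j :: nat
  defines "R \<equiv> real (Suc r)"
  defines "Y \<equiv> R - real j"
  shows "step r j (\<lambda>i. (real r - real i)\<^sup>2) = (Y * real r / R)\<^sup>2 + (1 - Y / R) * (real r / R)"
proof -
  define p where "p = real r / R"
  have "step r j (\<lambda>i. (real r - real i)\<^sup>2)
      = step r j (\<lambda>i. (real r)\<^sup>2 + ((1 - 2 * real r) * real i + real i * (real i - 1)))"
    by (rule step_cong) (simp add: power2_eq_square algebra_simps)
  also have "\<dots> = (real r)\<^sup>2 + ((1 - 2 * real r) * step r j real + step r j (\<lambda>i. real i * (real i - 1)))"
    by (simp add: step_add step_cmult)
  also have "step r j real = j * p"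
    using sum_k_Bernstein[of j p] by (simp add: step_def p_def R_def mult_ac)
  also have "step r j (\<lambda>i. real i * (real i - 1)) = real j * (real j - 1) * p\<^sup>2"
    using sum_kk_Bernstein[of j p] by (simp add: step_def p_def R_def mult_ac)
  finally have *: "step r j (\<lambda>i. (real r - real i)\<^sup>2) =
    (real r)\<^sup>2 + ((1 - 2 * real r) * (j * p) + real j * (real j - 1) * p\<^sup>2)" .
  have j: "real j = R - Y" by (simp add: Y_def)
  have r: "real r = R - 1" by (simp add: R_def)
  have R: "R > 0" by (simp add: R_def)
  have "(R - 1)\<^sup>2 + ((1 - 2 * (R - 1)) * ((R - Y) * ((R - 1) / R)) + (R - Y) * (R - Y - 1) * ((R - 1) / R)\<^sup>2)
      = (Y * (R - 1) / R)\<^sup>2 + (1 - Y / R) * ((R - 1) / R)"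
    using R by (simp add: field_simps power2_eq_square)
  then show ?thesis using * unfolding j p_def r by simp
qed

lemma step_exp: "step r j (\<lambda>i. exp (- (l * real i))) = ((real r * exp (- l) + 1) / real (Suc r)) ^ j"
proof -
  define p where "p = real r / real (Suc r)"
  have "(p * exp (- l) + (1 - p)) ^ j = (\<Sum>i\<le>j. real (j choose i) * (p * exp (- l)) ^ i * (1 - p) ^ (j - i))"
    by (rule binomial_ring)
  also have "\<dots> = step r j (\<lambda>i. exp (- (l * real i)))"
    unfolding step_def Bernstein_def p_def[symmetric]
    by (intro sum.cong refl) (simp add: power_mult_distrib exp_of_nat_mult[symmetric] mult_ac)
  finally show ?thesis by (simp add: p_def field_simps)
qed

lemma exp_second_order:
  fixes l :: real
  assumes "\<bar>l\<bar> \<le> 1"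
  shows "\<bar>exp l - 1 - l\<bar> \<le> 3 / 2 * l\<^sup>2" "\<bar>exp l - 1 - l - l\<^sup>2 / 2\<bar> \<le> \<bar>l\<bar> ^ 3 / 2"
proof -
  have e: "exp t \<le> 3" if "\<bar>t\<bar> \<le> \<bar>l\<bar>" for t :: real
  proof -
    have "exp t \<le> exp 1" using that assms by simp
    then show ?thesis using exp_le by linarith
  qed
  obtain t where t: "\<bar>t\<bar> \<le> \<bar>l\<bar>" "exp l = (\<Sum>m<2. l ^ m / fact m) + exp t / fact 2 * l ^ 2"
    using Maclaurin_exp_le[of l 2] by blast
  then have "exp l - 1 - l = exp t / 2 * l\<^sup>2" by (simp add: numeral_2_eq_2)
  then have "\<bar>exp l - 1 - l\<bar> = \<bar>exp t / 2 * l\<^sup>2\<bar>" by (rule arg_cong)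
  also have "\<dots> = exp t / 2 * l\<^sup>2" by simp
  also have "\<dots> \<le> 3 / 2 * l\<^sup>2" using e[OF t(1)] by (intro mult_right_mono) auto
  finally show "\<bar>exp l - 1 - l\<bar> \<le> 3 / 2 * l\<^sup>2" .
  obtain t where t: "\<bar>t\<bar> \<le> \<bar>l\<bar>" "exp l = (\<Sum>m<3. l ^ m / fact m) + exp t / fact 3 * l ^ 3"
    using Maclaurin_exp_le[of l 3] by blast
  then have "exp l - 1 - l - l\<^sup>2 / 2 = exp t / 6 * l ^ 3"
    by (simp add: numeral_3_eq_3 numeral_2_eq_2)
  then have "\<bar>exp l - 1 - l - l\<^sup>2 / 2\<bar> = \<bar>exp t / 6 * l ^ 3\<bar>" by (rule arg_cong)
  also have "\<dots> = exp t / 6 * \<bar>l\<bar> ^ 3" by (simp add: abs_mult power_abs)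
  also have "\<dots> \<le> 1 / 2 * \<bar>l\<bar> ^ 3" using e[OF t(1)] by (intro mult_right_mono) auto
  finally show "\<bar>exp l - 1 - l - l\<^sup>2 / 2\<bar> \<le> \<bar>l\<bar> ^ 3 / 2" by simp
qed

text \<open>By \<open>step_exp\<close> the expectation is explicit. In its logarithm the linear and
  the leading quadratic terms in l cancel against those of the kernel at R, the quadratic one
  because the remaining time drops from R to r. For l of order 1/s, Y of order s and R of order s^2,
  the error \<open>err\<close> is O(1/s^3).\<close>

lemma step_kern:
  fixes r j :: nat and z s :: real
  defines "R \<equiv> real (Suc r)"
  defines "Y \<equiv> R - real j"
  defines "l \<equiv> z * s / real r"
  defines "err \<equiv> 2 * \<bar>Y\<bar> * l\<^sup>2 / R + \<bar>l\<bar> ^ 3 + 26 * l\<^sup>2 / R"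
  assumes "r > 0" "s > 0" "\<bar>l\<bar> \<le> 1 / 5" "\<bar>Y\<bar> \<le> R" "err \<le> 1"
  shows "\<bar>step r j (\<lambda>i. kern z (real r / s\<^sup>2) ((real r - real i) / s)) - kern z (R / s\<^sup>2) (Y / s)\<bar>
         \<le> 2 * err * kern z (R / s\<^sup>2) (Y / s)"
proof -
  define w where "w = exp l - 1"
  have R: "R \<ge> 1" "real r = R - 1" "R \<noteq> 0" by (simp_all add: R_def)
  have rp: "real r > 0" using assms by simp
  have j: "real j = R - Y" by (simp add: Y_def)
  have w1: "\<bar>w - l\<bar> \<le> 3 / 2 * l\<^sup>2" "\<bar>w - l - l\<^sup>2 / 2\<bar> \<le> \<bar>l\<bar> ^ 3 / 2"
    using exp_second_order[of l] assms(7) by (auto simp: w_def)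
  have "l\<^sup>2 = \<bar>l\<bar> * \<bar>l\<bar>" by (simp add: power2_eq_square)
  also have "\<dots> \<le> \<bar>l\<bar> * (1 / 5)" using assms(7) by (intro mult_left_mono) auto
  finally have "\<bar>w\<bar> \<le> 5 / 2 * \<bar>l\<bar>" using w1(1) by linarith
  then have w2: "\<bar>w\<bar> \<le> 5 / 2 * \<bar>l\<bar>" "\<bar>w\<bar> \<le> 1 / 2" using assms(7) by auto
  have wR: "\<bar>w / R\<bar> \<le> 1 / 2"
  proof -
    have "\<bar>w\<bar> / R \<le> \<bar>w\<bar> / 1" using R by (intro divide_left_mono) auto
    then show ?thesis using w2(2) R by simp
  qed
  then have pos: "1 + w / R > 0" by linarith
  \<comment> \<open>D is the logarithm of the expectation divided by
    \<open>kern z (R / s\<^sup>2) (Y / s)\<close>.\<close>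
  define D where "D = l * Y / R - l - l\<^sup>2 / 2 + l\<^sup>2 / (2 * R) + real j * ln (1 + w / R)"
  have kern1: "kern z (real r / s\<^sup>2) ((real r - real i) / s) = exp (l * real r - l * z * s / 2) * exp (- (l * real i))" for i
    unfolding kern_def l_def exp_add[symmetric] using assms(6) rp
    by (simp add: field_simps power2_eq_square)
  have "step r j (\<lambda>i. kern z (real r / s\<^sup>2) ((real r - real i) / s))
      = exp (l * real r - l * z * s / 2) * ((real r * exp (- l) + 1) / R) ^ j"
    unfolding kern1 step_cmult step_exp R_def ..
  also have "(real r * exp (- l) + 1) / R = exp (- l) * (1 + w / R)"
    using R by (simp add: w_def exp_minus field_simps)
  also have "(exp (- l) * (1 + w / R)) ^ j = exp (- l * real j + real j * ln (1 + w / R))"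
  proof -
    have "exp (real j * ln (1 + w / R)) = (1 + w / R) ^ j" using pos by (simp add: exp_of_nat_mult)
    moreover have "exp (- l * real j) = exp (- l) ^ j" by (simp add: mult.commute flip: exp_of_nat_mult)
    ultimately show ?thesis by (simp only: power_mult_distrib exp_add)
  qed
  also have "exp (l * real r - l * z * s / 2) * \<dots> = exp (D + (z * (Y / s - z / 2) / (R / s\<^sup>2)))"
  proof -
    have zs: "z * s = l * (R - 1)" using rp by (simp add: l_def R(2))
    have "z * (Y / s - z / 2) / (R / s\<^sup>2) = ((z * s) * Y - (z * s) * (z * s) / 2) / R"
      using assms(6) R by (simp add: field_simps power2_eq_square)
    also have "\<dots> = ((l * (R - 1)) * Y - (l * (R - 1)) * (l * (R - 1)) / 2) / R" unfolding zs ..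
    finally have E: "z * (Y / s - z / 2) / (R / s\<^sup>2) = \<dots>" .
    have F: "l * real r - l * z * s / 2 = l * (R - 1) - l * (l * (R - 1)) / 2"
      using zs R(2) by (simp add: mult.assoc)
    have "l * (R - 1) - l * (l * (R - 1)) / 2 + (- l * (R - Y) + L)
      = (l * Y / R - l - l\<^sup>2 / 2 + l\<^sup>2 / (2 * R) + L)
        + ((l * (R - 1)) * Y - (l * (R - 1)) * (l * (R - 1)) / 2) / R" for L
      using R(3) by (simp add: field_simps power2_eq_square)
    then show ?thesis unfolding exp_add[symmetric] E F D_def j by (rule arg_cong)
  qed
  also have "\<dots> = exp D * kern z (R / s\<^sup>2) (Y / s)" by (simp add: exp_add kern_def)
  finally have step: "step r j (\<lambda>i. kern z (real r / s\<^sup>2) ((real r - real i) / s)) = exp D * kern z (R / s\<^sup>2) (Y / s)" .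
  have D: "\<bar>D\<bar> \<le> err"
  proof -
    define q where "q = ln (1 + w / R) - w / R"
    \<comment> \<open>Since j = R - Y, the first-order part j w / R of j ln (1 + w/R) is w - Y w /
      R. Only Taylor remainders and l^2/(2R) survive.\<close>
    have "D = - (Y / R * (w - l)) + (w - l - l\<^sup>2 / 2) + l\<^sup>2 / (2 * R) + real j * q"
      unfolding D_def q_def j using R by (simp add: field_simps)
    moreover have "\<bar>Y / R * (w - l)\<bar> \<le> \<bar>Y\<bar> / R * (3 / 2 * l\<^sup>2)"
    proof -
      have "\<bar>Y / R * (w - l)\<bar> = \<bar>Y\<bar> / R * \<bar>w - l\<bar>" using R by (simp add: abs_mult)
      then show ?thesis using w1(1) R by (simp only:) (intro mult_left_mono, auto)
    qed
    moreover have "\<bar>real j * q\<bar> \<le> 25 * l\<^sup>2 / R"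
    proof -
      have "\<bar>q\<bar> \<le> 2 * (w / R)\<^sup>2"
        unfolding q_def by (rule abs_ln_one_plus_x_minus_x_bound[OF wR])
      moreover have "real j \<le> 2 * R" using assms(8) j by linarith
      ultimately have "\<bar>real j * q\<bar> \<le> (2 * R) * (2 * (w / R)\<^sup>2)"
        unfolding abs_mult by (intro mult_mono) auto
      also have "\<dots> = 4 * \<bar>w\<bar>\<^sup>2 / R" using R by (simp add: field_simps power2_eq_square)
      also have "\<dots> \<le> 4 * (5 / 2 * \<bar>l\<bar>)\<^sup>2 / R"
        using w2(1) R by (intro divide_right_mono mult_left_mono power_mono) auto
      also have "\<dots> = 25 * l\<^sup>2 / R" by (simp add: power2_eq_square)
      finally show ?thesis .
    qed
    \<comment> \<open>The four parts are abstracted to make the estimate linear; the coefficients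
      3/2, 1/2 and 1/2 + 25 are rounded up to the 2, 1 and 26 of \<open>err\<close>.\<close>
    moreover have "\<bar>p1 + p2 + p3 + p4\<bar> \<le> 2 * u + c + 26 * v"
      if "\<bar>p1\<bar> \<le> 3 / 2 * u" "\<bar>p2\<bar> \<le> c / 2" "p3 = v / 2" "\<bar>p4\<bar> \<le> 25 * v" "u \<ge> 0" "v \<ge> 0" "c \<ge> 0"
      for p1 p2 p3 p4 u v c :: real
      using that by linarith
    from this[of "- (Y / R * (w - l))" "\<bar>Y\<bar> / R * l\<^sup>2" "w - l - l\<^sup>2 / 2" "\<bar>l\<bar> ^ 3"
        "l\<^sup>2 / (2 * R)" "l\<^sup>2 / R" "real j * q"]
    have "\<bar>Y / R * (w - l)\<bar> \<le> \<bar>Y\<bar> / R * (3 / 2 * l\<^sup>2) \<Longrightarrow> \<bar>real j * q\<bar> \<le> 25 * l\<^sup>2 / R \<Longrightarrow>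
      \<bar>- (Y / R * (w - l)) + (w - l - l\<^sup>2 / 2) + l\<^sup>2 / (2 * R) + real j * q\<bar>
        \<le> 2 * (\<bar>Y\<bar> / R * l\<^sup>2) + \<bar>l\<bar> ^ 3 + 26 * (l\<^sup>2 / R)"
      using w1(2) R by (simp add: mult.commute mult.left_commute)
    moreover have "err = 2 * (\<bar>Y\<bar> / R * l\<^sup>2) + \<bar>l\<bar> ^ 3 + 26 * (l\<^sup>2 / R)" by (simp add: err_def)
    ultimately show ?thesis by simp
  qed
  have "\<bar>exp D - 1\<bar> \<le> 2 * \<bar>D\<bar>"
  proof -
    have D1: "\<bar>D\<bar> \<le> 1" using D assms(9) by linarith
    show ?thesis
    proof (cases "D \<ge> 0")
      case True
      then have "exp D \<le> 1 + D + D\<^sup>2" using D1 by (intro exp_bound) auto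
      moreover have "D\<^sup>2 \<le> D" using D1 True by (simp add: power2_eq_square mult_left_le)
      ultimately show ?thesis using True by auto
    next
      case False
      then have "exp D \<le> 1" by simp
      then show ?thesis using exp_ge_add_one_self[of D] False by linarith
    qed
  qed
  then have "\<bar>exp D - 1\<bar> \<le> 2 * err" using D by linarith
  then have "\<bar>exp D - 1\<bar> * kern z (R / s\<^sup>2) (Y / s) \<le> 2 * err * kern z (R / s\<^sup>2) (Y / s)"
    by (intro mult_right_mono) (auto simp: kern_def)
  moreover have "\<bar>exp D * kern z (R / s\<^sup>2) (Y / s) - kern z (R / s\<^sup>2) (Y / s)\<bar> = \<bar>exp D - 1\<bar> * kern z (R / s\<^sup>2) (Y / s)"
  proof -
    have "exp D * kern z (R / s\<^sup>2) (Y / s) - kern z (R / s\<^sup>2) (Y / s) = (exp D - 1) * kern z (R / s\<^sup>2) (Y / s)"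
      by (simp add: algebra_simps)
    then show ?thesis by (simp add: abs_mult kern_def)
  qed
  ultimately show ?thesis unfolding step by simp
qed

section \<open>Survival probabilities and their comparison with image sums\<close>

text \<open>With \<open>r\<close> cells and \<open>j\<close> cars still to come the walk is at \<open>r - j\<close>; \<open>surv A B r j\<close> is the probability
  that it stays in \<open>[A, B]\<close> from there on.\<close>

fun surv :: "real \<Rightarrow> real \<Rightarrow> nat \<Rightarrow> nat \<Rightarrow> real" where
  "surv A B 0 j = (if j = 0 then 1 else 0)"
| "surv A B (Suc r) j =
     (if A \<le> real (Suc r) - real j \<and> real (Suc r) - real j \<le> B then step r j (surv A B r) else 0)"

lemma surv_nonneg: "0 \<le> surv A B r j"
proof (induction r arbitrary: j)
  case (Suc r)
  have "step r j (\<lambda>i. 0) \<le> step r j (surv A B r)" by (rule step_mono) (rule Suc)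
  then show ?case by simp
qed auto

lemma surv_le_1: "surv A B r j \<le> 1"
proof (induction r arbitrary: j)
  case (Suc r)
  have "step r j (surv A B r) \<le> step r j (\<lambda>i. 1)" by (rule step_mono) (rule Suc)
  then show ?case by simp
qed auto

lemma step_square_le:
  "step r j (\<lambda>i. (real r - real i)\<^sup>2) \<le> (real (Suc r) - real j)\<^sup>2 + 2"
proof -
  define R where "R = real (Suc r)"
  define Y where "Y = R - real j"
  define q where "q = real r / R"
  have R: "R \<ge> 1" "real r = R - 1" by (simp_all add: R_def)
  have q: "0 \<le> q" "q \<le> 1" "q + 1 / R = 1" using R by (auto simp: q_def field_simps)
  have "step r j (\<lambda>i. (real r - real i)\<^sup>2) = Y\<^sup>2 * q\<^sup>2 + q - Y * (q / R)"
  proof -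
    have "step r j (\<lambda>i. (real r - real i)\<^sup>2) = (Y * real r / R)\<^sup>2 + (1 - Y / R) * (real r / R)"
      unfolding step_square R_def Y_def ..
    also have "Y * real r / R = Y * q" by (simp add: q_def)
    also have "real r / R = q" by (simp add: q_def)
    finally show ?thesis by (simp add: power_mult_distrib algebra_simps)
  qed
  also have "- Y * (q / R) \<le> (Y\<^sup>2 + 1) * (q / R)"
  proof (rule mult_right_mono)
    have "0 \<le> (Y + 1)\<^sup>2 + Y\<^sup>2 + 1" by simp
    then show "- Y \<le> Y\<^sup>2 + 1" by (simp add: power2_eq_square algebra_simps)
  qed (use q R in auto)
  then have "Y\<^sup>2 * q\<^sup>2 + q - Y * (q / R) \<le> Y\<^sup>2 * (q * (q + 1 / R)) + q * (1 + 1 / R)"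
    by (simp add: algebra_simps power2_eq_square)
  also have "\<dots> \<le> Y\<^sup>2 * 1 + 1 * (1 + 1)"
    using q R by (intro add_mono mult_mono mult_left_mono) (auto simp: field_simps)
  finally show ?thesis by (simp add: Y_def R_def)
qed

text \<open>A Chebyshev argument by induction: ((r - j)^2 + 2r) / m^2 is at least 1 outside the
  strip, and by \<open>step_square_le\<close> it does not grow in mean. The induction starts at r =
  1, where all cars must take the last cell and the walk goes to 0; at r = 0 a state with cars left
  has survival probability 0.\<close>

lemma surv_near_one:
  assumes "m > 0" "A \<le> - m" "m \<le> B" "r \<ge> 1"
    and "A \<le> real r - real j" "real r - real j \<le> B"
  shows "1 - surv A B r j \<le> ((real r - real j)\<^sup>2 + 2 * real r) / m\<^sup>2"
  using assms(4-6)
proof (induction r arbitrary: j rule: dec_induct)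
  case base
  have "step 0 j (surv A B 0) = (\<Sum>i\<le>j. if i = 0 then 1 else 0)"
    unfolding step_def by (intro sum.cong) (auto simp: Bernstein_def)
  then have "surv A B 1 j = 1" using base by simp
  then show ?case by simp
next
  case (step r)
  have "1 - surv A B (Suc r) j = step r j (\<lambda>i. 1 - surv A B r i)"
    using step.prems by (simp add: step_diff del: of_nat_Suc)
  also have "\<dots> \<le> step r j (\<lambda>i. 1 / m\<^sup>2 * ((real r - real i)\<^sup>2 + 2 * real r))"
  proof (rule step_mono)
    fix i
    show "1 - surv A B r i \<le> 1 / m\<^sup>2 * ((real r - real i)\<^sup>2 + 2 * real r)"
    proof (cases "A \<le> real r - real i \<and> real r - real i \<le> B")
      case True
      then show ?thesis using step.IH[of i] by simp
    next
      case False
      then have "\<bar>m\<bar> \<le> \<bar>real r - real i\<bar>" using assms(1-3) by linarith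
      then have "m\<^sup>2 \<le> (real r - real i)\<^sup>2" by (simp only: abs_le_square_iff)
      then have "m\<^sup>2 \<le> (real r - real i)\<^sup>2 + 2 * real r" by simp
      then have "1 \<le> 1 / m\<^sup>2 * ((real r - real i)\<^sup>2 + 2 * real r)" using assms(1) by simp
      then show ?thesis using surv_nonneg[of A B r i] by linarith
    qed
  qed
  also have "\<dots> \<le> 1 / m\<^sup>2 * (((real (Suc r) - real j)\<^sup>2 + 2) + 2 * real r)"
    unfolding step_cmult step_add step_const using step_square_le[of r j]
    by (intro mult_left_mono add_right_mono) auto
  also have "\<dots> = ((real (Suc r) - real j)\<^sup>2 + 2 * real (Suc r)) / m\<^sup>2" by simp
  finally show ?case .
qed

text \<open>A discrete maximum principle. The survival probability satisfies the recursion with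
  killing outside the strip, U satisfies it up to a defect, and \<Phi> is a supersolution of the
  same recursion that also pays for the defect.\<close>

lemma surv_compare:
  fixes A B :: real
  defines "strip \<equiv> \<lambda>r j. A \<le> real r - real j \<and> real r - real j \<le> B"
  assumes base: "\<And>j. strip r0 j \<Longrightarrow> \<bar>surv A B r0 j - U r0 j\<bar> \<le> \<Phi> r0 j"
    and step: "\<And>r j. r0 \<le> r \<Longrightarrow> r < R \<Longrightarrow> strip (Suc r) j \<Longrightarrow>
          \<bar>step r j (\<lambda>i. if strip r i then U r i else 0) - U (Suc r) j\<bar>
          + step r j (\<lambda>i. if strip r i then \<Phi> r i else 0) \<le> \<Phi> (Suc r) j"
    and "r0 \<ge> 1" "r0 \<le> R" "strip R j"
  shows "\<bar>surv A B R j - U R j\<bar> \<le> \<Phi> R j"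
  using assms(5,6) step
proof (induction R arbitrary: j rule: dec_induct)
  case base
  then show ?case using assms(2) by blast
next
  case (step r)
  have IH: "\<bar>surv A B r i - U r i\<bar> \<le> \<Phi> r i" if "strip r i" for i
    using step.IH[OF that] step.prems(2) by (meson less_SucI)
  \<comment> \<open>For positive r the survival probability vanishes outside the strip; the equation
    for r = 0 does not test the strip.\<close>
  obtain r' where r': "r = Suc r'" using step(1) assms(4) by (cases r) auto
  have "surv A B (Suc r) j = step r j (surv A B r)"
    using step.prems(1) by (simp add: strip_def)
  also have "\<dots> = step r j (\<lambda>i. if strip r i then surv A B r i else 0)"
    by (intro step_cong) (auto simp: strip_def r')
  finally have 1: "surv A B (Suc r) j = step r j (\<lambda>i. if strip r i then surv A B r i else 0)" .
  have "\<bar>surv A B (Suc r) j - step r j (\<lambda>i. if strip r i then U r i else 0)\<bar>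
      \<le> step r j (\<lambda>i. \<bar>(if strip r i then surv A B r i else 0) - (if strip r i then U r i else 0)\<bar>)"
    unfolding 1 step_diff[symmetric] by (rule step_abs)
  also have "\<dots> \<le> step r j (\<lambda>i. if strip r i then \<Phi> r i else 0)"
    by (rule step_mono) (use IH in auto)
  finally show ?case
    using step.prems(2)[OF step(1) lessI step.prems(1)] by linarith
qed

section \<open>Image sums one cell later, inside the strip and beyond its walls\<close>

lemma kern_shift: "kern z \<tau> x' = kern z \<tau> x * exp (z * (x' - x) / \<tau>)"
  unfolding kern_def exp_add[symmetric] by (simp add: algebra_simps diff_divide_distrib add_divide_distrib)

lemma images_diff_le:
  assumes "\<And>k. k \<in> {- int K..int K} \<Longrightarrow>
        \<bar>f (2 * of_int k * (a + b)) - g (2 * of_int k * (a + b))\<bar> \<le> c \<and>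
        \<bar>f (2 * b + 2 * of_int k * (a + b)) - g (2 * b + 2 * of_int k * (a + b))\<bar> \<le> c"
  shows "\<bar>(\<Sum>k\<in>{- int K..int K}. f (2 * of_int k * (a + b)) - f (2 * b + 2 * of_int k * (a + b)))
        - (\<Sum>k\<in>{- int K..int K}. g (2 * of_int k * (a + b)) - g (2 * b + 2 * of_int k * (a + b)))\<bar>
       \<le> (4 * real K + 2) * (c :: real)"
proof -
  have "\<bar>(\<Sum>k\<in>{- int K..int K}. f (2 * of_int k * (a + b)) - f (2 * b + 2 * of_int k * (a + b)))
        - (\<Sum>k\<in>{- int K..int K}. g (2 * of_int k * (a + b)) - g (2 * b + 2 * of_int k * (a + b)))\<bar>
      \<le> (\<Sum>k\<in>{- int K..int K}. 2 * c)"
    unfolding sum_subtractf[symmetric]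
  proof (rule sum_abs[THEN order_trans], rule sum_mono)
    fix k assume "k \<in> {- int K..int K}"
    from assms[OF this] show "\<bar>f (2 * of_int k * (a + b)) - f (2 * b + 2 * of_int k * (a + b))
         - (g (2 * of_int k * (a + b)) - g (2 * b + 2 * of_int k * (a + b)))\<bar> \<le> 2 * c"
      by linarith
  qed
  also have "\<dots> = (4 * real K + 2) * c" by (simp add: algebra_simps of_nat_diff)
  finally show ?thesis .
qed

lemma image_abs_le:
  assumes "k \<in> {- int K..int K}" "a > 0" "b > 0"
  shows "\<bar>2 * of_int k * (a + b)\<bar> \<le> 2 * (real K + 1) * (a + b)"
    "\<bar>2 * b + 2 * of_int k * (a + b)\<bar> \<le> 2 * (real K + 1) * (a + b)"
proof -
  have "\<bar>real_of_int k\<bar> \<le> real K" using assms(1) by auto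
  then have "\<bar>real_of_int k\<bar> * (a + b) \<le> real K * (a + b)" using assms by (intro mult_right_mono) auto
  moreover have "\<bar>2 * real_of_int k * (a + b)\<bar> = 2 * (\<bar>real_of_int k\<bar> * (a + b))" using assms by (simp add: abs_mult)
  moreover have "2 * (real K + 1) * (a + b) = 2 * (real K * (a + b)) + 2 * a + 2 * b" by (simp add: algebra_simps)
  ultimately show "\<bar>2 * of_int k * (a + b)\<bar> \<le> 2 * (real K + 1) * (a + b)"
    "\<bar>2 * b + 2 * of_int k * (a + b)\<bar> \<le> 2 * (real K + 1) * (a + b)" using assms by linarith+
qed

text \<open>Only x has to lie in the strip, where every kernel is at most 1. Moving to x' multiplies
  a kernel by exp (z (x' - x) / \<tau>), and Z bounds all images of the truncated sum. This controls
  the sum beyond the walls.\<close>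

lemma images_shift:
  fixes K :: nat and a b :: real
  assumes "a > 0" "b > 0" "\<tau> > 0" "- a \<le> x" "x \<le> b"
  defines "Z \<equiv> 2 * (real K + 1) * (a + b)"
  shows "\<bar>images K a b \<tau> x' - images K a b \<tau> x\<bar> \<le> (4 * real K + 2) * (exp (Z * \<bar>x' - x\<bar> / \<tau>) - 1)"
proof -
  have *: "\<bar>kern z \<tau> x' - kern z \<tau> x\<bar> \<le> exp (Z * \<bar>x' - x\<bar> / \<tau>) - 1" if "is_image a b z" "\<bar>z\<bar> \<le> Z" for z
  proof -
    define u where "u = z * (x' - x) / \<tau>"
    have "\<bar>u\<bar> = \<bar>z\<bar> * \<bar>x' - x\<bar> / \<tau>" using assms by (simp add: u_def abs_mult)
    also have "\<dots> \<le> Z * \<bar>x' - x\<bar> / \<tau>"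
      using that assms by (intro divide_right_mono mult_right_mono) auto
    finally have u: "\<bar>u\<bar> \<le> Z * \<bar>x' - x\<bar> / \<tau>" .
    have "\<bar>exp u - 1\<bar> \<le> exp \<bar>u\<bar> - 1"
    proof (cases "u \<ge> 0")
      case False
      then have "\<bar>exp u - 1\<bar> = 1 - exp u" by simp
      also have "\<dots> \<le> exp (- u) - 1"
        using exp_ge_add_one_self[of u] exp_ge_add_one_self[of "- u"] by linarith
      finally show ?thesis using False by simp
    qed simp
    also have "\<dots> \<le> exp (Z * \<bar>x' - x\<bar> / \<tau>) - 1" using u by simp
    finally have "\<bar>exp u - 1\<bar> \<le> exp (Z * \<bar>x' - x\<bar> / \<tau>) - 1" .
    moreover have "kern z \<tau> x' - kern z \<tau> x = kern z \<tau> x * (exp u - 1)"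
      by (subst kern_shift[of z \<tau> x' x]) (simp add: u_def algebra_simps)
    moreover have "0 \<le> kern z \<tau> x" "kern z \<tau> x \<le> 1"
      using kern_le_1[OF that(1)] assms by (auto simp: kern_def)
    ultimately show ?thesis
      by (simp add: abs_mult) (meson abs_ge_zero mult_left_le_one_le order_trans)
  qed
  show ?thesis unfolding images_def
    by (rule images_diff_le, rule conjI; rule *)
       (auto simp only: Z_def intro: image_abs_le[OF _ assms(1,2)] is_image_even[OF assms(1,2)]
         is_image_odd[OF assms(1,2)])
qed

text \<open>\<open>step_kern\<close> for every image at once: \<open>err\<close> is taken at the
  largest image modulus and with (a + b) s in place of \<bar>Y\<bar>.\<close>

lemma step_kern_images:
  fixes r j K :: nat and a b s :: real
  defines "R \<equiv> real (Suc r)"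
  defines "Y \<equiv> R - real j"
  defines "l \<equiv> 2 * (real K + 1) * (a + b) * s / real r"
  defines "err \<equiv> 2 * (a + b) * s * l\<^sup>2 / R + l ^ 3 + 26 * l\<^sup>2 / R"
  assumes "a > 0" "b > 0" "r > 0" "s > 0" "l \<le> 1 / 5" "- a * s \<le> Y" "Y \<le> b * s" "(a + b) * s \<le> R" "err \<le> 1"
  shows "\<bar>step r j (\<lambda>i. images K a b (real r / s\<^sup>2) ((real r - real i) / s)) - images K a b (R / s\<^sup>2) (Y / s)\<bar>
         \<le> (4 * real K + 2) * (2 * err)"
proof -
  define Z where "Z = 2 * (real K + 1) * (a + b)"
  have Z: "Z > 0" using assms by (simp add: Z_def)
  have l: "l = Z * s / real r" "l > 0" using assms Z by (auto simp: l_def Z_def)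
  have R: "R \<ge> 1" by (simp add: R_def)
  have absY: "\<bar>Y\<bar> \<le> (a + b) * s"
  proof -
    have "0 \<le> a * s" "0 \<le> b * s" using assms by auto
    moreover have "(a + b) * s = a * s + b * s" by (simp add: algebra_simps)
    ultimately show ?thesis using assms(10,11) by auto
  qed
  have one: "\<bar>step r j (\<lambda>i. kern z (real r / s\<^sup>2) ((real r - real i) / s)) - kern z (R / s\<^sup>2) (Y / s)\<bar> \<le> 2 * err"
    if z: "is_image a b z" "\<bar>z\<bar> \<le> Z" for z
  proof -
    define l' where "l' = z * s / real r"
    define err' where "err' = 2 * \<bar>Y\<bar> * l'\<^sup>2 / R + \<bar>l'\<bar> ^ 3 + 26 * l'\<^sup>2 / R"
    have l': "\<bar>l'\<bar> \<le> l"
    proof -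
      have "\<bar>l'\<bar> = \<bar>z\<bar> * s / real r" using assms(8) by (simp add: l'_def abs_mult)
      also have "\<dots> \<le> Z * s / real r" using z(2) assms(8) by (intro divide_right_mono mult_right_mono) auto
      finally show ?thesis by (simp add: l)
    qed
    then have "\<bar>l'\<bar> \<le> \<bar>l\<bar>" by simp
    then have l'2: "l'\<^sup>2 \<le> l\<^sup>2" by (simp only: abs_le_square_iff)
    have e: "err' \<le> err" unfolding err'_def err_def
    proof (intro add_mono divide_right_mono)
      have "2 * (\<bar>Y\<bar> * l'\<^sup>2) \<le> 2 * ((a + b) * s * l\<^sup>2)"
        using absY l'2 by (intro mult_left_mono mult_mono order_trans[OF abs_ge_zero absY]) auto
      then show "2 * \<bar>Y\<bar> * l'\<^sup>2 \<le> 2 * (a + b) * s * l\<^sup>2" by (simp only: mult.assoc)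
      show "\<bar>l'\<bar> ^ 3 \<le> l ^ 3" using l' by (intro power_mono) auto
    qed (use l'2 R in auto)
    have x: "- a \<le> Y / s" "Y / s \<le> b"
      using assms(8,10,11) by (simp_all add: field_simps)
    have k: "kern z (R / s\<^sup>2) (Y / s) \<le> 1" "0 \<le> kern z (R / s\<^sup>2) (Y / s)"
      using kern_le_1[OF z(1) x _ assms(5,6), of "R / s\<^sup>2"] assms(8) R by (simp_all add: kern_def)
    have "\<bar>step r j (\<lambda>i. kern z (real r / s\<^sup>2) ((real r - real i) / s)) - kern z (R / s\<^sup>2) (Y / s)\<bar>
        \<le> 2 * err' * kern z (R / s\<^sup>2) (Y / s)"
      unfolding err'_def R_def Y_def l'_def
    proof (rule step_kern)
      show "\<bar>z * s / real r\<bar> \<le> 1 / 5" using l' assms(9) unfolding l'_def by linarith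
      show "\<bar>real (Suc r) - real j\<bar> \<le> real (Suc r)" using absY assms(12) unfolding Y_def R_def by linarith
      show "2 * \<bar>real (Suc r) - real j\<bar> * (z * s / real r)\<^sup>2 / real (Suc r) + \<bar>z * s / real r\<bar> ^ 3 +
        26 * (z * s / real r)\<^sup>2 / real (Suc r) \<le> 1"
        using e assms(13) unfolding err'_def R_def Y_def l'_def by linarith
    qed (use assms in auto)
    also have "\<dots> \<le> 2 * err * 1"
    proof (rule mult_mono)
      have "0 \<le> err'" using R by (simp add: err'_def)
      then show "0 \<le> 2 * err" using e by simp
    qed (use e k in auto)
    finally show ?thesis by simp
  qed
  have "step r j (\<lambda>i. images K a b (real r / s\<^sup>2) ((real r - real i) / s))
      = (\<Sum>k\<in>{- int K..int K}. step r j (\<lambda>i. kern (2 * of_int k * (a + b)) (real r / s\<^sup>2) ((real r - real i) / s))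
         - step r j (\<lambda>i. kern (2 * b + 2 * of_int k * (a + b)) (real r / s\<^sup>2) ((real r - real i) / s)))"
    unfolding images_def step_sum step_diff ..
  also have "\<bar>\<dots> - images K a b (R / s\<^sup>2) (Y / s)\<bar> \<le> (4 * real K + 2) * (2 * err)"
    unfolding images_def
    by (rule images_diff_le, rule conjI; rule one)
       (auto simp only: Z_def intro: image_abs_le[OF _ assms(5,6)] is_image_even[OF assms(5,6)]
         is_image_odd[OF assms(5,6)])
  finally show ?thesis .
qed

text \<open>One cell lowers the walk by at most 1 but may raise it by many cars. An exit at the
  bottom, or at the top by at most D, is compared with the value at the wall, which is tiny or 0. An
  overshoot u > D at the top satisfies u \<le> j - i, hence u \<le> 2 (j - i) - D, and is charged to
  an exponential moment of the jump.\<close>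

lemma images_outside:
  fixes r i j K :: nat and a b s D :: real
  defines "l \<equiv> 2 * (real K + 1) * (a + b) * s / real r"
  assumes "a > 0" "b > 0" "r > 0" "s > 0" "real r \<le> s\<^sup>2" "l \<le> 1" "1 \<le> D" "i \<le> j"
    and "- a * s \<le> real (Suc r) - real j" "real (Suc r) - real j \<le> b * s"
    and "\<not> (- a * s \<le> real r - real i \<and> real r - real i \<le> b * s)"
    and "exp (- 2 * (real K * (a + b))\<^sup>2) + (4 * real K + 2) * (exp (l * D) - 1) \<le> \<delta>"
  shows "\<bar>images K a b (real r / s\<^sup>2) ((real r - real i) / s)\<bar>
       \<le> \<delta> + (4 * real K + 2) * exp (- D) * exp (2 * (real j - real i))"
proof -
  define y where "y = real r - real i"
  define \<tau> where "\<tau> = real r / s\<^sup>2"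
  have \<tau>: "0 < \<tau>" "\<tau> \<le> 1" using assms by (auto simp: \<tau>_def)
  have l0: "l \<ge> 0" using assms by (simp add: l_def)
  have shift: "\<bar>images K a b \<tau> (y / s) - images K a b \<tau> (w / s)\<bar> \<le> (4 * real K + 2) * (exp (l * \<bar>y - w\<bar>) - 1)"
    if "- a * s \<le> w" "w \<le> b * s" for w
  proof -
    have "- a \<le> w / s" "w / s \<le> b" using that assms(5) by (simp_all add: field_simps)
    from images_shift[OF assms(2,3) \<tau>(1) this, of K "y / s"]
    have "\<bar>images K a b \<tau> (y / s) - images K a b \<tau> (w / s)\<bar>
      \<le> (4 * real K + 2) * (exp (2 * (real K + 1) * (a + b) * \<bar>y / s - w / s\<bar> / \<tau>) - 1)" .
    also have "2 * (real K + 1) * (a + b) * \<bar>y / s - w / s\<bar> / \<tau> = l * \<bar>y - w\<bar>"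
    proof -
      have "\<bar>y / s - w / s\<bar> = \<bar>y - w\<bar> / s" using assms(5) by (simp add: diff_divide_distrib[symmetric])
      then show ?thesis using assms(4,5) by (simp add: l_def \<tau>_def field_simps power2_eq_square)
    qed
    finally show ?thesis .
  qed
  have as: "0 < a * s" "0 < b * s" using assms by auto
  have r1: "0 \<le> (4 * real K + 2) * exp (- D) * exp (2 * (real j - real i))" by simp
  have near: "(4 * real K + 2) * (exp (l * d) - 1) \<le> (4 * real K + 2) * (exp (l * D) - 1)" if "d \<le> D" for d
    using that l0 by (intro mult_left_mono diff_right_mono) (auto intro: mult_left_mono)
  consider "y < - a * s" | "y > b * s" "y - b * s \<le> D" | "y > b * s" "y - b * s > D"
    using assms(12) unfolding y_def by linarith
  then have "\<bar>images K a b \<tau> (y / s)\<bar> \<le> \<delta> + (4 * real K + 2) * exp (- D) * exp (2 * (real j - real i))"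
  proof cases
    case 1
    have "\<bar>y - - a * s\<bar> \<le> D" using 1 assms(8-10) unfolding y_def by (simp add: abs_if)
    then have "\<bar>images K a b \<tau> (y / s) - images K a b \<tau> (- a * s / s)\<bar> \<le> (4 * real K + 2) * (exp (l * D) - 1)"
      using shift[of "- a * s"] near[of "\<bar>y - - a * s\<bar>"] as by linarith
    then have "\<bar>images K a b \<tau> (y / s) - images K a b \<tau> (- a)\<bar> \<le> (4 * real K + 2) * (exp (l * D) - 1)"
      using assms(5) by simp
    moreover have "\<bar>images K a b \<tau> (- a)\<bar> \<le> exp (- 2 * (real K * (a + b))\<^sup>2)"
      using images_at_bottom \<tau> assms by blast
    ultimately show ?thesis using assms(13) r1 by linarith
  next
    case 2
    then have "\<bar>images K a b \<tau> (y / s) - images K a b \<tau> (b * s / s)\<bar> \<le> (4 * real K + 2) * (exp (l * D) - 1)"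
      using shift[of "b * s"] near[of "\<bar>y - b * s\<bar>"] as by linarith
    moreover have "images K a b \<tau> (b * s / s) = 0" using assms(5) by (simp add: images_at_top)
    moreover have "0 \<le> exp (- 2 * (real K * (a + b))\<^sup>2)" by simp
    ultimately show ?thesis using assms(13) r1 by linarith
  next
    case 3
    have d: "y - b * s \<le> real j - real i" using assms(11) by (simp add: y_def)
    have "l * (y - b * s) \<le> 1 * (y - b * s)" using 3 assms(7) by (intro mult_right_mono) auto
    also have "\<dots> \<le> 2 * (real j - real i) - D"
    proof -
      have "1 * u \<le> 2 * v - D" if "u \<le> v" "D < u" for u v :: real using that by linarith
      from this[OF d 3(2)] show ?thesis .
    qed
    finally have "exp (l * (y - b * s)) \<le> exp (- D) * exp (2 * (real j - real i))"
      by (simp flip: exp_add)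
    then have e: "(4 * real K + 2) * (exp (l * (y - b * s)) - 1) \<le> (4 * real K + 2) * (exp (- D) * exp (2 * (real j - real i)))"
      by (intro mult_left_mono) auto
    have "\<bar>images K a b \<tau> (y / s) - images K a b \<tau> (b * s / s)\<bar> \<le> (4 * real K + 2) * (exp (l * (y - b * s)) - 1)"
      using shift[of "b * s"] 3 as by auto
    moreover have "images K a b \<tau> (b * s / s) = 0" using assms(5) by (simp add: images_at_top)
    moreover have "0 \<le> \<delta>"
    proof -
      have "0 \<le> (4 * real K + 2) * (exp (l * D) - 1)" using l0 assms(8) by simp
      moreover have "0 \<le> exp (- 2 * (real K * (a + b))\<^sup>2)" by simp
      ultimately show ?thesis using assms(13) by linarith
    qed
    ultimately show ?thesis using e unfolding mult.assoc by linarith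
  qed
  then show ?thesis by (simp add: y_def \<tau>_def)
qed

text \<open>The number j - i of cars in the cell is binomial with parameters j and 1/R, so the
  moment is (1 + (exp 2 - 1)/R)^j. Then exp 2 \<le> 9 and j \<le> 2R give the constant.\<close>

lemma step_jump_exp:
  assumes "real j \<le> 2 * real (Suc r)"
  shows "step r j (\<lambda>i. exp (2 * (real j - real i))) \<le> exp 16"
proof -
  define R where "R = real (Suc r)"
  have R: "R \<ge> 1" "real r = R - 1" by (simp_all add: R_def)
  have e2: "exp 2 \<le> (9::real)"
  proof -
    have "exp (2::real) = exp 1 * exp 1" by (simp flip: exp_add)
    also have "\<dots> \<le> 3 * 3" using exp_le by (intro mult_mono) auto
    finally show ?thesis by simp
  qed
  have "step r j (\<lambda>i. exp (2 * (real j - real i))) = step r j (\<lambda>i. exp (2 * real j) * exp (- (2 * real i)))"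
    by (simp add: algebra_simps flip: exp_add)
  also have "\<dots> = exp (2 * real j) * ((real r * exp (- 2) + 1) / R) ^ j"
    unfolding step_cmult step_exp R_def ..
  also have "exp (2 * real j) = exp 2 ^ j" by (simp add: mult.commute flip: exp_of_nat_mult)
  also have "exp 2 ^ j * ((real r * exp (- 2) + 1) / R) ^ j = (exp 2 * ((real r * exp (- 2) + 1) / R)) ^ j"
    by (simp only: power_mult_distrib)
  also have "exp 2 * ((real r * exp (- 2) + 1) / R) = 1 + (exp 2 - 1) / R"
  proof -
    have "exp 2 * (real r * exp (- 2) + 1) = real r + exp (2 :: real)"
    proof -
      have "exp 2 * (real r * exp (- 2) + 1) = real r * (exp 2 * exp (- 2)) + exp (2 :: real)"
        by (simp only: distrib_left mult_1_right mult_ac)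
      also have "exp 2 * exp (- 2) = (1 :: real)" by (simp flip: exp_add)
      finally show ?thesis by simp
    qed
    then have "exp 2 * ((real r * exp (- 2) + 1) / R) = (real r + exp 2) / R"
      by (simp only: times_divide_eq_right)
    also have "\<dots> = 1 + (exp 2 - 1) / R" using R by (simp add: field_simps)
    finally show ?thesis .
  qed
  also have "(1 + (exp 2 - 1) / R) ^ j \<le> exp (8 / R) ^ j"
  proof (rule power_mono)
    have "1 + (exp 2 - 1) / R \<le> 1 + 8 / R" using e2 R by (intro add_left_mono divide_right_mono) auto
    also have "\<dots> \<le> exp (8 / R)" by (rule exp_ge_add_one_self)
    finally show "1 + (exp 2 - 1) / R \<le> exp (8 / R)" .
    have "exp 2 \<ge> (1::real)" by simp
    then show "0 \<le> 1 + (exp 2 - 1) / R" using R by (intro add_nonneg_nonneg divide_nonneg_nonneg) auto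
  qed
  also have "\<dots> = exp (8 * (real j / R))" by (simp add: mult.commute flip: exp_of_nat_mult)
  also have "\<dots> \<le> exp 16"
  proof -
    have "real j / R \<le> 2" using assms R unfolding R_def[symmetric] by (simp add: field_simps)
    then show ?thesis by simp
  qed
  finally show ?thesis .
qed

text \<open>The error function \<open>\<Phi>\<close> in the proof has three parts: \<open>\<delta>\<close> pays for the values of the image sum just
  outside the strip, \<open>Q\<close> is a quadratic supersolution which is at least 1 away from 0 when \<open>r0\<close> cells are
  left but of order \<open>r0 / s\<^sup>2\<close> at the start, and \<open>\<rho>\<close> is the one-step error together with the exponentially
  unlikely jumps by more than \<open>D\<close>.\<close>

lemma surv_images_bound:
  fixes K r0 n :: nat and a b s D E \<delta> :: real
  defines "l0 \<equiv> 2 * (real K + 1) * (a + b) * s / real r0"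
  defines "c \<equiv> 4 * real K + 2"
  defines "m \<equiv> min a b"
  defines "\<tau>0 \<equiv> real r0 / s\<^sup>2"
  defines "\<rho> \<equiv> c * (2 * E) + c * exp (- D) * exp 16"
  assumes ab: "a > 0" "b > 0" and s: "s > 0" "s\<^sup>2 = real (Suc n)"
    and r0: "r0 \<ge> 1" "r0 \<le> Suc n" "(a + b) * s \<le> real r0"
    and l0: "l0 \<le> 1 / 5"
    and E: "2 * (a + b) * s * l0\<^sup>2 / real r0 + l0 ^ 3 + 26 * l0\<^sup>2 / real r0 \<le> E" "E \<le> 1"
    and D: "1 \<le> D" "exp (- 2 * (real K * (a + b))\<^sup>2) + c * (exp (l0 * D) - 1) \<le> \<delta>"
    and init: "c * exp (- (m\<^sup>2 / \<tau>0)) + 2 * \<tau>0 / m\<^sup>2 \<le> \<delta>"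
    and start: "1 \<le> b * s"
  shows "\<bar>surv (- a * s) (b * s) (Suc n) n - images K a b 1 (1 / s)\<bar>
      \<le> \<delta> + (c + 1) * (8 * \<tau>0 / m\<^sup>2) + s\<^sup>2 * \<rho>"
proof -
  have m: "m > 0" "m \<le> a" "m \<le> b" using ab by (auto simp: m_def)
  have c: "c \<ge> 2" by (simp add: c_def)
  have l0p: "l0 \<ge> 0" using ab s by (simp add: l0_def)
  have E0: "0 \<le> E"
  proof -
    have "0 \<le> 2 * (a + b) * s * l0\<^sup>2 / real r0 + l0 ^ 3 + 26 * l0\<^sup>2 / real r0"
      using ab s l0p by (intro add_nonneg_nonneg) auto
    then show ?thesis using E(1) by linarith
  qed
  have \<rho>: "\<rho> \<ge> 0" using c E0 by (simp add: \<rho>_def)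
  have \<tau>0: "\<tau>0 > 0" using r0 s(1) by (simp add: \<tau>0_def)
  have \<delta>: "\<delta> \<ge> 0"
  proof -
    have "0 \<le> c * exp (- (m\<^sup>2 / \<tau>0))" using c by simp
    moreover have "0 \<le> 2 * \<tau>0 / m\<^sup>2" using \<tau>0 by simp
    ultimately show ?thesis using init by linarith
  qed
  define strip where "strip r j \<longleftrightarrow> - a * s \<le> real r - real j \<and> real r - real j \<le> b * s" for r j :: nat
  define U where "U r j = images K a b (real r / s\<^sup>2) ((real r - real j) / s)" for r j :: nat
  \<comment> \<open>C makes Q r0 j equal to 4 x^2 / m^2 for x = (r0 - j) / s, which is at least 1
    once \<bar>x\<bar> \<ge> m/2. In Q, the ratio (r - j) / r is a martingale whose square gains in
    mean at most 2 (1/r - 1/(r + 1)) per cell; the second summand telescopes these gains.\<close>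
  define C where "C = 4 * (real r0)\<^sup>2 / (m\<^sup>2 * s\<^sup>2)"
  define Q where "Q r j = C * (((real r - real j) / real r)\<^sup>2 + 2 * (1 / real r0 - 1 / real r))" for r j :: nat
  define \<Phi> where "\<Phi> r j = \<delta> + (c + 1) * Q r j + (real r - real r0) * \<rho>" for r j :: nat
  have C: "C \<ge> 0" by (simp add: C_def)
  have Q: "Q r j \<ge> 0" if "r0 \<le> r" for r j
  proof -
    have "1 / real r \<le> 1 / real r0" using that r0 by (intro divide_left_mono) auto
    then show ?thesis using C by (simp add: Q_def)
  qed
  have base: "\<bar>surv (- a * s) (b * s) r0 j - U r0 j\<bar> \<le> \<Phi> r0 j" if j: "strip r0 j" for j
  proof -
    define x where "x = (real r0 - real j) / s"
    have sv: "0 \<le> surv (- a * s) (b * s) r0 j" "surv (- a * s) (b * s) r0 j \<le> 1"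
      by (rule surv_nonneg, rule surv_le_1)
    have Qx: "Q r0 j = 4 * x\<^sup>2 / m\<^sup>2"
      using r0 s(1) m by (simp add: Q_def C_def x_def power_divide field_simps)
    show ?thesis
    \<comment> \<open>Near 0 both quantities are close to 1. Elsewhere the crude bound c + 1 on
      their difference is covered by (c + 1) Q.\<close>
    proof (cases "\<bar>x\<bar> \<le> m / 2")
      case True
      have "\<bar>U r0 j - 1\<bar> \<le> c * exp (- (m\<^sup>2 / \<tau>0))"
        unfolding U_def c_def using images_center[OF m True \<tau>0, of K] by (simp add: x_def \<tau>0_def)
      moreover have "1 - surv (- a * s) (b * s) r0 j \<le> ((real r0 - real j)\<^sup>2 + 2 * real r0) / (m * s)\<^sup>2"
      proof (rule surv_near_one)
        show "- a * s \<le> - (m * s)" "m * s \<le> b * s" using m s by auto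
      qed (use m s r0 j in \<open>auto simp: strip_def\<close>)
      moreover have "((real r0 - real j)\<^sup>2 + 2 * real r0) / (m * s)\<^sup>2 = x\<^sup>2 / m\<^sup>2 + 2 * \<tau>0 / m\<^sup>2"
        using s(1) m by (simp add: x_def \<tau>0_def power_divide power_mult_distrib field_simps)
      moreover have "1 * (x\<^sup>2 / m\<^sup>2) \<le> (c + 1) * (4 * x\<^sup>2 / m\<^sup>2)"
        using c by (intro mult_mono divide_right_mono) auto
      ultimately show ?thesis using init sv unfolding \<Phi>_def Qx by simp
    next
      case False
      have "\<bar>U r0 j\<bar> \<le> c * 1"
        unfolding U_def c_def
      proof (rule images_bound)
        fix z assume "is_image a b z"
        then show "kern z (real r0 / s\<^sup>2) ((real r0 - real j) / s) \<le> 1"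
          by (rule kern_le_1) (use j s(1) ab r0 in \<open>auto simp: strip_def field_simps\<close>)
      qed (use ab in auto)
      moreover have "1 \<le> Q r0 j"
      proof -
        have "m\<^sup>2 \<le> (2 * \<bar>x\<bar>)\<^sup>2" using False m by (intro power_mono) auto
        then show ?thesis using m by (simp add: Qx power_mult_distrib)
      qed
      moreover have "(c + 1) * 1 \<le> (c + 1) * Q r0 j" using calculation(2) c by (intro mult_left_mono) auto
      ultimately show ?thesis using sv \<delta> by (simp add: \<Phi>_def)
    qed
  qed
  have step: "\<bar>step r j (\<lambda>i. if strip r i then U r i else 0) - U (Suc r) j\<bar>
      + step r j (\<lambda>i. if strip r i then \<Phi> r i else 0) \<le> \<Phi> (Suc r) j"
    if r: "r0 \<le> r" "r < Suc n" and j: "strip (Suc r) j" for r j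
  proof -
    define R where "R = real (Suc r)"
    define Y where "Y = R - real j"
    define l where "l = 2 * (real K + 1) * (a + b) * s / real r"
    have rpos: "real r > 0" "real r0 > 0" "real r0 \<le> real r" "R > 0" "real r0 \<le> R" using r r0 by (auto simp: R_def)
    have l: "0 \<le> l" "l \<le> l0"
      unfolding l_def l0_def using ab s rpos by (auto intro!: divide_left_mono)
    have Y: "- a * s \<le> Y" "Y \<le> b * s" using j by (auto simp: strip_def Y_def R_def)
    have abR: "(a + b) * s \<le> R" using r0 rpos by linarith
    have "0 < b * s" using ab s by simp
    then have YR: "- R \<le> Y" using Y abR by (simp add: algebra_simps)
    have jR: "real j \<le> 2 * real (Suc r)" using YR by (simp add: Y_def R_def)
    define err where "err = 2 * (a + b) * s * l\<^sup>2 / R + l ^ 3 + 26 * l\<^sup>2 / R"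
    have err: "err \<le> E"
    proof -
      have "l\<^sup>2 \<le> l0\<^sup>2" "l ^ 3 \<le> l0 ^ 3" using l by (auto intro: power_mono)
      then have "err \<le> 2 * (a + b) * s * l0\<^sup>2 / real r0 + l0 ^ 3 + 26 * l0\<^sup>2 / real r0"
        unfolding err_def using ab s rpos l by (intro add_mono frac_le mult_left_mono) auto
      then show ?thesis using E by linarith
    qed
    have main: "\<bar>step r j (U r) - U (Suc r) j\<bar> \<le> c * (2 * E)"
    proof -
      have "\<bar>step r j (U r) - U (Suc r) j\<bar> \<le> c * (2 * err)"
        unfolding U_def c_def err_def l_def R_def
      proof (rule step_kern_images[OF ab _ s(1)])
        show "2 * (real K + 1) * (a + b) * s / real r \<le> 1 / 5" using l l0 unfolding l_def by linarith
        show "2 * (a + b) * s * (2 * (real K + 1) * (a + b) * s / real r)\<^sup>2 / real (Suc r)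
            + (2 * (real K + 1) * (a + b) * s / real r) ^ 3
            + 26 * (2 * (real K + 1) * (a + b) * s / real r)\<^sup>2 / real (Suc r) \<le> 1"
          using err E unfolding err_def l_def R_def by linarith
      qed (use rpos Y abR in \<open>simp_all only: Y_def R_def of_nat_0_less_iff\<close>)
      also have "\<dots> \<le> c * (2 * E)" using c err by (intro mult_left_mono) auto
      finally show ?thesis .
    qed
    \<comment> \<open>P is the probability of leaving the strip in this cell. Killing \<Phi> there
      frees \<delta> P, which covers the image values met outside; so \<delta> is spent once and not
      once per cell.\<close>
    define P where "P = step r j (\<lambda>i. if strip r i then 0 else 1)"
    have out: "\<bar>step r j (\<lambda>i. if strip r i then 0 else U r i)\<bar> \<le> \<delta> * P + c * exp (- D) * exp 16"
    proof -
      have "\<bar>step r j (\<lambda>i. if strip r i then 0 else U r i)\<bar> \<le> step r j (\<lambda>i. \<bar>if strip r i then 0 else U r i\<bar>)"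
        by (rule step_abs)
      also have "\<dots> \<le> step r j (\<lambda>i. \<delta> * (if strip r i then 0 else 1) + c * exp (- D) * exp (2 * (real j - real i)))"
      proof (rule step_mono)
        fix i assume i: "i \<le> j"
        show "\<bar>if strip r i then 0 else U r i\<bar>
          \<le> \<delta> * (if strip r i then 0 else 1) + c * exp (- D) * exp (2 * (real j - real i))"
        proof (cases "strip r i")
          case True
          then show ?thesis using c by simp
        next
          case False
          have "exp (l * D) \<le> exp (l0 * D)" using l D by (simp add: mult_right_mono)
          then have "c * (exp (l * D) - 1) \<le> c * (exp (l0 * D) - 1)" using c by (intro mult_left_mono) auto
          then have d: "exp (- 2 * (real K * (a + b))\<^sup>2) + c * (exp (l * D) - 1) \<le> \<delta>" using D(2) by linarith
          have "real r \<le> s\<^sup>2" using r unfolding s(2) of_nat_le_iff by simp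
          then have "\<bar>U r i\<bar> \<le> \<delta> + c * exp (- D) * exp (2 * (real j - real i))"
            unfolding U_def c_def
          proof (intro images_outside[OF ab _ s(1) _ _ D(1) i])
            show "2 * (real K + 1) * (a + b) * s / real r \<le> 1" using l l0 unfolding l_def by linarith
          qed (use rpos j False d in \<open>simp_all only: strip_def l_def c_def of_nat_0_less_iff simp_thms\<close>)
          then show ?thesis using False by simp
        qed
      qed
      also have "\<dots> = \<delta> * P + c * exp (- D) * step r j (\<lambda>i. exp (2 * (real j - real i)))"
        unfolding step_add step_cmult P_def ..
      also have "\<dots> \<le> \<delta> * P + c * exp (- D) * exp 16"
        using step_jump_exp[OF jR] c by (intro add_left_mono mult_left_mono) auto
      finally show ?thesis .
    qed
    have "step r j (U r) = step r j (\<lambda>i. (if strip r i then U r i else 0) + (if strip r i then 0 else U r i))"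
      by (rule step_cong) auto
    then have split: "step r j (\<lambda>i. if strip r i then U r i else 0)
       = step r j (U r) - step r j (\<lambda>i. if strip r i then 0 else U r i)"
      by (simp add: step_add)
    have stepQ: "step r j (Q r) \<le> Q (Suc r) j"
    proof -
      have "step r j (Q r) = C * (1 / (real r)\<^sup>2 * step r j (\<lambda>i. (real r - real i)\<^sup>2) + 2 * (1 / real r0 - 1 / real r))"
        unfolding Q_def step_cmult step_add step_const by (simp add: power_divide flip: step_cmult)
      also have "step r j (\<lambda>i. (real r - real i)\<^sup>2) = (Y * real r / R)\<^sup>2 + (1 - Y / R) * (real r / R)"
        unfolding step_square R_def Y_def ..
      also have "1 / (real r)\<^sup>2 * \<dots> = (Y / R)\<^sup>2 + (1 - Y / R) * (1 / (real r * R))"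
        using rpos by (simp add: field_simps power2_eq_square)
      also have "\<dots> \<le> (Y / R)\<^sup>2 + 2 * (1 / (real r * R))"
        using YR rpos by (intro add_left_mono mult_right_mono) (auto simp: field_simps)
      also have "1 / (real r * R) = 1 / real r - 1 / R"
      proof -
        have "R = real r + 1" by (simp add: R_def)
        then show ?thesis using rpos by (simp add: field_simps)
      qed
      finally show ?thesis using C unfolding Q_def R_def[symmetric] Y_def[symmetric]
        by (simp add: mult_left_mono)
    qed
    have "step r j (\<lambda>i. if strip r i then \<Phi> r i else 0)
       \<le> step r j (\<lambda>i. \<delta> * (1 - (if strip r i then 0 else 1)) + ((c + 1) * Q r i + (real r - real r0) * \<rho>))"
    proof (rule step_mono)
      fix i
      have "0 \<le> (c + 1) * Q r i + (real r - real r0) * \<rho>" using c Q r \<rho> by simp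
      then show "(if strip r i then \<Phi> r i else 0)
        \<le> \<delta> * (1 - (if strip r i then 0 else 1)) + ((c + 1) * Q r i + (real r - real r0) * \<rho>)"
        by (simp add: \<Phi>_def)
    qed
    also have "\<dots> = \<delta> * (1 - P) + ((c + 1) * step r j (Q r) + (real r - real r0) * \<rho>)"
      unfolding step_add step_cmult step_diff step_const P_def ..
    also have "\<dots> \<le> \<delta> * (1 - P) + ((c + 1) * Q (Suc r) j + (real r - real r0) * \<rho>)"
      using stepQ c by (intro add_left_mono add_right_mono mult_left_mono) auto
    finally have phi: "step r j (\<lambda>i. if strip r i then \<Phi> r i else 0)
      \<le> \<delta> * (1 - P) + ((c + 1) * Q (Suc r) j + (real r - real r0) * \<rho>)" .
    have "\<Phi> (Suc r) j = \<delta> + (c + 1) * Q (Suc r) j + (real r - real r0) * \<rho> + \<rho>"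
      by (simp add: \<Phi>_def algebra_simps)
    moreover have "\<delta> * (1 - P) = \<delta> - \<delta> * P" by (simp add: algebra_simps)
    ultimately show ?thesis using main out phi unfolding split \<rho>_def by linarith
  qed
  have "\<bar>surv (- a * s) (b * s) (Suc n) n - U (Suc n) n\<bar> \<le> \<Phi> (Suc n) n"
  proof (rule surv_compare[OF base[unfolded strip_def] step[unfolded strip_def] r0(1,2)])
    have "0 \<le> a * s" using ab s by simp
    then show "- a * s \<le> real (Suc n) - real n \<and> real (Suc n) - real n \<le> b * s" using start by simp
  qed auto
  also have "U (Suc n) n = images K a b 1 (1 / s)"
    using s by (simp add: U_def)
  also have "\<Phi> (Suc n) n \<le> \<delta> + (c + 1) * (8 * \<tau>0 / m\<^sup>2) + s\<^sup>2 * \<rho>"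
  proof -
    have "Q (Suc n) n \<le> C * (2 / real r0)"
      unfolding Q_def
    proof (rule mult_left_mono)
      have "1 / (real (Suc n) * real (Suc n)) \<le> 1 / real (Suc n)"
      proof (rule frac_le)
        have "real (Suc n) * 1 \<le> real (Suc n) * real (Suc n)" by (intro mult_left_mono) auto
        then show "real (Suc n) \<le> real (Suc n) * real (Suc n)" by simp
      qed auto
      also have "1 / real (Suc n) = 1 * (1 / real (Suc n))" by (rule mult_1[symmetric])
      also have "\<dots> \<le> 2 * (1 / real (Suc n))" by (rule mult_right_mono) auto
      finally have "1 / (real (Suc n) * real (Suc n)) \<le> 2 * (1 / real (Suc n))" .
      then show "((real (Suc n) - real n) / real (Suc n))\<^sup>2 + 2 * (1 / real r0 - 1 / real (Suc n)) \<le> 2 / real r0"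
        by (simp add: power_divide power2_eq_square algebra_simps)
    qed (rule C)
    also have "C * (2 / real r0) = 8 * \<tau>0 / m\<^sup>2"
      using r0 s(1) m by (simp add: C_def \<tau>0_def field_simps power2_eq_square)
    finally have "(c + 1) * Q (Suc n) n \<le> (c + 1) * (8 * \<tau>0 / m\<^sup>2)" using c by (intro mult_left_mono) auto
    moreover have "(real (Suc n) - real r0) * \<rho> \<le> s\<^sup>2 * \<rho>" unfolding s(2) using \<rho> by (intro mult_right_mono) auto
    ultimately show ?thesis unfolding \<Phi>_def by linarith
  qed
  finally show ?thesis .
qed

text \<open>K makes the truncation error small, \<epsilon> is chosen for this K, and n comes last.
  The jump threshold D = sqrt s works because l0 is O(1/s), so exp (l0 D) tends to 1, while s^2 exp
  (- sqrt s) still tends to 0.\<close>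

lemma surv_images_eventually:
  fixes a b e :: real
  assumes ab: "a > 0" "b > 0" and e: "e > 0"
  shows "\<forall>\<^sub>F K in sequentially. \<forall>\<^sub>F n in sequentially.
    \<bar>surv (- a * sqrt (real (Suc n))) (b * sqrt (real (Suc n))) (Suc n) n - images K a b 1 0\<bar> \<le> e"
proof -
  \<comment> \<open>Four shares: the \<delta> of \<open>surv_images_bound\<close>, its term from Q,
    the accumulated one-step errors, and the move of the starting point from 1/s to 0.\<close>
  define \<delta> where "\<delta> = e / 4"
  have \<delta>: "\<delta> > 0" using e by (simp add: \<delta>_def)
  have L: "a + b > 0" using ab by simp
  define L where "L = a + b"
  have "((\<lambda>K. exp (- 2 * (real K * L)\<^sup>2)) \<longlongrightarrow> 0) sequentially"
    using L unfolding L_def[symmetric] by real_asymp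
  then have "\<forall>\<^sub>F K in sequentially. exp (- 2 * (real K * L)\<^sup>2) < \<delta> / 2"
    using \<delta> by (intro order_tendstoD(2)) auto
  then show ?thesis
  proof eventually_elim
    case (elim K)
    define c where "c = 4 * real K + 2"
    define m where "m = min a b"
    define Z where "Z = 2 * (real K + 1) * (a + b)"
    have c: "c > 0" by (simp add: c_def)
    have m: "m > 0" using ab by (simp add: m_def)
    have Z: "Z > 0" using L by (simp add: Z_def)
    have "((\<lambda>\<tau>. c * exp (- (m\<^sup>2 / \<tau>)) + 2 * \<tau> / m\<^sup>2) \<longlongrightarrow> 0) (at_right 0)"
      using m c by real_asymp
    then have ev1: "\<forall>\<^sub>F \<tau> in at_right 0. c * exp (- (m\<^sup>2 / \<tau>)) + 2 * \<tau> / m\<^sup>2 < \<delta>"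
      using \<delta> by (intro order_tendstoD(2)) auto
    have "((\<lambda>\<tau>. (c + 1) * (8 * \<tau> / m\<^sup>2)) \<longlongrightarrow> 0) (at_right 0)"
      using m c by real_asymp
    then have ev2: "\<forall>\<^sub>F \<tau> in at_right 0. (c + 1) * (8 * \<tau> / m\<^sup>2) < \<delta>"
      using \<delta> by (intro order_tendstoD(2)) auto
    from eventually_conj[OF ev1 ev2] obtain \<tau>1 where \<tau>1: "\<tau>1 > 0"
      "\<And>\<tau>. 0 < \<tau> \<Longrightarrow> \<tau> < \<tau>1 \<Longrightarrow> c * exp (- (m\<^sup>2 / \<tau>)) + 2 * \<tau> / m\<^sup>2 < \<delta> \<and> (c + 1) * (8 * \<tau> / m\<^sup>2) < \<delta>"
      unfolding eventually_at_right_field by auto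
    \<comment> \<open>Rounding \<epsilon> s^2 up to r0 at most doubles it. Hence \<tau>0 \<le> 2
      \<epsilon> < \<tau>1, and \<epsilon> \<le> 1/2 keeps r0 within the n + 1 cells.\<close>
    define \<epsilon> where "\<epsilon> = min (\<tau>1 / 3) (1 / 2)"
    have \<epsilon>: "\<epsilon> > 0" "2 * \<epsilon> < \<tau>1" "\<epsilon> \<le> 1 / 2" using \<tau>1 by (auto simp: \<epsilon>_def min_def)
    define q where "q = Z / \<epsilon>"
    have q: "q > 0" using Z \<epsilon> by (simp add: q_def)
    \<comment> \<open>W / s^3 is the one-step error after inserting l0 \<le> q / s and r0 \<ge>
      \<epsilon> s^2, with s^4 weakened to s^3 in the last term.\<close>
    define W where "W = (2 * (a + b) / \<epsilon> + q + 26 / \<epsilon>) * q\<^sup>2"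
    have W: "W > 0" using L \<epsilon> q by (simp add: W_def add_pos_pos)
    define good where "good s \<longleftrightarrow> (a + b) * s \<le> \<epsilon> * s\<^sup>2 \<and> q / s \<le> 1 / 5 \<and> W / s ^ 3 \<le> 1 \<and> 1 \<le> sqrt s \<and>
        c * (exp (q / sqrt s) - 1) \<le> \<delta> / 2 \<and>
        s\<^sup>2 * (c * (2 * (W / s ^ 3)) + c * exp (- sqrt s) * exp 16) \<le> \<delta> \<and>
        1 \<le> b * s \<and> 1 \<le> \<epsilon> * s\<^sup>2 \<and> c * (exp (Z / s) - 1) \<le> \<delta>" for s
    have "\<forall>\<^sub>F s in at_top. good s"
      unfolding good_def
    proof (intro eventually_conj)
      have "\<forall>\<^sub>F s in at_top. L * s \<le> \<epsilon> * s\<^sup>2" using L \<epsilon> unfolding L_def[symmetric] by real_asymp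
      then show "\<forall>\<^sub>F s in at_top. (a + b) * s \<le> \<epsilon> * s\<^sup>2" by (simp add: L_def)
      have "((\<lambda>s. q / s) \<longlongrightarrow> 0) at_top" by real_asymp
      from order_tendstoD(2)[OF this, of "1 / 5"] show "\<forall>\<^sub>F s in at_top. q / s \<le> 1 / 5"
        by (auto elim: eventually_mono)
      have "((\<lambda>s. W / s ^ 3) \<longlongrightarrow> 0) at_top" by real_asymp
      from order_tendstoD(2)[OF this, of 1] show "\<forall>\<^sub>F s in at_top. W / s ^ 3 \<le> 1"
        by (auto elim: eventually_mono)
      show "\<forall>\<^sub>F s in at_top. (1::real) \<le> sqrt s" by real_asymp
      have "((\<lambda>s. c * (exp (q / sqrt s) - 1)) \<longlongrightarrow> 0) at_top" using q c by real_asymp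
      from order_tendstoD(2)[OF this, of "\<delta> / 2"] \<delta> show "\<forall>\<^sub>F s in at_top. c * (exp (q / sqrt s) - 1) \<le> \<delta> / 2"
        by (auto elim: eventually_mono)
      have "((\<lambda>s. s\<^sup>2 * (c * (2 * (W / s ^ 3)) + c * exp (- sqrt s) * exp 16)) \<longlongrightarrow> 0) at_top"
        using W c by real_asymp
      from order_tendstoD(2)[OF this, of \<delta>] \<delta>
      show "\<forall>\<^sub>F s in at_top. s\<^sup>2 * (c * (2 * (W / s ^ 3)) + c * exp (- sqrt s) * exp 16) \<le> \<delta>"
        by (auto elim: eventually_mono)
      show "\<forall>\<^sub>F s in at_top. 1 \<le> b * s" using ab by real_asymp
      show "\<forall>\<^sub>F s in at_top. 1 \<le> \<epsilon> * s\<^sup>2" using \<epsilon> by real_asymp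
      have "((\<lambda>s. c * (exp (Z / s) - 1)) \<longlongrightarrow> 0) at_top" using Z c by real_asymp
      from order_tendstoD(2)[OF this, of \<delta>] \<delta> show "\<forall>\<^sub>F s in at_top. c * (exp (Z / s) - 1) \<le> \<delta>"
        by (auto elim: eventually_mono)
    qed
    moreover have "filterlim (\<lambda>n. sqrt (real (Suc n))) at_top sequentially" by real_asymp
    ultimately have "\<forall>\<^sub>F n in sequentially. good (sqrt (real (Suc n)))"
      by (rule eventually_compose_filterlim)
    then show ?case
    proof eventually_elim
      case (elim n)
      define s where "s = sqrt (real (Suc n))"
      define r0 where "r0 = nat \<lceil>\<epsilon> * s\<^sup>2\<rceil>"
      have s2: "s\<^sup>2 = real (Suc n)" "s > 0" by (auto simp: s_def)
      have s1: "s \<ge> 1" by (simp add: s_def)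
      note g = elim[folded s_def, unfolded good_def]
      have r0: "\<epsilon> * s\<^sup>2 \<le> real r0" "real r0 \<le> 2 * \<epsilon> * s\<^sup>2" "real r0 \<ge> 1"
        using g unfolding r0_def by linarith+
      have eps_s: "0 < \<epsilon> * s\<^sup>2" using \<epsilon> s2 by simp
      have "r0 \<le> Suc n"
      proof -
        have "2 * \<epsilon> * s\<^sup>2 \<le> 1 * s\<^sup>2" using \<epsilon> by (intro mult_right_mono) auto
        then have "real r0 \<le> s\<^sup>2" using r0(2) by linarith
        then show ?thesis unfolding s2(1) of_nat_le_iff .
      qed
      define \<tau>0 where "\<tau>0 = real r0 / s\<^sup>2"
      have \<tau>0: "0 < \<tau>0" "\<tau>0 < \<tau>1"
      proof -
        show "0 < \<tau>0" using r0 s2(2) by (simp add: \<tau>0_def)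
        have "\<tau>0 \<le> 2 * \<epsilon>" using r0 s2(2) by (simp add: \<tau>0_def field_simps)
        then show "\<tau>0 < \<tau>1" using \<epsilon> by simp
      qed
      define l0 where "l0 = Z * s / real r0"
      have l0: "0 \<le> l0" "l0 \<le> q / s"
      proof -
        show "0 \<le> l0" using Z s2 by (simp add: l0_def)
        have "l0 \<le> Z * s / (\<epsilon> * s\<^sup>2)" unfolding l0_def using r0 Z s2(2) eps_s by (intro divide_left_mono) auto
        also have "\<dots> = q / s" using s2(2) by (simp add: q_def power2_eq_square)
        finally show "l0 \<le> q / s" .
      qed
      have l0sq: "l0\<^sup>2 \<le> q\<^sup>2 / s\<^sup>2" using power_mono[OF l0(2,1), of 2] by (simp add: power_divide)
      have E: "2 * (a + b) * s * l0\<^sup>2 / real r0 + l0 ^ 3 + 26 * l0\<^sup>2 / real r0 \<le> W / s ^ 3"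
      proof -
        have "2 * (a + b) * s * l0\<^sup>2 / real r0 \<le> 2 * (a + b) * s * (q\<^sup>2 / s\<^sup>2) / (\<epsilon> * s\<^sup>2)"
          using L s2(2) l0sq r0 eps_s by (intro frac_le mult_left_mono) auto
        also have "\<dots> = 2 * (a + b) / \<epsilon> * q\<^sup>2 / s ^ 3"
          using s2(2) \<epsilon> by (simp add: field_simps power2_eq_square power3_eq_cube)
        finally have 1: "2 * (a + b) * s * l0\<^sup>2 / real r0 \<le> 2 * (a + b) / \<epsilon> * q\<^sup>2 / s ^ 3" .
        have 2: "l0 ^ 3 \<le> q ^ 3 / s ^ 3" using power_mono[OF l0(2,1), of 3] by (simp add: power_divide)
        have "26 * l0\<^sup>2 / real r0 \<le> 26 * (q\<^sup>2 / s\<^sup>2) / (\<epsilon> * s\<^sup>2)"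
          using s2(2) l0sq r0 eps_s by (intro frac_le mult_left_mono) auto
        also have "\<dots> = 26 / \<epsilon> * q\<^sup>2 / s ^ 4"
          using s2(2) \<epsilon> by (simp add: field_simps power2_eq_square power4_eq_xxxx)
        also have "\<dots> \<le> 26 / \<epsilon> * q\<^sup>2 / s ^ 3"
          using s1 \<epsilon> by (intro divide_left_mono power_increasing) auto
        finally have 3: "26 * l0\<^sup>2 / real r0 \<le> 26 / \<epsilon> * q\<^sup>2 / s ^ 3" .
        have "W / s ^ 3 = 2 * (a + b) / \<epsilon> * q\<^sup>2 / s ^ 3 + q ^ 3 / s ^ 3 + 26 / \<epsilon> * q\<^sup>2 / s ^ 3"
          by (simp add: W_def algebra_simps add_divide_distrib power2_eq_square power3_eq_cube)
        then show ?thesis using 1 2 3 by linarith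
      qed
      have expD: "exp (- 2 * (real K * (a + b))\<^sup>2) + c * (exp (l0 * sqrt s) - 1) \<le> \<delta>"
      proof -
        have "l0 * sqrt s \<le> q / s * sqrt s" using l0 s1 by (intro mult_right_mono) auto
        also have "\<dots> = q / sqrt s" using s2(2) by (simp add: field_simps)
        finally have "c * (exp (l0 * sqrt s) - 1) \<le> c * (exp (q / sqrt s) - 1)" using c by simp
        then have "c * (exp (l0 * sqrt s) - 1) \<le> \<delta> / 2" using g by linarith
        then show ?thesis using \<open>exp (- 2 * (real K * L)\<^sup>2) < \<delta> / 2\<close> unfolding L_def by linarith
      qed
      have small: "c * exp (- (m\<^sup>2 / \<tau>0)) + 2 * \<tau>0 / m\<^sup>2 \<le> \<delta>" "(c + 1) * (8 * \<tau>0 / m\<^sup>2) \<le> \<delta>"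
        using \<tau>1(2)[OF \<tau>0] by auto
      have "\<bar>surv (- a * s) (b * s) (Suc n) n - images K a b 1 (1 / s)\<bar>
          \<le> \<delta> + (c + 1) * (8 * \<tau>0 / m\<^sup>2) + s\<^sup>2 * (c * (2 * (W / s ^ 3)) + c * exp (- sqrt s) * exp 16)"
        unfolding c_def \<tau>0_def m_def
      proof (rule surv_images_bound[OF ab s2(2,1) _ \<open>r0 \<le> Suc n\<close>])
        show "1 \<le> r0" using r0 by simp
        show "(a + b) * s \<le> real r0" using g r0 by linarith
        show "2 * (real K + 1) * (a + b) * s / real r0 \<le> 1 / 5"
          using l0 g unfolding l0_def Z_def by linarith
        show "2 * (a + b) * s * (2 * (real K + 1) * (a + b) * s / real r0)\<^sup>2 / real r0 +
            (2 * (real K + 1) * (a + b) * s / real r0) ^ 3 +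
            26 * (2 * (real K + 1) * (a + b) * s / real r0)\<^sup>2 / real r0 \<le> W / s ^ 3"
          using E unfolding l0_def Z_def .
        show "exp (- 2 * (real K * (a + b))\<^sup>2) +
            (4 * real K + 2) * (exp (2 * (real K + 1) * (a + b) * s / real r0 * sqrt s) - 1) \<le> \<delta>"
          using expD unfolding l0_def Z_def c_def .
        show "(4 * real K + 2) * exp (- ((min a b)\<^sup>2 / (real r0 / s\<^sup>2))) + 2 * (real r0 / s\<^sup>2) / (min a b)\<^sup>2 \<le> \<delta>"
          using small(1) unfolding c_def m_def \<tau>0_def .
      qed (use g in auto)
      moreover have "\<bar>images K a b 1 (1 / s) - images K a b 1 0\<bar> \<le> \<delta>"
      proof -
        have "\<bar>images K a b 1 (1 / s) - images K a b 1 0\<bar> \<le> c * (exp (Z * \<bar>1 / s - 0\<bar> / 1) - 1)"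
          unfolding c_def Z_def using ab by (intro images_shift) auto
        also have "\<dots> = c * (exp (Z / s) - 1)" using s2(2) by simp
        finally show ?thesis using g by linarith
      qed
      moreover have "s\<^sup>2 * (c * (2 * (W / s ^ 3)) + c * exp (- sqrt s) * exp 16) \<le> \<delta>" using g by blast
      ultimately have "\<bar>surv (- a * s) (b * s) (Suc n) n - images K a b 1 0\<bar> \<le> 4 * \<delta>" using small(2) by linarith
      then show ?case by (simp add: s_def \<delta>_def)
    qed
  qed
qed

section \<open>Counting maps whose walk stays in a strip\<close>

lemma sum_Pow_card:
  fixes w :: "nat \<Rightarrow> real"
  assumes "finite T"
  shows "(\<Sum>V\<in>Pow T. w (card V)) = (\<Sum>i\<le>card T. real (card T choose i) * w i)"
proof -
  have "(\<Sum>V\<in>Pow T. w (card V)) = (\<Sum>i\<in>{..card T}. \<Sum>V\<in>{V \<in> Pow T. card V = i}. w (card V))"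
    using assms by (intro sum.group[symmetric]) (auto intro: card_mono)
  also have "\<dots> = (\<Sum>i\<le>card T. real (card T choose i) * w i)"
  proof (rule sum.cong)
    fix i
    have "{V \<in> Pow T. card V = i} = {V. V \<subseteq> T \<and> card V = i}" by auto
    then have "card {V \<in> Pow T. card V = i} = card T choose i" using n_subsets[OF assms, of i] by simp
    moreover have "(\<Sum>V\<in>{V \<in> Pow T. card V = i}. w (card V)) = (\<Sum>V\<in>{V \<in> Pow T. card V = i}. w i)"
      by (rule sum.cong) auto
    ultimately show "(\<Sum>V\<in>{V \<in> Pow T. card V = i}. w (card V)) = real (card T choose i) * w i" by simp
  qed simp
  finally show ?thesis .
qed

text \<open>The cars form a set T rather than a number because removing those in the first cell
  leaves an arbitrary subset. The path starts at r - card T and ends at 0.\<close>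

definition confined :: "real \<Rightarrow> real \<Rightarrow> nat \<Rightarrow> nat set \<Rightarrow> (nat \<Rightarrow> nat) set" where
  "confined A B r T = {f \<in> T \<rightarrow>\<^sub>E {..<r}. \<forall>k\<le>r.
     A \<le> real r - real (card T) + real (card {t \<in> T. f t < k}) - real k \<and>
     real r - real (card T) + real (card {t \<in> T. f t < k}) - real k \<le> B}"

lemma finite_confined: "finite T \<Longrightarrow> finite (confined A B r T)"
  unfolding confined_def by (rule finite_subset[of _ "T \<rightarrow>\<^sub>E {..<r}"]) (auto intro: finite_PiE)

text \<open>Peel off the first cell: V collects the cars that miss it, and their values drop by 1.
  By \<open>shift\<close>, time k + 1 of the old path is time k of the new one; time 0 of the old
  path is the assumption on A and B.\<close>

lemma confined_Suc:
  assumes T: "finite T" and k0: "A \<le> real (Suc r) - real (card T)" "real (Suc r) - real (card T) \<le> B"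
  shows "card (confined A B (Suc r) T) = (\<Sum>V\<in>Pow T. card (confined A B r V))"
proof -
  have shift: "real (Suc r) - real (card T) + real (card {t \<in> T. f t < Suc k}) - real (Suc k)
      = real r - real (card V) + real (card {t \<in> V. g t < k}) - real k"
    if "V \<subseteq> T" "\<And>t. t \<in> T \<Longrightarrow> f t = (if t \<in> V then Suc (g t) else 0)" for f g V k
  proof -
    have "{t \<in> T. f t < Suc k} = (T - V) \<union> {t \<in> V. g t < k}" using that by auto
    moreover have "card ((T - V) \<union> {t \<in> V. g t < k}) = card (T - V) + card {t \<in> V. g t < k}"
      using T that(1) by (intro card_Un_disjoint) (auto intro: finite_subset)
    moreover have "card T = card (T - V) + card V"
      using card_Diff_subset[OF finite_subset[OF that(1) T] that(1)] card_mono[OF T that(1)] by simp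
    ultimately show ?thesis by simp
  qed
  define F where "F = (\<lambda>f. ({t \<in> T. f t \<noteq> 0}, \<lambda>t\<in>{t \<in> T. f t \<noteq> 0}. (f t :: nat) - 1))"
  define G where "G = (\<lambda>(V, g). \<lambda>t\<in>T. if t \<in> V then Suc (g t) else 0)"
  have "bij_betw F (confined A B (Suc r) T) (Sigma (Pow T) (confined A B r))"
  proof (rule bij_betw_byWitness[where f' = G])
    show "\<forall>f\<in>confined A B (Suc r) T. G (F f) = f"
    proof (intro ballI ext)
      fix f t assume "f \<in> confined A B (Suc r) T"
      then have "f \<in> extensional T" by (simp add: confined_def PiE_def)
      then have "t \<notin> T \<Longrightarrow> f t = undefined" by (rule extensional_arb)
      then show "G (F f) t = f t" by (cases "t \<in> T") (simp_all add: F_def G_def)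
    qed
    show "\<forall>p\<in>Sigma (Pow T) (confined A B r). F (G p) = p"
    proof (clarify)
      fix V g assume V: "V \<subseteq> T" and g: "g \<in> confined A B r V"
      have "{t \<in> T. G (V, g) t \<noteq> 0} = V" using V by (auto simp: G_def)
      moreover have "(\<lambda>t\<in>V. G (V, g) t - 1) = g"
      proof
        fix t
        have "g \<in> extensional V" using g by (simp add: confined_def PiE_def)
        then have "t \<notin> V \<Longrightarrow> g t = undefined" by (rule extensional_arb)
        then show "(\<lambda>t\<in>V. G (V, g) t - 1) t = g t"
          using V by (cases "t \<in> V") (auto simp: G_def)
      qed
      ultimately show "F (G (V, g)) = (V, g)" by (simp add: F_def)
    qed
    show "F ` confined A B (Suc r) T \<subseteq> Sigma (Pow T) (confined A B r)"
    proof (rule image_subsetI)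
      fix f assume f: "f \<in> confined A B (Suc r) T"
      define V where V: "V = {t \<in> T. f t \<noteq> 0}"
      define g where g: "g = (\<lambda>t\<in>V. f t - 1)"
      have fg: "f t = (if t \<in> V then Suc (g t) else 0)" if "t \<in> T" for t using that by (auto simp: V g)
      have VT: "V \<subseteq> T" by (auto simp: V)
      have "g \<in> V \<rightarrow>\<^sub>E {..<r}" using f by (auto simp: confined_def g V PiE_iff)
      moreover have "A \<le> real r - real (card V) + real (card {t \<in> V. g t < k}) - real k \<and>
        real r - real (card V) + real (card {t \<in> V. g t < k}) - real k \<le> B" if "k \<le> r" for k
      proof -
        have "\<forall>k\<le>Suc r. A \<le> real (Suc r) - real (card T) + real (card {t \<in> T. f t < k}) - real k \<and>
            real (Suc r) - real (card T) + real (card {t \<in> T. f t < k}) - real k \<le> B"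
          using f unfolding confined_def mem_Collect_eq by (rule conjunct2)
        then have "A \<le> real (Suc r) - real (card T) + real (card {t \<in> T. f t < Suc k}) - real (Suc k) \<and>
            real (Suc r) - real (card T) + real (card {t \<in> T. f t < Suc k}) - real (Suc k) \<le> B"
          using that by blast
        moreover have "real (Suc r) - real (card T) + real (card {t \<in> T. f t < Suc k}) - real (Suc k)
            = real r - real (card V) + real (card {t \<in> V. g t < k}) - real k"
          by (rule shift[OF VT fg])
        ultimately show ?thesis by (simp only:)
      qed
      ultimately have "(V, g) \<in> Sigma (Pow T) (confined A B r)" using VT by (auto simp: confined_def)
      then show "F f \<in> Sigma (Pow T) (confined A B r)" by (simp add: F_def V g)
    qed
    show "G ` Sigma (Pow T) (confined A B r) \<subseteq> confined A B (Suc r) T"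
    proof (clarify)
      fix V g assume VT: "V \<subseteq> T" and g: "g \<in> confined A B r V"
      define f where "f = G (V, g)"
      have fg: "f t = (if t \<in> V then Suc (g t) else 0)" if "t \<in> T" for t using that by (auto simp: f_def G_def)
      have "f \<in> T \<rightarrow>\<^sub>E {..<Suc r}" using g VT by (auto simp: confined_def f_def G_def PiE_iff)
      moreover have "A \<le> real (Suc r) - real (card T) + real (card {t \<in> T. f t < k}) - real k \<and>
        real (Suc r) - real (card T) + real (card {t \<in> T. f t < k}) - real k \<le> B" if "k \<le> Suc r" for k
      proof (cases k)
        case 0
        then show ?thesis using k0 by simp
      next
        case (Suc k')
        have "\<forall>k\<le>r. A \<le> real r - real (card V) + real (card {t \<in> V. g t < k}) - real k \<and>
            real r - real (card V) + real (card {t \<in> V. g t < k}) - real k \<le> B"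
          using g unfolding confined_def mem_Collect_eq by (rule conjunct2)
        then have "A \<le> real r - real (card V) + real (card {t \<in> V. g t < k'}) - real k' \<and>
            real r - real (card V) + real (card {t \<in> V. g t < k'}) - real k' \<le> B"
          using that Suc by blast
        moreover have "real (Suc r) - real (card T) + real (card {t \<in> T. f t < Suc k'}) - real (Suc k')
            = real r - real (card V) + real (card {t \<in> V. g t < k'}) - real k'"
          by (rule shift[OF VT fg])
        ultimately show ?thesis unfolding Suc by (simp only:)
      qed
      ultimately show "G (V, g) \<in> confined A B (Suc r) T" by (auto simp: confined_def f_def)
    qed
  qed
  then have "card (confined A B (Suc r) T) = card (Sigma (Pow T) (confined A B r))"
    by (rule bij_betw_same_card)
  also have "\<dots> = (\<Sum>V\<in>Pow T. card (confined A B r V))"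
    using T by (intro card_SigmaI) (auto intro!: finite_confined intro: finite_subset)
  finally show ?thesis .
qed

lemma card_confined:
  assumes "finite T" "A \<le> 0" "0 \<le> B"
  shows "real (card (confined A B r T)) = real r ^ card T * surv A B r (card T)"
  using assms(1)
proof (induction r arbitrary: T)
  case 0
  then show ?case
  proof (cases "T = {}")
    case True
    \<comment> \<open>Without cells and cars the path is the single value 0, so A \<le> 0 \<le> B
      enters here.\<close>
    then have "confined A B 0 T = {\<lambda>x. undefined}" using assms by (auto simp: confined_def)
    then show ?thesis using True by simp
  next
    case False
    then have "confined A B 0 T = {}" by (auto simp: confined_def PiE_eq_empty_iff)
    then show ?thesis using False 0 by (simp add: card_gt_0_iff)
  qed
next
  case (Suc r)
  let ?j = "card T"
  show ?case
  proof (cases "A \<le> real (Suc r) - real ?j \<and> real (Suc r) - real ?j \<le> B")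
    case True
    have "real (card (confined A B (Suc r) T)) = (\<Sum>V\<in>Pow T. real r ^ card V * surv A B r (card V))"
      using confined_Suc[OF Suc.prems, of A r B] True Suc.IH
        by (auto intro!: sum.cong dest: finite_subset[OF _ Suc.prems])
    also have "\<dots> = (\<Sum>i\<le>?j. real (?j choose i) * (real r ^ i * surv A B r i))"
      by (rule sum_Pow_card[OF Suc.prems])
    also have "\<dots> = real (Suc r) ^ ?j * step r ?j (surv A B r)"
      unfolding step_def sum_distrib_left
    proof (rule sum.cong)
      fix i assume "i \<in> {..?j}"
      then have "real (Suc r) ^ ?j = real (Suc r) ^ i * real (Suc r) ^ (?j - i)"
        by (simp flip: power_add)
      moreover have "1 - real r / real (Suc r) = 1 / real (Suc r)" by (simp add: field_simps)
      ultimately show "real (?j choose i) * (real r ^ i * surv A B r i)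
        = real (Suc r) ^ ?j * (Bernstein ?j i (real r / real (Suc r)) * surv A B r i)"
        unfolding Bernstein_def by (simp only:) (simp add: power_divide)
    qed simp
    finally show ?thesis using True by simp
  next
    case False
    have "A \<le> real (Suc r) - real ?j \<and> real (Suc r) - real ?j \<le> B" if "f \<in> confined A B (Suc r) T" for f
      using that unfolding confined_def by (auto dest!: spec[of _ 0])
    then have "confined A B (Suc r) T = {}" using False by auto
    then show ?thesis using False by (auto simp del: of_nat_Suc)
  qed
qed

section \<open>The spread of the walk\<close>

definition paths :: "nat \<Rightarrow> (nat \<Rightarrow> nat) set" where
  "paths n = {..<n} \<rightarrow>\<^sub>E {..<Suc n}"

text \<open>This is the position r - j of \<open>surv\<close> after k cells, from r = n + 1 and j =
  n; hence the start at 1 and the end at 0.\<close>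

definition walk :: "nat \<Rightarrow> (nat \<Rightarrow> nat) \<Rightarrow> nat \<Rightarrow> real" where
  "walk n f k = 1 + real (card {t. t < n \<and> f t < k}) - real k"

definition range_low :: "nat \<Rightarrow> (nat \<Rightarrow> nat) \<Rightarrow> real" where
  "range_low n f = Min (walk n f ` {..Suc n})"

definition range_high :: "nat \<Rightarrow> (nat \<Rightarrow> nat) \<Rightarrow> real" where
  "range_high n f = Max (walk n f ` {..Suc n})"

definition spread :: "nat \<Rightarrow> (nat \<Rightarrow> nat) \<Rightarrow> real" where
  "spread n f = range_high n f - range_low n f"

lemma finite_paths [simp]: "finite (paths n)"
  by (simp add: paths_def finite_PiE)

lemma card_paths: "card (paths n) = Suc n ^ n"
  by (simp add: paths_def card_PiE)

lemma walk_0 [simp]: "walk n f 0 = 1"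
  by (simp add: walk_def)

lemma walk_last: "f \<in> paths n \<Longrightarrow> walk n f (Suc n) = 0"
proof -
  assume "f \<in> paths n"
  then have "{t. t < n \<and> f t < Suc n} = {..<n}" by (auto simp: paths_def)
  then show ?thesis by (simp add: walk_def)
qed

lemma range_low_le: "f \<in> paths n \<Longrightarrow> range_low n f \<le> 0"
  unfolding range_low_def using walk_last[of f n] by (intro Min_le) (auto simp: image_iff intro!: bexI[of _ "Suc n"])

lemma range_high_ge: "1 \<le> range_high n f"
  unfolding range_high_def by (intro Max_ge) (auto simp: image_iff intro!: bexI[of _ 0])

lemma range_low_ge_iff: "c \<le> range_low n f \<longleftrightarrow> (\<forall>k\<le>Suc n. c \<le> walk n f k)"
  unfolding range_low_def by (subst Min_ge_iff) auto

lemma range_high_le_iff: "range_high n f \<le> c \<longleftrightarrow> (\<forall>k\<le>Suc n. walk n f k \<le> c)"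
  unfolding range_high_def by (subst Max_le_iff) auto

lemma card_paths_strip:
  assumes "A \<le> 0" "0 \<le> B"
  shows "real (card {f \<in> paths n. A \<le> range_low n f \<and> range_high n f \<le> B})
     = real (card (paths n)) * surv A B (Suc n) n"
proof -
  have "{f \<in> paths n. A \<le> range_low n f \<and> range_high n f \<le> B} = confined A B (Suc n) {..<n}"
    unfolding confined_def range_low_ge_iff range_high_le_iff walk_def paths_def by auto
  then show ?thesis using card_confined[of "{..<n}" A B "Suc n"] assms by (simp add: card_paths)
qed

text \<open>Exchange the sum over f with the integral over x: the path of f stays in the strip
  exactly for x in \<open>?I f\<close>, an interval of length t - spread/s, empty if this is
  negative. Since \<open>range_low\<close> \<le> 0 and \<open>range_high\<close> \<ge> 1, it lies in
  the half-open interval {0..<t}.\<close>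

lemma surv_integral:
  assumes "t > 0" "s > 0"
  shows "(LBINT x. indicator {0..<t} x * surv (- x * s) ((t - x) * s) (Suc n) n)
     = (\<Sum>f\<in>paths n. max 0 (t - spread n f / s)) / real (card (paths n))"
    and "(\<lambda>x. indicator {0..<t} x * surv (- x * s) ((t - x) * s) (Suc n) n) \<in> borel_measurable borel"
proof -
  let ?I = "\<lambda>f. {- range_low n f / s .. t - range_high n f / s}"
  have cp: "real (card (paths n)) > 0" by (simp add: card_paths)
  have ind: "indicator {0..<t} x * surv (- x * s) ((t - x) * s) (Suc n) n
     = (\<Sum>f\<in>paths n. indicator (?I f) x) / real (card (paths n))" for x :: real
  proof (cases "x \<in> {0..<t}")
    case True
    have "real (card (paths n)) * surv (- x * s) ((t - x) * s) (Suc n) n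
        = real (card {f \<in> paths n. - x * s \<le> range_low n f \<and> range_high n f \<le> (t - x) * s})"
      using True assms by (intro card_paths_strip[symmetric]) auto
    also have "\<dots> = (\<Sum>f\<in>paths n. indicator (?I f) x)"
    proof -
      have "x \<in> ?I f \<longleftrightarrow> - x * s \<le> range_low n f \<and> range_high n f \<le> (t - x) * s" for f
        using assms(2) by (auto simp: field_simps)
      then have "(\<Sum>f\<in>paths n. indicator (?I f) x) = (\<Sum>f\<in>paths n. if - x * s \<le> range_low n f \<and> range_high n f \<le> (t - x) * s then 1 else (0::real))"
        by (intro sum.cong) (auto simp: indicator_def)
      also have "\<dots> = real (card {f \<in> paths n. - x * s \<le> range_low n f \<and> range_high n f \<le> (t - x) * s})"
        by (simp add: sum.If_cases Int_def)
      finally show ?thesis by simp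
    qed
    finally have eq: "real (card (paths n)) * surv (- x * s) ((t - x) * s) (Suc n) n = (\<Sum>f\<in>paths n. indicator (?I f) x)" .
    have "surv (- x * s) ((t - x) * s) (Suc n) n
        = real (card (paths n)) * surv (- x * s) ((t - x) * s) (Suc n) n / real (card (paths n))"
      using cp by (subst nonzero_mult_div_cancel_left) auto
    then show ?thesis using True unfolding eq by (simp del: surv.simps)
  next
    case False
    have "indicator (?I f) x = (0::real)" if f: "f \<in> paths n" for f
    proof -
      have "0 \<le> - range_low n f / s" using range_low_le[OF f] assms by (intro divide_nonneg_pos) auto
      moreover have "t - range_high n f / s < t" using range_high_ge[of n f] assms by simp
      ultimately have "x \<notin> ?I f" using False by auto
      then show ?thesis by simp
    qed
    then show ?thesis using False by simp
  qed
  show "(\<lambda>x. indicator {0..<t} x * surv (- x * s) ((t - x) * s) (Suc n) n) \<in> borel_measurable borel"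
    unfolding ind by measurable
  have int: "(LBINT x. indicator (?I f) x) = max 0 (t - spread n f / s)" for f
  proof -
    have "t - spread n f / s = (t - range_high n f / s) - (- range_low n f / s)"
      by (simp add: spread_def diff_divide_distrib)
    then show ?thesis
      by (cases "- range_low n f / s \<le> t - range_high n f / s") auto
  qed
  show "(LBINT x. indicator {0..<t} x * surv (- x * s) ((t - x) * s) (Suc n) n)
     = (\<Sum>f\<in>paths n. max 0 (t - spread n f / s)) / real (card (paths n))"
  proof -
    have "(LBINT x. (\<Sum>f\<in>paths n. indicator (?I f) x) / real (card (paths n)))
        = (LBINT x. (\<Sum>f\<in>paths n. indicator (?I f) x)) / real (card (paths n))"
      by (rule integral_divide_zero)
    also have "(LBINT x. (\<Sum>f\<in>paths n. indicator (?I f) x)) = (\<Sum>f\<in>paths n. LBINT x. indicator (?I f) x :: real)"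
      by (rule Bochner_Integration.integral_sum, rule integrable_real_indicator)
         (simp_all add: emeasure_lborel_Icc_eq)
    finally show ?thesis unfolding ind int .
  qed
qed

section \<open>The limit of the mean excess, by integrating image sums over the strip
  position\<close>

definition theta :: "real \<Rightarrow> real" where
  "theta t = 1 + 2 * (\<Sum>k. exp (- 2 * (real (Suc k) * t)\<^sup>2))"

lemma sum_symmetric:
  fixes f :: "int \<Rightarrow> real"
  assumes "\<And>k. f (- k) = f k"
  shows "(\<Sum>k\<in>{- int K..int K}. f k) = f 0 + 2 * (\<Sum>k<K. f (int (Suc k)))"
proof (induction K)
  case (Suc K)
  have "{- int (Suc K)..int (Suc K)} = insert (- int (Suc K)) (insert (int (Suc K)) {- int K..int K})"
    by auto
  then show ?case using Suc assms[of "1 + int K"] by (simp add: algebra_simps)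
qed simp

lemma exp_square_le_geometric:
  assumes "0 < d" "d \<le> t"
  shows "exp (- (real (Suc k) * t)\<^sup>2) \<le> exp (- d\<^sup>2) ^ Suc k"
proof -
  have "real (Suc k) * d\<^sup>2 \<le> (real (Suc k) * t)\<^sup>2"
    unfolding power_mult_distrib using assms
    by (intro mult_mono power_mono) (auto simp: power2_eq_square algebra_simps)
  moreover have "exp (- d\<^sup>2) ^ Suc k = exp (- (real (Suc k) * d\<^sup>2))"
    by (simp only: flip: exp_of_nat_mult) simp
  ultimately show ?thesis by simp
qed

lemma summable_theta: "t > 0 \<Longrightarrow> summable (\<lambda>k. exp (- 2 * (real (Suc k) * t)\<^sup>2))"
proof (rule summable_comparison_test')
  assume t: "t > 0"
  show "summable (\<lambda>k. exp (- t\<^sup>2) ^ Suc k)"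
    unfolding summable_Suc_iff using t by (intro summable_geometric) simp
  show "norm (exp (- 2 * (real (Suc k) * t)\<^sup>2)) \<le> exp (- t\<^sup>2) ^ Suc k" for k
  proof -
    have "exp (- 2 * (real (Suc k) * t)\<^sup>2) \<le> exp (- (real (Suc k) * t)\<^sup>2)" by simp
    also have "\<dots> \<le> exp (- t\<^sup>2) ^ Suc k" by (rule exp_square_le_geometric) (use t in auto)
    finally show ?thesis by simp
  qed
qed

lemma theta_lim:
  assumes "t > 0"
  shows "(\<lambda>K. \<Sum>k\<in>{- int K..int K}. exp (- 2 * (of_int k * t)\<^sup>2)) \<longlonglongrightarrow> theta t"
proof -
  have "(\<lambda>K. \<Sum>k\<in>{- int K..int K}. exp (- 2 * (of_int k * t)\<^sup>2)) =
        (\<lambda>K. 1 + 2 * (\<Sum>k<K. exp (- 2 * (real (Suc k) * t)\<^sup>2)))"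
    by (rule ext, subst sum_symmetric) auto
  then show ?thesis unfolding theta_def
    by (simp only:) (intro tendsto_intros summable_LIMSEQ summable_theta assms)
qed

lemma images_0: "images K a b 1 0 =
   (\<Sum>k\<in>{- int K..int K}. exp (- 2 * (of_int k * (a + b))\<^sup>2)) -
   (\<Sum>k\<in>{- int K..int K}. exp (- 2 * (b + of_int k * (a + b))\<^sup>2))"
proof -
  have "kern (2 * w) 1 0 = exp (- 2 * w\<^sup>2)" for w
    by (simp add: kern_def power2_eq_square)
  from this[of "of_int _ * (a + b)"] this[of "b + of_int _ * (a + b)"] show ?thesis
    by (simp add: images_def sum_subtractf distrib_left mult.assoc)
qed

lemma tendsto_double_limit:
  fixes g :: "nat \<Rightarrow> real" and h :: "nat \<Rightarrow> real"
  assumes "\<And>e. e > 0 \<Longrightarrow> \<forall>\<^sub>F K in sequentially. \<forall>\<^sub>F n in sequentially. \<bar>g n - h K\<bar> \<le> e"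
    and h: "h \<longlonglongrightarrow> l"
  shows "g \<longlonglongrightarrow> l"
proof (rule LIMSEQ_I)
  fix e :: real assume e: "e > 0"
  have "\<forall>\<^sub>F K in sequentially. dist (h K) l < e / 2" using h e by (intro tendstoD) auto
  moreover have "\<forall>\<^sub>F K in sequentially. \<forall>\<^sub>F n in sequentially. \<bar>g n - h K\<bar> \<le> e / 2"
    using e by (intro assms) auto
  ultimately have "\<forall>\<^sub>F K in sequentially. dist (h K) l < e / 2 \<and> (\<forall>\<^sub>F n in sequentially. \<bar>g n - h K\<bar> \<le> e / 2)"
    by (rule eventually_conj)
  from eventually_happens'[OF sequentially_bot this]
  obtain K where K: "dist (h K) l < e / 2" "\<forall>\<^sub>F n in sequentially. \<bar>g n - h K\<bar> \<le> e / 2"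
    by blast
  from K(2) have "\<forall>\<^sub>F n in sequentially. norm (g n - l) < e"
  proof eventually_elim
    case (elim n)
    have "\<bar>g n - l\<bar> \<le> \<bar>g n - h K\<bar> + \<bar>h K - l\<bar>" by linarith
    then show ?case using elim K(1) unfolding dist_real_def real_norm_def by linarith
  qed
  then show "\<exists>no. \<forall>n\<ge>no. norm (g n - l) < e" by (simp add: eventually_sequentially)
qed

text \<open>All late h K are close to the same g n, hence to each other. Convergence of the
  reflected sums in K is thus read off from the survival probabilities instead of from estimates of
  their terms.\<close>

lemma tendsto_double_Cauchy:
  fixes g :: "nat \<Rightarrow> real" and h :: "nat \<Rightarrow> real"
  assumes "\<And>e. e > 0 \<Longrightarrow> \<forall>\<^sub>F K in sequentially. \<forall>\<^sub>F n in sequentially. \<bar>g n - h K\<bar> \<le> e"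
  shows "convergent h"
proof -
  have "Cauchy h"
  proof (rule metric_CauchyI)
    fix e :: real assume e: "e > 0"
    obtain K0 where K0: "\<And>K. K \<ge> K0 \<Longrightarrow> \<forall>\<^sub>F n in sequentially. \<bar>g n - h K\<bar> \<le> e / 3"
      using assms[of "e / 3"] e unfolding eventually_sequentially by auto
    have "dist (h m) (h n) < e" if mn: "m \<ge> K0" "n \<ge> K0" for m n
    proof -
      have "\<forall>\<^sub>F i in sequentially. \<bar>g i - h m\<bar> \<le> e / 3 \<and> \<bar>g i - h n\<bar> \<le> e / 3"
        using K0[OF mn(1)] K0[OF mn(2)] by (rule eventually_conj)
      from eventually_happens'[OF sequentially_bot this]
      obtain i where "\<bar>g i - h m\<bar> \<le> e / 3" "\<bar>g i - h n\<bar> \<le> e / 3"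
        by blast
      then show ?thesis using e unfolding dist_real_def by linarith
    qed
    then show "\<exists>M. \<forall>m\<ge>M. \<forall>n\<ge>M. dist (h m) (h n) < e" by blast
  qed
  then show ?thesis by (rule Cauchy_convergent)
qed

text \<open>The total weight of the odd images, independent of the width t and so invisible after
  differentiation.\<close>

definition gauss_mass :: real where
  "gauss_mass = (LBINT u. exp (- 2 * u\<^sup>2))"

lemma integrable_gauss: "integrable lborel (\<lambda>u :: real. exp (- 2 * u\<^sup>2))"
proof -
  have "(\<lambda>u :: real. exp (- 2 * u\<^sup>2)) = (\<lambda>u. sqrt (2 * pi * (1 / 2)\<^sup>2) * normal_density 0 (1 / 2) u)"
    by (auto simp: normal_density_def fun_eq_iff power2_eq_square)
  then show ?thesis by (simp only:) (intro integrable_mult_right integrable_normal_density, simp)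
qed

lemma integrable_gauss_indicator:
  assumes "A \<in> sets borel"
  shows "integrable lborel (\<lambda>u :: real. indicator A u * exp (- 2 * u\<^sup>2))"
proof -
  have "A \<in> sets lborel" using assms by simp
  from integrable_real_mult_indicator[OF this integrable_gauss] show ?thesis
    by (subst mult.commute)
qed

text \<open>The substitution u = (k + 1) t - x carries {0..<t} onto a half-open block of length t.
  The blocks for all k tile the line, so the reflected terms add up to one full Gauss
  integral.\<close>

lemma reflected_gauss_integral:
  fixes t :: real and k :: int
  shows "integrable lborel (\<lambda>x. indicator {0..<t} x * exp (- 2 * ((t - x) + of_int k * t)\<^sup>2))"
    and "(LBINT x. indicator {0..<t} x * exp (- 2 * ((t - x) + of_int k * t)\<^sup>2))
      = (LBINT u. indicator {of_int k * t<..of_int (k + 1) * t} u * exp (- 2 * u\<^sup>2))"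
proof -
  let ?f = "\<lambda>u. indicator {of_int k * t<..of_int (k + 1) * t} u * exp (- 2 * u\<^sup>2) :: real"
  have eq: "?f (of_int (k + 1) * t + (- 1) * x) = indicator {0..<t} x * exp (- 2 * ((t - x) + of_int k * t)\<^sup>2)" for x
    by (auto simp: indicator_def algebra_simps)
  have int: "integrable lborel ?f"
    by (rule integrable_gauss_indicator) simp
  show "integrable lborel (\<lambda>x. indicator {0..<t} x * exp (- 2 * ((t - x) + of_int k * t)\<^sup>2))"
    using lborel_integrable_real_affine[OF int, of "- 1" "of_int (k + 1) * t"] unfolding eq by simp
  show "(LBINT x. indicator {0..<t} x * exp (- 2 * ((t - x) + of_int k * t)\<^sup>2)) = integral\<^sup>L lborel ?f"
    using lborel_integral_real_affine[of "- 1" ?f "of_int (k + 1) * t"] unfolding eq by simp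
qed

lemma sum_indicator_blocks:
  fixes t :: real
  assumes "t > 0"
  shows "(\<Sum>k\<in>{- int K..int K}. indicator {of_int k * t<..of_int (k + 1) * t} u)
    = (indicator {- real K * t<..(real K + 1) * t} u :: real)"
proof (induction K)
  case (Suc K)
  have "{- int (Suc K)..int (Suc K)} = insert (- int (Suc K)) (insert (int (Suc K)) {- int K..int K})"
    by auto
  then have "(\<Sum>k\<in>{- int (Suc K)..int (Suc K)}. indicator {of_int k * t<..of_int (k + 1) * t} u)
    = indicator {(- 1 - real K) * t<..- real K * t} u + (indicator {(real K + 1) * t<..(real K + 2) * t} u
      + (indicator {- real K * t<..(real K + 1) * t} u :: real))"
    using Suc by (simp add: algebra_simps)
  also have "\<dots> = indicator {(- 1 - real K) * t<..(real K + 2) * t} u"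
  proof -
    have "(- 1 - real K) * t \<le> - real K * t" "- real K * t \<le> (real K + 1) * t" "(real K + 1) * t \<le> (real K + 2) * t"
      using assms by (simp_all only: mult_le_cancel_right_pos)
    then show ?thesis by (auto simp: indicator_def)
  qed
  finally show ?case by (simp add: algebra_simps)
qed simp

lemma reflected_gauss_sum_lim:
  assumes t: "t > 0"
  shows "(\<lambda>K. LBINT x. indicator {0..<t} x * (\<Sum>k\<in>{- int K..int K}. exp (- 2 * ((t - x) + of_int k * t)\<^sup>2)))
     \<longlonglongrightarrow> gauss_mass"
proof -
  have "(LBINT x. indicator {0..<t} x * (\<Sum>k\<in>{- int K..int K}. exp (- 2 * ((t - x) + of_int k * t)\<^sup>2)))
     = (LBINT u. indicator {- real K * t<..(real K + 1) * t} u * exp (- 2 * u\<^sup>2))" for K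
  proof -
    have "(LBINT x. indicator {0..<t} x * (\<Sum>k\<in>{- int K..int K}. exp (- 2 * ((t - x) + of_int k * t)\<^sup>2)))
      = (\<Sum>k\<in>{- int K..int K}. LBINT x. indicator {0..<t} x * exp (- 2 * ((t - x) + of_int k * t)\<^sup>2))"
      unfolding sum_distrib_left by (rule Bochner_Integration.integral_sum) (rule reflected_gauss_integral)
    also have "\<dots> = (\<Sum>k\<in>{- int K..int K}. LBINT u. indicator {of_int k * t<..of_int (k + 1) * t} u * exp (- 2 * u\<^sup>2))"
      by (simp only: reflected_gauss_integral(2))
    also have "\<dots> = (LBINT u. (\<Sum>k\<in>{- int K..int K}. indicator {of_int k * t<..of_int (k + 1) * t} u * exp (- 2 * u\<^sup>2)))"
      by (rule Bochner_Integration.integral_sum[symmetric])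
         (rule integrable_gauss_indicator, simp)
    also have "\<dots> = (LBINT u. indicator {- real K * t<..(real K + 1) * t} u * exp (- 2 * u\<^sup>2))"
      unfolding sum_distrib_right[symmetric] sum_indicator_blocks[OF t] ..
    finally show ?thesis .
  qed
  moreover have "(\<lambda>K. LBINT u. indicator {- real K * t<..(real K + 1) * t} u * exp (- 2 * u\<^sup>2)) \<longlonglongrightarrow> gauss_mass"
    unfolding gauss_mass_def
  proof (rule integral_dominated_convergence[where w = "\<lambda>u. exp (- 2 * u\<^sup>2)"])
    show "AE u in lborel. (\<lambda>K. indicator {- real K * t<..(real K + 1) * t} u * exp (- 2 * u\<^sup>2)) \<longlonglongrightarrow> exp (- 2 * u\<^sup>2)"
    proof (rule AE_I2)
      fix u :: real
      have "\<forall>\<^sub>F K in sequentially. - real K * t < u" "\<forall>\<^sub>F K in sequentially. u \<le> (real K + 1) * t"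
        using t by real_asymp+
      then have "\<forall>\<^sub>F K in sequentially. indicator {- real K * t<..(real K + 1) * t} u * exp (- 2 * u\<^sup>2) = exp (- 2 * u\<^sup>2)"
        by eventually_elim simp
      then show "(\<lambda>K. indicator {- real K * t<..(real K + 1) * t} u * exp (- 2 * u\<^sup>2)) \<longlonglongrightarrow> exp (- 2 * u\<^sup>2)"
        by (rule tendsto_eventually)
    qed
    show "AE u in lborel. norm (indicator {- real K * t<..(real K + 1) * t} u * exp (- 2 * u\<^sup>2)) \<le> exp (- 2 * u\<^sup>2)" for K
      by (rule AE_I2) (auto simp: indicator_def)
  qed (use integrable_gauss in auto)
  ultimately show ?thesis by simp
qed

text \<open>Take a = x and b = t - x. The even images then give \<open>theta t\<close> whatever x
  is, and only the odd ones, T, depend on x. Survival probabilities are dominated by 1 on {0..<t}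
  and T increases with K, so dominated convergence in n and monotone convergence in K pass both
  limits under the integral.\<close>

lemma mean_excess_lim:
  assumes t: "t > 0"
  shows "(\<lambda>n. (\<Sum>f\<in>paths n. max 0 (t - spread n f / sqrt (real (Suc n)))) / real (card (paths n)))
     \<longlonglongrightarrow> t * theta t - gauss_mass"
proof -
  define g where "g n x = surv (- x * sqrt (real (Suc n))) ((t - x) * sqrt (real (Suc n))) (Suc n) n" for n x
  define S where "S K = (\<Sum>k\<in>{- int K..int K}. exp (- 2 * (of_int k * t)\<^sup>2))" for K
  define T where "T K x = (\<Sum>k\<in>{- int K..int K}. exp (- 2 * ((t - x) + of_int k * t)\<^sup>2))" for K x
  have S: "S \<longlonglongrightarrow> theta t" unfolding S_def by (rule theta_lim[OF t])
  have ev: "\<forall>\<^sub>F K in sequentially. \<forall>\<^sub>F n in sequentially. \<bar>g n x - (S K - T K x)\<bar> \<le> e"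
    if "0 < x" "x < t" "e > 0" for x e
    using surv_images_eventually[of x "t - x" e] that by (simp add: g_def S_def T_def images_0)
  have T: "\<exists>l. (\<lambda>K. T K x) \<longlonglongrightarrow> l" if x: "0 < x" "x < t" for x
  proof -
    obtain l where "(\<lambda>K. S K - T K x) \<longlonglongrightarrow> l"
      using tendsto_double_Cauchy[OF ev[OF x]] unfolding convergent_def by blast
    then have "(\<lambda>K. S K - (S K - T K x)) \<longlonglongrightarrow> theta t - l" by (intro tendsto_diff S)
    then show ?thesis by auto
  qed
  define W where "W x = lim (\<lambda>K. T K x)" for x
  have W: "(\<lambda>K. T K x) \<longlonglongrightarrow> W x" if "0 < x" "x < t" for x
    using T[OF that] unfolding W_def by (simp add: convergent_LIMSEQ_iff[symmetric] convergent_def)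
  have gW: "(\<lambda>n. g n x) \<longlonglongrightarrow> theta t - W x" if "0 < x" "x < t" for x
    using tendsto_double_limit[OF ev[OF that]] tendsto_diff[OF S W[OF that]] by blast
  have meas_T: "T K \<in> borel_measurable borel" for K unfolding T_def by measurable
  have meas_W: "W \<in> borel_measurable borel" unfolding W_def using meas_T by measurable
  \<comment> \<open>At x = 0 the lower wall touches the starting point, while the strip limit
    requires a > 0.\<close>
  have AE0: "AE x in lborel. x \<noteq> (0 :: real)" by (rule AE_lborel_singleton)
  have limT: "(\<lambda>K. LBINT x. indicator {0..<t} x * T K x) \<longlonglongrightarrow> gauss_mass"
    unfolding T_def by (rule reflected_gauss_sum_lim[OF t])
  have intT: "integrable lborel (\<lambda>x. indicator {0..<t} x * T K x)" for K
    unfolding T_def sum_distrib_left by (intro Bochner_Integration.integrable_sum reflected_gauss_integral)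
  have monoT: "T K x \<le> T K' x" if "K \<le> K'" for K K' x
    unfolding T_def using that by (intro sum_mono2) auto
  have AE_mono: "AE x in lborel. mono (\<lambda>K. indicator {0..<t} x * T K x)"
    by (rule AE_I2) (auto simp: mono_def indicator_def intro: monoT)
  have AE_lim: "AE x in lborel. (\<lambda>K. indicator {0..<t} x * T K x) \<longlonglongrightarrow> indicator {0..<t} x * W x"
    using AE0 by eventually_elim (auto simp: indicator_def intro: W)
  have meas_iW: "(\<lambda>x. indicator {0..<t} x * W x) \<in> borel_measurable lborel"
    using meas_W by measurable
  have intW: "integrable lborel (\<lambda>x. indicator {0..<t} x * W x)"
    and valW: "(LBINT x. indicator {0..<t} x * W x) = gauss_mass"
    using integral_monotone_convergence[OF intT AE_mono AE_lim limT meas_iW]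
      integrable_monotone_convergence[OF intT AE_mono AE_lim limT meas_iW] by auto
  have ind: "integrable lborel (\<lambda>x. indicator {0..<t} x * c :: real)" for c
    using t by (intro integrable_mult_left integrable_real_indicator) auto
  have "(\<lambda>n. LBINT x. indicator {0..<t} x * g n x) \<longlonglongrightarrow> (LBINT x. indicator {0..<t} x * (theta t - W x))"
  proof (rule integral_dominated_convergence[where w = "\<lambda>x. indicator {0..<t} x"])
    show "(\<lambda>x. indicator {0..<t} x * (theta t - W x)) \<in> borel_measurable lborel"
      using meas_W by measurable
    show "(\<lambda>x. indicator {0..<t} x * g n x) \<in> borel_measurable lborel" for n
      unfolding g_def using surv_integral(2)[OF t, of "sqrt (real (Suc n))" n] by simp
    show "integrable lborel (\<lambda>x. indicator {0..<t} x :: real)" using ind[of 1] by simp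
    show "AE x in lborel. (\<lambda>n. indicator {0..<t} x * g n x) \<longlonglongrightarrow> indicator {0..<t} x * (theta t - W x)"
      using AE0 by eventually_elim (auto simp: indicator_def intro: gW)
    show "AE x in lborel. norm (indicator {0..<t} x * g n x) \<le> indicator {0..<t} x" for n
      by (rule AE_I2) (auto simp: indicator_def g_def abs_of_nonneg[OF surv_nonneg] surv_le_1 simp del: surv.simps)
  qed
  moreover have "(LBINT x. indicator {0..<t} x * g n x)
      = (\<Sum>f\<in>paths n. max 0 (t - spread n f / sqrt (real (Suc n)))) / real (card (paths n))" for n
    unfolding g_def by (rule surv_integral(1)[OF t]) simp
  moreover have "(LBINT x. indicator {0..<t} x * (theta t - W x)) = t * theta t - gauss_mass"
  proof -
    have "(LBINT x. indicator {0..<t} x * (theta t - W x))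
      = (LBINT x. indicator {0..<t} x * theta t) - (LBINT x. indicator {0..<t} x * W x)"
      unfolding right_diff_distrib by (rule Bochner_Integration.integral_diff[OF ind intW])
    then show ?thesis using t by (simp add: valW)
  qed
  ultimately show ?thesis by simp
qed

section \<open>The limiting distribution function\<close>

text \<open>The derivative in t of t exp (- 2 (k t)^2), with index k + 1 for k.\<close>

definition cdf_term :: "nat \<Rightarrow> real \<Rightarrow> real" where
  "cdf_term k t = (1 - 4 * (real (Suc k) * t)\<^sup>2) * exp (- 2 * (real (Suc k) * t)\<^sup>2)"

text \<open>A majorant uniform in t \<ge> d, for the Weierstrass test. One of the two factors exp (-
  y) pays for the polynomial through \<bar>1 - 4 y\<bar> \<le> 4 (1 + y) \<le> 4 exp y.\<close>

lemma cdf_term_bound: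
  assumes "0 < d" "d \<le> t"
  shows "\<bar>cdf_term k t\<bar> \<le> 4 * exp (- d\<^sup>2) ^ Suc k"
proof -
  define y where "y = (real (Suc k) * t)\<^sup>2"
  have y: "y \<ge> 0" by (simp add: y_def)
  have "\<bar>1 - 4 * y\<bar> \<le> 4 * (1 + y)" using y by (simp add: abs_le_iff)
  also have "\<dots> \<le> 4 * exp y" using exp_ge_add_one_self[of y] by (intro mult_left_mono) auto
  finally have "\<bar>1 - 4 * y\<bar> * exp (- 2 * y) \<le> 4 * exp y * exp (- 2 * y)" by (intro mult_right_mono) auto
  also have "\<dots> = 4 * exp (- y)" by (simp flip: exp_add)
  also have "\<dots> \<le> 4 * exp (- d\<^sup>2) ^ Suc k"
    unfolding y_def using exp_square_le_geometric[OF assms, of k] by (simp del: of_nat_Suc power_Suc)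
  finally show ?thesis by (simp add: cdf_term_def y_def abs_mult del: of_nat_Suc)
qed

lemma summable_geometric_exp:
  assumes "0 < (d::real)"
  shows "summable (\<lambda>k. 4 * exp (- d\<^sup>2) ^ Suc k)"
proof -
  have "summable (\<lambda>k. exp (- d\<^sup>2) ^ k)" using assms by (intro summable_geometric) simp
  then show ?thesis by (intro summable_mult) (simp only: summable_Suc_iff)
qed

lemma summable_cdf_term: "0 < t \<Longrightarrow> summable (\<lambda>k. norm (cdf_term k t))"
  by (rule summable_comparison_test'[OF summable_geometric_exp[of t], of 0])
     (use cdf_term_bound[of t t] in auto)

lemma M_cdf_eq:
  assumes t: "0 < t"
  shows "M_cdf t = 1 + 2 * (\<Sum>k. cdf_term k t)"
proof -
  define g where "g k = (1 - 4 * real_of_int k ^ 2 * t ^ 2) * exp (- 2 * real_of_int k ^ 2 * t ^ 2)" for k :: int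
  define S where "S = (\<Sum>k. cdf_term k t)"
  have nat: "((\<lambda>k. cdf_term k t) has_sum S) UNIV"
    unfolding S_def
    by (rule norm_summable_imp_has_sum[OF summable_cdf_term[OF t]
        summable_sums[OF summable_norm_cancel[OF summable_cdf_term[OF t]]]])
  have g: "g (int (Suc k)) = cdf_term k t" "g (- int (Suc k)) = cdf_term k t" for k
    by (simp_all add: g_def cdf_term_def power_mult_distrib mult.assoc del: of_nat_Suc)
  have pos: "(g has_sum S) ((\<lambda>k. int (Suc k)) ` UNIV)"
    using nat by (subst has_sum_reindex) (simp_all only: inj_on_def o_def g, auto)
  have neg: "(g has_sum S) ((\<lambda>k. - int (Suc k)) ` UNIV)"
    using nat by (subst has_sum_reindex) (simp_all only: inj_on_def o_def g, auto)
  have zero: "(g has_sum 1) {0}"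
    using has_sum_finite[of "{0}" g] by (simp add: g_def)
  have "(g has_sum (S + S)) ((\<lambda>k. int (Suc k)) ` UNIV \<union> (\<lambda>k. - int (Suc k)) ` UNIV)"
    by (rule has_sum_Un_disjoint[OF pos neg]) auto
  then have "(g has_sum (1 + (S + S))) ({0} \<union> ((\<lambda>k. int (Suc k)) ` UNIV \<union> (\<lambda>k. - int (Suc k)) ` UNIV))"
    by (intro has_sum_Un_disjoint[OF zero]) auto
  also have "{0} \<union> ((\<lambda>k. int (Suc k)) ` UNIV \<union> (\<lambda>k. - int (Suc k)) ` UNIV) = (UNIV :: int set)"
  proof -
    have "k \<in> {0} \<union> ((\<lambda>k. int (Suc k)) ` UNIV \<union> (\<lambda>k. - int (Suc k)) ` UNIV)" for k :: int
    proof (cases k rule: int_cases3)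
      case (pos n)
      then have "k = int (Suc (n - 1))" by simp
      then show ?thesis by blast
    next
      case (neg n)
      then have "k = - int (Suc (n - 1))" by simp
      then show ?thesis by blast
    qed auto
    then show ?thesis by blast
  qed
  finally have "infsum g UNIV = 1 + (S + S)" by (rule infsumI)
  moreover have "M_cdf t = infsum g UNIV" unfolding M_cdf_def g_def[abs_def] ..
  ultimately show ?thesis by (simp add: S_def)
qed

lemma uniform_limit_cdf_term:
  assumes "0 < d"
  shows "uniform_limit {d<..} (\<lambda>n t. \<Sum>k<n. cdf_term k t) (\<lambda>t. \<Sum>k. cdf_term k t) sequentially"
  by (rule Weierstrass_m_test[OF _ summable_geometric_exp[OF assms]]) (use cdf_term_bound[OF assms] in auto)

lemma theta_deriv:
  assumes t: "0 < t"
  shows "((\<lambda>t. t * theta t) has_field_derivative M_cdf t) (at t)"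
proof -
  define d where "d = t / 2"
  have d: "0 < d" "t \<in> {d<..}" using t by (auto simp: d_def)
  define f where "f k x = x * exp (- 2 * (real (Suc k) * x)\<^sup>2)" for k x
  have "((\<lambda>x. \<Sum>k. f k x) has_field_derivative (\<Sum>k. cdf_term k t)) (at t)"
  proof (rule has_field_derivative_series'(2)[where S = "{d<..}" and x0 = t and f = f and f' = cdf_term])
    show "(f k has_field_derivative cdf_term k x) (at x within {d<..})" for k x
      unfolding f_def[abs_def] cdf_term_def
      by (auto intro!: derivative_eq_intros simp: algebra_simps power2_eq_square)
    show "uniformly_convergent_on {d<..} (\<lambda>n x. \<Sum>i<n. cdf_term i x)"
      using uniform_limit_cdf_term[OF d(1)] by (auto simp: uniformly_convergent_on_def)
    show "summable (\<lambda>k. f k t)"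
      unfolding f_def by (intro summable_mult summable_theta t)
  qed (use d in \<open>auto simp: interior_open\<close>)
  then have der: "((\<lambda>x. x + 2 * (\<Sum>k. f k x)) has_field_derivative M_cdf t) (at t)"
    unfolding M_cdf_eq[OF t] by (auto intro!: derivative_eq_intros)
  have ev: "\<forall>\<^sub>F x in nhds t. x + 2 * (\<Sum>k. f k x) = x * theta x"
  proof -
    have "\<forall>\<^sub>F x in nhds t. x \<in> {0<..}" using t by (intro eventually_nhds_in_open) auto
    then show ?thesis
    proof eventually_elim
      case (elim x)
      then show ?case unfolding theta_def f_def using suminf_mult[OF summable_theta[of x], of x]
        by (simp add: algebra_simps)
    qed
  qed
  show ?thesis using der unfolding DERIV_cong_ev[OF refl ev refl] .
qed

lemma isCont_M_cdf:
  assumes t: "0 < t"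
  shows "isCont M_cdf t"
proof -
  define d where "d = t / 2"
  have d: "0 < d" "t \<in> {d<..}" using t by (auto simp: d_def)
  have "continuous_on {d<..} (\<lambda>t. \<Sum>k. cdf_term k t)"
    by (rule uniform_limit_theorem[OF _ uniform_limit_cdf_term[OF d(1)]])
       (auto intro!: always_eventually continuous_intros simp: cdf_term_def)
  then have "continuous_on {d<..} (\<lambda>t. 1 + 2 * (\<Sum>k. cdf_term k t))" by (intro continuous_intros)
  then have "continuous_on {d<..} M_cdf"
    by (rule continuous_on_cong[THEN iffD1, rotated -1]) (use d in \<open>auto simp: M_cdf_eq\<close>)
  then show ?thesis using d by (simp add: continuous_on_eq_continuous_at)
qed

text \<open>This gives the limit law total mass 1.\<close>

lemma M_cdf_at_top: "(M_cdf \<longlongrightarrow> 1) at_top"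
proof -
  have "((\<lambda>t::real. 8 * (exp (- t\<^sup>2) / (1 - exp (- t\<^sup>2)))) \<longlongrightarrow> 0) at_top" by real_asymp
  moreover have "\<forall>\<^sub>F t in at_top. norm (M_cdf t - 1) \<le> 8 * (exp (- t\<^sup>2) / (1 - exp (- t\<^sup>2)))"
    using eventually_gt_at_top[of 0]
  proof eventually_elim
    case (elim t)
    have q: "\<bar>exp (- t\<^sup>2)\<bar> < 1" using elim by simp
    have "\<bar>\<Sum>k. cdf_term k t\<bar> \<le> (\<Sum>k. \<bar>cdf_term k t\<bar>)"
      using summable_norm[OF summable_cdf_term[OF elim]] by simp
    also have "\<dots> \<le> (\<Sum>k. 4 * exp (- t\<^sup>2) ^ Suc k)"
      using summable_cdf_term[OF elim]
      by (intro suminf_le summable_geometric_exp[OF elim] cdf_term_bound elim) auto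
    also have "\<dots> = 4 * (\<Sum>k. exp (- t\<^sup>2) * exp (- t\<^sup>2) ^ k)"
      by (subst suminf_mult) (use q in \<open>auto intro!: summable_mult summable_geometric\<close>)
    also have "(\<Sum>k. exp (- t\<^sup>2) * exp (- t\<^sup>2) ^ k) = exp (- t\<^sup>2) * (1 / (1 - exp (- t\<^sup>2)))"
      using q by (subst suminf_mult) (auto intro!: summable_geometric simp: suminf_geometric)
    finally show ?case by (simp add: M_cdf_eq[OF elim])
  qed
  ultimately have "((\<lambda>t. M_cdf t - 1) \<longlongrightarrow> 0) at_top" by (rule Lim_null_comparison[rotated])
  then show ?thesis by (simp add: LIM_zero_iff)
qed

section \<open>Rotating preferences\<close>

definition rot :: "nat \<Rightarrow> nat \<Rightarrow> (nat \<Rightarrow> nat) \<Rightarrow> nat \<Rightarrow> nat" where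
  "rot n c f = (\<lambda>t\<in>{..<n}. (f t + c) mod Suc n)"

definition parking :: "nat \<Rightarrow> (nat \<Rightarrow> nat) set" where
  "parking n = {f \<in> paths n. \<forall>k\<in>{1..n}. 1 \<le> walk n f k}"

lemma rot_paths: "rot n c f \<in> paths n"
  by (auto simp: rot_def paths_def)

lemma pathsD: "f \<in> paths n \<Longrightarrow> t < n \<Longrightarrow> f t < Suc n"
  by (auto simp: paths_def PiE_iff)

lemma rot_rot: "(\<And>t. t < n \<Longrightarrow> f t < Suc n) \<Longrightarrow> rot n c (rot n d f) = rot n (c + d) f"
  by (rule ext) (simp add: rot_def mod_simps add_ac)

lemma rot_period:
  assumes "f \<in> paths n" "Suc n dvd c"
  shows "rot n c f = f"
proof
  fix t
  show "rot n c f t = f t"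
  proof (cases "t < n")
    case True
    obtain m where c: "c = Suc n * m" using assms(2) by (auto elim: dvdE)
    have "(f t + c) mod Suc n = f t mod Suc n" unfolding c by (rule mod_mult_self2)
    also have "\<dots> = f t" using pathsD[OF assms(1) True] by simp
    finally show ?thesis using True by (simp add: rot_def)
  next
    case False
    then show ?thesis using PiE_arb[OF assms(1)[unfolded paths_def], of t] by (simp add: rot_def)
  qed
qed

text \<open>Rotation by c rereads the path from position n + 1 - c, restarted at 1. Up to the wrap
  at k = c this is all; past it, in \<open>walk_rot_high\<close>, the descent by 1 in one round
  cancels the restart value.\<close>

lemma walk_rot_low:
  assumes f: "f \<in> paths n" and "c \<le> n" "k \<le> c"
  shows "walk n (rot n c f) k = 1 + walk n f (Suc n - c + k) - walk n f (Suc n - c)"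
proof -
  let ?m = "Suc n - c"
  have "{t. t < n \<and> rot n c f t < k} = {t. t < n \<and> f t < ?m + k} - {t. t < n \<and> f t < ?m}"
  proof -
    have "(f t + c) mod Suc n < k \<longleftrightarrow> f t < ?m + k \<and> \<not> f t < ?m" if t: "t < n" for t
    proof (cases "f t < ?m")
      case True
      then have "(f t + c) mod Suc n = f t + c" using assms by (intro mod_less) linarith
      then show ?thesis using True assms by simp
    next
      case False
      have "f t < Suc n" by (rule pathsD[OF f t])
      then have "(f t + c) mod Suc n = f t + c - Suc n"
        using False assms by (subst le_mod_geq) auto
      then show ?thesis using False assms by auto
    qed
    then show ?thesis by (auto simp: rot_def)
  qed
  moreover have sub: "{t. t < n \<and> f t < ?m} \<subseteq> {t. t < n \<and> f t < ?m + k}" by auto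
  moreover have "card {t. t < n \<and> f t < ?m} \<le> card {t. t < n \<and> f t < ?m + k}" using sub by (intro card_mono) auto
  ultimately have "real (card {t. t < n \<and> rot n c f t < k})
      = real (card {t. t < n \<and> f t < ?m + k}) - real (card {t. t < n \<and> f t < ?m})"
    by (simp add: card_Diff_subset of_nat_diff)
  then show ?thesis unfolding walk_def by simp
qed

lemma walk_rot_high:
  assumes f: "f \<in> paths n" and "c \<le> n" "c < k" "k \<le> Suc n"
  shows "walk n (rot n c f) k = walk n f (k - c) - walk n f (Suc n - c)"
proof -
  let ?m = "Suc n - c"
  have "{t. t < n \<and> rot n c f t < k} = ({..<n} - {t. t < n \<and> f t < ?m}) \<union> {t. t < n \<and> f t < k - c}"
  proof -
    have "(f t + c) mod Suc n < k \<longleftrightarrow> \<not> f t < ?m \<or> f t < k - c" if t: "t < n" for t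
    proof (cases "f t < ?m")
      case True
      then have "(f t + c) mod Suc n = f t + c" using assms by (intro mod_less) linarith
      then show ?thesis using True assms by auto
    next
      case False
      have "f t < Suc n" by (rule pathsD[OF f t])
      then have "(f t + c) mod Suc n = f t + c - Suc n"
        using False assms by (subst le_mod_geq) auto
      then show ?thesis using False \<open>f t < Suc n\<close> assms by auto
    qed
    then show ?thesis by (auto simp: rot_def)
  qed
  moreover have "({..<n} - {t. t < n \<and> f t < ?m}) \<inter> {t. t < n \<and> f t < k - c} = {}" using assms by auto
  moreover have sub: "{t. t < n \<and> f t < ?m} \<subseteq> {..<n}" by auto
  moreover have "card {t. t < n \<and> f t < ?m} \<le> n" using card_mono[OF _ sub] by simp
  ultimately have "real (card {t. t < n \<and> rot n c f t < k})
      = real n - real (card {t. t < n \<and> f t < ?m}) + real (card {t. t < n \<and> f t < k - c})"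
    by (simp add: card_Un_disjoint card_Diff_subset of_nat_diff)
  then show ?thesis unfolding walk_def using assms by (simp add: of_nat_diff)
qed

lemma parking_walk:
  assumes "f \<in> parking n"
  shows "f \<in> paths n" "k \<le> n \<Longrightarrow> 1 \<le> walk n f k" "k \<le> Suc n \<Longrightarrow> 0 \<le> walk n f k"
proof -
  show 1: "f \<in> paths n" using assms by (simp add: parking_def)
  show 2: "1 \<le> walk n f k" if "k \<le> n" for k
    using assms that by (cases "k = 0") (auto simp: parking_def)
  show "0 \<le> walk n f k" if "k \<le> Suc n"
    using that walk_last[OF 1] 2[of k] by (cases "k = Suc n") auto
qed

lemma walk_le_range_high: "k \<le> Suc n \<Longrightarrow> walk n f k \<le> range_high n f"
  unfolding range_high_def by (intro Max_ge) auto

lemma walk_ge_range_low: "k \<le> Suc n \<Longrightarrow> range_low n f \<le> walk n f k"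
  unfolding range_low_def by (intro Min_le) auto

text \<open>A parking path stays at or above its final value 0, so its height is its spread.
  Rotation shifts all values alike except for the drop of 1 at the wrap, which can reduce the spread
  by at most 1.\<close>

lemma spread_rot:
  assumes f: "f \<in> parking n" and c: "c \<le> n"
  shows "range_high n f - 1 \<le> spread n (rot n c f)" "spread n (rot n c f) \<le> range_high n f"
proof -
  note h = parking_walk[OF f]
  let ?g = "rot n c f" and ?y = "walk n f (Suc n - c)"
  have "range_high n f \<in> walk n f ` {..Suc n}" unfolding range_high_def by (intro Max_in) auto
  then obtain k where k: "k \<le> Suc n" "walk n f k = range_high n f" by auto
  have "range_high n ?g \<ge> range_high n f - ?y"
  proof -
    consider "k = 0" | "1 \<le> k" "k \<le> Suc n - c" | "Suc n - c < k" by linarith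
    then show ?thesis
    proof cases
      case 1
      then have "range_high n f = 1" using k by simp
      moreover have "walk n ?g c = 1 - ?y"
        using walk_rot_low[OF h(1) c, of c] c walk_last[OF h(1)] by simp
      ultimately show ?thesis using walk_le_range_high[of c n ?g] c by simp
    next
      case 2
      then have "walk n ?g (k + c) = range_high n f - ?y"
        using walk_rot_high[OF h(1) c, of "k + c"] k c by simp
      then show ?thesis using walk_le_range_high[of "k + c" n ?g] 2 c by simp
    next
      case 3
      then have "walk n ?g (k - (Suc n - c)) = 1 + range_high n f - ?y"
        using walk_rot_low[OF h(1) c, of "k - (Suc n - c)"] k c by simp
      moreover have "k - (Suc n - c) \<le> Suc n" using k(1) by linarith
      ultimately show ?thesis using walk_le_range_high[of "k - (Suc n - c)" n ?g] by linarith
    qed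
  qed
  moreover have "range_low n ?g \<le> 1 - ?y"
    using walk_rot_low[OF h(1) c, of c] c walk_last[OF h(1)] walk_ge_range_low[of c n ?g] by simp
  ultimately show "range_high n f - 1 \<le> spread n ?g" by (simp add: spread_def)
  show "spread n ?g \<le> range_high n f"
  proof (cases "c = 0")
    case True
    then have g: "?g = f" using rot_period[OF h(1)] by simp
    have "0 \<le> range_low n f" unfolding range_low_ge_iff using h(3) by blast
    then show ?thesis unfolding g spread_def by simp
  next
    case False
    have "1 - ?y \<le> walk n ?g k \<and> walk n ?g k \<le> 1 + range_high n f - ?y" if k: "k \<le> Suc n" for k
    proof (cases "k \<le> c")
      case True
      then show ?thesis
        using walk_rot_low[OF h(1) c True] h(3)[of "Suc n - c + k"] walk_le_range_high[of "Suc n - c + k" n f] c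
        by simp
    next
      case False
      moreover have "k - c \<le> n" "k - c \<le> Suc n" using k \<open>c \<noteq> 0\<close> by linarith+
      ultimately show ?thesis
        using walk_rot_high[OF h(1) c _ k] h(2)[of "k - c"] walk_le_range_high[of "k - c" n f] by simp
    qed
    then have "1 - ?y \<le> range_low n ?g" "range_high n ?g \<le> 1 + range_high n f - ?y"
      unfolding range_low_ge_iff range_high_le_iff by auto
    then show ?thesis by (simp add: spread_def)
  qed
qed

text \<open>Positions 0 and n + 1 are one point of the circle. Searching from 1 assigns n + 1 to an
  unrotated parking map, and \<open>mod Suc n\<close> turns this into the rotation amount 0.\<close>

definition argmin_pos :: "nat \<Rightarrow> (nat \<Rightarrow> nat) \<Rightarrow> nat" where
  "argmin_pos n g = (LEAST k. k \<in> {1..Suc n} \<and> (\<forall>i\<in>{1..Suc n}. walk n g k \<le> walk n g i))"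

lemma argmin_pos:
  shows "argmin_pos n g \<in> {1..Suc n}"
    and "i \<in> {1..Suc n} \<Longrightarrow> walk n g (argmin_pos n g) \<le> walk n g i"
    and "1 \<le> i \<Longrightarrow> i < argmin_pos n g \<Longrightarrow> walk n g (argmin_pos n g) + 1 \<le> walk n g i"
proof -
  let ?P = "\<lambda>k. k \<in> {1..Suc n} \<and> (\<forall>i\<in>{1..Suc n}. walk n g k \<le> walk n g i)"
  have "Min (walk n g ` {1..Suc n}) \<in> walk n g ` {1..Suc n}" by (intro Min_in) auto
  then obtain k where k: "Min (walk n g ` {1..Suc n}) = walk n g k" "k \<in> {1..Suc n}" by (rule imageE)
  have "walk n g k \<le> walk n g i" if "i \<in> {1..Suc n}" for i
    unfolding k(1)[symmetric] using that by (intro Min_le) auto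
  then have "?P k" using k(2) by blast
  then have P: "?P (argmin_pos n g)" unfolding argmin_pos_def by (rule LeastI)
  then show pos: "argmin_pos n g \<in> {1..Suc n}" and
    min: "\<And>i. i \<in> {1..Suc n} \<Longrightarrow> walk n g (argmin_pos n g) \<le> walk n g i" by auto
  assume i: "1 \<le> i" "i < argmin_pos n g"
  have "\<not> ?P i" using i(2) unfolding argmin_pos_def by (rule not_less_Least)
  moreover have "i \<in> {1..Suc n}" using i pos by auto
  ultimately have "walk n g (argmin_pos n g) < walk n g i"
    using min by (smt (verit))
  \<comment> \<open>The walk is integer-valued, so the strict inequality improves to a gap of
    1.\<close>
  moreover have int: "walk n g k = of_int (1 + int (card {t. t < n \<and> g t < k}) - int k)" for k
    by (simp add: walk_def)
  ultimately show "walk n g (argmin_pos n g) + 1 \<le> walk n g i"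
    unfolding int of_int_less_iff by linarith
qed

lemma argmin_pos_unique:
  assumes "k \<in> {1..Suc n}" "\<And>i. i \<in> {1..Suc n} \<Longrightarrow> walk n g k \<le> walk n g i"
    "\<And>i. 1 \<le> i \<Longrightarrow> i < k \<Longrightarrow> walk n g k < walk n g i"
  shows "argmin_pos n g = k"
proof (rule antisym)
  show "argmin_pos n g \<le> k" unfolding argmin_pos_def by (rule Least_le) (use assms in auto)
  show "k \<le> argmin_pos n g"
    using argmin_pos(1)[of n g] argmin_pos(2)[of k n g] assms(1) assms(3)[of "argmin_pos n g"]
    by (meson atLeastAtMost_iff not_le)
qed

text \<open>A cycle lemma. The end of a parking path is its strict minimum over the positions from 1
  on. Rotation by c > 0 carries the end to position c, and the drop at the wrap allows later values
  to tie with it but not to go below, so it is the first minimum. Conversely, a path reread from its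
  first minimum stays at 1 or higher until its last step.\<close>

lemma bij_betw_rot:
  "bij_betw (\<lambda>(f, c). rot n c f) (parking n \<times> {..n}) (paths n)"
proof (rule bij_betw_byWitness[where f' = "\<lambda>g. (rot n (Suc n - argmin_pos n g) g, argmin_pos n g mod Suc n)"])
  show "\<forall>a\<in>parking n \<times> {..n}. (\<lambda>g. (rot n (Suc n - argmin_pos n g) g, argmin_pos n g mod Suc n))
          ((\<lambda>(f, c). rot n c f) a) = a"
  proof
    fix a assume "a \<in> parking n \<times> {..n}"
    then obtain f c where a: "a = (f, c)" and f: "f \<in> parking n" and c: "c \<le> n" by auto
    note h = parking_walk[OF f]
    have pos: "argmin_pos n (rot n c f) = (if c = 0 then Suc n else c)"
    proof (cases "c = 0")
      case True
      then have g: "rot n c f = f" using rot_period[OF h(1)] by simp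
      have "argmin_pos n f = Suc n"
      proof (rule argmin_pos_unique)
        show "walk n f (Suc n) < walk n f i" if "1 \<le> i" "i < Suc n" for i
          using h(2)[of i] that walk_last[OF h(1)] by simp
      qed (use h(3) walk_last[OF h(1)] in auto)
      then show ?thesis using True g by simp
    next
      case False
      let ?y = "walk n f (Suc n - c)"
      have hc: "walk n (rot n c f) c = 1 - ?y"
        using walk_rot_low[OF h(1) c, of c] c walk_last[OF h(1)] by simp
      have lo: "1 - ?y < walk n (rot n c f) i" if "1 \<le> i" "i < c" for i
      proof -
        have "1 \<le> walk n f (Suc n - c + i)" using that c by (intro h(2)) linarith
        then show ?thesis using walk_rot_low[OF h(1) c, of i] that by simp
      qed
      have hi: "1 - ?y \<le> walk n (rot n c f) i" if "c < i" "i \<le> Suc n" for i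
        using walk_rot_high[OF h(1) c that] h(2)[of "i - c"] that False by simp
      have "argmin_pos n (rot n c f) = c"
      proof (rule argmin_pos_unique)
        fix i assume "i \<in> {1..Suc n}"
        then show "walk n (rot n c f) c \<le> walk n (rot n c f) i"
          using lo[of i] hi[of i] hc by (cases i c rule: linorder_cases) auto
      qed (use lo hc False c in auto)
      then show ?thesis using False by simp
    qed
    have "rot n (Suc n - argmin_pos n (rot n c f)) (rot n c f) = f"
      unfolding pos using rot_rot[of n f _ c] pathsD[OF h(1)] rot_period[OF h(1)] c by simp
    moreover have "argmin_pos n (rot n c f) mod Suc n = c" unfolding pos using c by simp
    ultimately show "(\<lambda>g. (rot n (Suc n - argmin_pos n g) g, argmin_pos n g mod Suc n))
          ((\<lambda>(f, c). rot n c f) a) = a"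
      by (simp add: a)
  qed
  show "\<forall>g\<in>paths n. (\<lambda>(f, c). rot n c f) (rot n (Suc n - argmin_pos n g) g, argmin_pos n g mod Suc n) = g"
  proof
    fix g assume g: "g \<in> paths n"
    have "Suc n dvd argmin_pos n g mod Suc n + (Suc n - argmin_pos n g)"
      using argmin_pos(1)[of n g] by (cases "argmin_pos n g = Suc n") auto
    then show "(\<lambda>(f, c). rot n c f) (rot n (Suc n - argmin_pos n g) g, argmin_pos n g mod Suc n) = g"
      using rot_rot[of n g] pathsD[OF g] rot_period[OF g] by simp
  qed
  show "(\<lambda>(f, c). rot n c f) ` (parking n \<times> {..n}) \<subseteq> paths n" by (auto intro: rot_paths)
  show "(\<lambda>g. (rot n (Suc n - argmin_pos n g) g, argmin_pos n g mod Suc n)) ` paths n \<subseteq> parking n \<times> {..n}"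
  proof (rule image_subsetI)
    fix g assume g: "g \<in> paths n"
    define m where "m = argmin_pos n g"
    have m: "1 \<le> m" "m \<le> Suc n" using argmin_pos(1)[of n g] by (auto simp: m_def)
    have "1 \<le> walk n (rot n (Suc n - m) g) k" if k: "1 \<le> k" "k \<le> n" for k
    proof (cases "k \<le> Suc n - m")
      case True
      then show ?thesis
        using walk_rot_low[OF g _ True] argmin_pos(2)[of "m + k" n g] m k by (simp add: m_def[symmetric])
    next
      case False
      then have "1 \<le> k - (Suc n - m)" "k - (Suc n - m) < m" using m k by linarith+
      then show ?thesis
        using walk_rot_high[OF g, of "Suc n - m" k] argmin_pos(3)[of "k - (Suc n - m)" n g] m k False
        unfolding m_def[symmetric] by (simp del: diff_diff_cancel add: diff_diff_cancel[OF m(2)])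
    qed
    then have "rot n (Suc n - m) g \<in> parking n" by (simp add: parking_def rot_paths)
    then show "(rot n (Suc n - argmin_pos n g) g, argmin_pos n g mod Suc n) \<in> parking n \<times> {..n}"
      by (simp add: m_def[symmetric] less_Suc_eq_le[symmetric])
  qed
qed

lemma card_parking: "card (paths n) = card (parking n) * Suc n"
  using bij_betw_same_card[OF bij_betw_rot[of n]] by (simp add: card_cartesian_product)

text \<open>Each parking map represents n + 1 maps, and by \<open>spread_rot\<close> their spreads
  lie between its height minus 1 and its height.\<close>

lemma parking_spread_bounds:
  shows "card {f \<in> paths n. spread n f \<le> x} \<le> card {f \<in> parking n. range_high n f - 1 \<le> x} * Suc n"
    and "card {f \<in> parking n. range_high n f - 1 \<le> x} * Suc n \<le> card {f \<in> paths n. spread n f \<le> x + 1}"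
proof -
  let ?F = "\<lambda>(f, c). rot n c f" and ?Q = "{f \<in> parking n. range_high n f - 1 \<le> x}"
  have inj: "inj_on ?F (?Q \<times> {..n})"
    by (rule inj_on_subset[OF bij_betw_imp_inj_on[OF bij_betw_rot]]) auto
  have card: "card (?F ` (?Q \<times> {..n})) = card ?Q * Suc n"
    using card_image[OF inj] by (simp add: card_cartesian_product)
  have "finite (parking n)" by (rule finite_subset[of _ "paths n"]) (auto simp: parking_def)
  then have fin: "finite (?F ` (?Q \<times> {..n}))" by auto
  have "{f \<in> paths n. spread n f \<le> x} \<subseteq> ?F ` (?Q \<times> {..n})"
  proof
    fix g assume g: "g \<in> {f \<in> paths n. spread n f \<le> x}"
    then obtain f c where "f \<in> parking n" "c \<le> n" "g = rot n c f"
      using bij_betw_imp_surj_on[OF bij_betw_rot[of n]] by force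
    then show "g \<in> ?F ` (?Q \<times> {..n})" using spread_rot(1)[of f n c] g by force
  qed
  from card_mono[OF fin this] card
  show "card {f \<in> paths n. spread n f \<le> x} \<le> card ?Q * Suc n" by simp
  have "?F ` (?Q \<times> {..n}) \<subseteq> {f \<in> paths n. spread n f \<le> x + 1}"
    using spread_rot(2) by (force intro: rot_paths)
  from card_mono[OF _ this] card
  show "card ?Q * Suc n \<le> card {f \<in> paths n. spread n f \<le> x + 1}" by simp
qed

section \<open>Convergence of the distribution functions\<close>

lemma PF_walk:
  assumes p: "p \<in> PF n"
  shows "walk n (\<lambda>t\<in>{..<n}. p ! t - 1) k = 1 + real (card {t. t < n \<and> p ! t \<le> k}) - real k"
proof -
  have "{t. t < n \<and> (\<lambda>t\<in>{..<n}. p ! t - 1) t < k} = {t. t < n \<and> p ! t \<le> k}"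
  proof -
    have "p ! t - 1 < k \<longleftrightarrow> p ! t \<le> k" if "t < n" for t
    proof -
      have "1 \<le> p ! t" using p that by (simp add: PF_def)
      then show ?thesis by linarith
    qed
    then show ?thesis by auto
  qed
  then show ?thesis by (simp add: walk_def)
qed

lemma bij_betw_PF: "bij_betw (\<lambda>p. \<lambda>t\<in>{..<n}. p ! t - 1) (PF n) (parking n)"
proof (rule bij_betw_byWitness[where f' = "\<lambda>f. map (\<lambda>t. f t + 1) [0..<n]"])
  show "\<forall>p\<in>PF n. map (\<lambda>t. (\<lambda>t\<in>{..<n}. p ! t - 1) t + 1) [0..<n] = p"
    by (auto simp: PF_def intro!: nth_equalityI)
  show "\<forall>f\<in>parking n. (\<lambda>t\<in>{..<n}. map (\<lambda>t. f t + 1) [0..<n] ! t - 1) = f"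
  proof
    fix f assume "f \<in> parking n"
    then have f: "f \<in> {..<n} \<rightarrow>\<^sub>E {..<Suc n}" by (simp add: parking_def paths_def)
    show "(\<lambda>t\<in>{..<n}. map (\<lambda>t. f t + 1) [0..<n] ! t - 1) = f"
    proof
      fix t
      show "(\<lambda>t\<in>{..<n}. map (\<lambda>t. f t + 1) [0..<n] ! t - 1) t = f t"
        using PiE_arb[OF f, of t] by (cases "t < n") auto
    qed
  qed
  show "(\<lambda>p. \<lambda>t\<in>{..<n}. p ! t - 1) ` PF n \<subseteq> parking n"
  proof (rule image_subsetI)
    fix p assume p: "p \<in> PF n"
    have "(\<lambda>t\<in>{..<n}. p ! t - 1) \<in> paths n"
      using p by (fastforce simp: paths_def PF_def)
    moreover have "1 \<le> walk n (\<lambda>t\<in>{..<n}. p ! t - 1) k" if "k \<in> {1..n}" for k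
    proof -
      have "k \<le> card {t. t < n \<and> p ! t \<le> k}" using p that by (simp add: PF_def)
      then show ?thesis unfolding PF_walk[OF p] by simp
    qed
    ultimately show "(\<lambda>t\<in>{..<n}. p ! t - 1) \<in> parking n" by (simp add: parking_def)
  qed
  show "(\<lambda>f. map (\<lambda>t. f t + 1) [0..<n]) ` parking n \<subseteq> PF n"
  proof (rule image_subsetI)
    fix f assume f: "f \<in> parking n"
    have count: "{t. t < n \<and> map (\<lambda>t. f t + 1) [0..<n] ! t \<le> i} = {t. t < n \<and> f t < i}" for i
      by auto
    have card: "i \<le> card {t. t < n \<and> f t < i}" if "i \<in> {1..n}" for i
      using f that unfolding parking_def walk_def by force
    \<comment> \<open>Maps in \<open>paths n\<close> may take the value n; the parking condition at
      n forces all cars below it.\<close>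
    have "f t < n" if "t < n" for t
    proof -
      have "card {t. t < n \<and> f t < n} = card {..<n}"
        using card[of n] that card_mono[of "{..<n}" "{t. t < n \<and> f t < n}"] by fastforce
      then have "{t. t < n \<and> f t < n} = {..<n}" by (intro card_subset_eq) auto
      then show ?thesis using that by auto
    qed
    then show "map (\<lambda>t. f t + 1) [0..<n] \<in> PF n"
      unfolding PF_def mem_Collect_eq count using card by (simp add: Suc_le_eq)
  qed
qed

lemma PF_card: "finite (PF n)" "card (PF n) = card (parking n)" "card (PF n) > 0"
proof -
  have fin: "finite (parking n)" by (rule finite_subset[of _ "paths n"]) (auto simp: parking_def)
  then show "finite (PF n)" using bij_betw_finite[OF bij_betw_PF] by blast
  show eq: "card (PF n) = card (parking n)" by (rule bij_betw_same_card[OF bij_betw_PF])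
  have "card (parking n) * Suc n > 0" unfolding card_parking[symmetric] by (simp add: card_paths)
  then have "card (parking n) > 0" using zero_less_mult_pos2 by blast
  then show "card (PF n) > 0" unfolding eq by simp
qed

lemma pf_stat_nonneg:
  assumes "p \<in> PF n" "n > 0"
  shows "0 \<le> pf_stat n p"
proof -
  have "{t. t < n \<and> p ! t \<le> n} = {..<n}" using assms by (auto simp: PF_def)
  then have "(real (card {t. t < n \<and> p ! t \<le> n}) - real n) / sqrt (real n) = 0" by simp
  then have "0 \<in> (\<lambda>k. (real (card {t. t < n \<and> p ! t \<le> k}) - real k) / sqrt (real n)) ` {1..n}"
    using assms(2) by (auto simp: image_iff intro!: bexI[of _ n])
  then show ?thesis unfolding pf_stat_def by (intro Max_ge) auto
qed

lemma pf_stat_le_iff: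
  assumes p: "p \<in> PF n" and "n > 0" "t \<ge> 0"
  shows "pf_stat n p \<le> t \<longleftrightarrow> range_high n (\<lambda>t\<in>{..<n}. p ! t - 1) - 1 \<le> t * sqrt (real n)"
proof -
  let ?f = "\<lambda>t\<in>{..<n}. p ! t - 1"
  have f: "?f \<in> paths n" using bij_betw_PF[of n] p by (auto simp: bij_betw_def parking_def)
  have "pf_stat n p \<le> t \<longleftrightarrow> (\<forall>k\<in>{1..n}. (real (card {t. t < n \<and> p ! t \<le> k}) - real k) / sqrt (real n) \<le> t)"
    unfolding pf_stat_def using assms(2) by (subst Max_le_iff) auto
  also have "\<dots> \<longleftrightarrow> (\<forall>k\<in>{1..n}. walk n ?f k \<le> t * sqrt (real n) + 1)"
    unfolding PF_walk[OF p] using assms(2) by (simp add: pos_divide_le_eq algebra_simps)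
  \<comment> \<open>\<open>range_high\<close> also sees the positions 0 and n + 1, with values 1 and
    0; for t \<ge> 0 they never exceed the bound.\<close>
  also have "\<dots> \<longleftrightarrow> (\<forall>k\<le>Suc n. walk n ?f k \<le> t * sqrt (real n) + 1)"
  proof
    assume *: "\<forall>k\<in>{1..n}. walk n ?f k \<le> t * sqrt (real n) + 1"
    have "0 \<le> t * sqrt (real n)" using assms by simp
    then have "walk n ?f 0 \<le> t * sqrt (real n) + 1" "walk n ?f (Suc n) \<le> t * sqrt (real n) + 1"
      using walk_last[OF f] by (simp_all only: walk_0)
    then show "\<forall>k\<le>Suc n. walk n ?f k \<le> t * sqrt (real n) + 1"
      using * by (metis atLeastAtMost_iff le_SucE not_less_eq_eq One_nat_def le_zero_eq)
  qed auto
  also have "\<dots> \<longleftrightarrow> range_high n ?f - 1 \<le> t * sqrt (real n)"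
    using range_high_le_iff[of n ?f "t * sqrt (real n) + 1"] by (simp only: diff_le_eq)
  finally show ?thesis .
qed

section \<open>Enclosing the distribution functions by difference quotients\<close>

definition spread_cdf :: "nat \<Rightarrow> real \<Rightarrow> real" where
  "spread_cdf n x = real (card {f \<in> paths n. spread n f \<le> x}) / real (card (paths n))"

lemma spread_cdf_mono: "x \<le> y \<Longrightarrow> spread_cdf n x \<le> spread_cdf n y"
  unfolding spread_cdf_def by (intro divide_right_mono of_nat_mono card_mono) auto

lemma cdf_pf_stat_distr:
  "cdf (pf_stat_distr n) t = real (card {p \<in> PF n. pf_stat n p \<le> t}) / real (card (PF n))"
proof -
  have "PF n \<noteq> {}" using PF_card(3)[of n] by auto
  have "cdf (pf_stat_distr n) t = measure_pmf.prob (pmf_of_set (PF n)) (pf_stat n -` {..t})"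
    unfolding cdf_def pf_stat_distr_def measure_map_pmf ..
  also have "\<dots> = real (card (PF n \<inter> pf_stat n -` {..t})) / real (card (PF n))"
    using PF_card(1) \<open>PF n \<noteq> {}\<close> by (intro measure_pmf_of_set)
  also have "PF n \<inter> pf_stat n -` {..t} = {p \<in> PF n. pf_stat n p \<le> t}" by auto
  finally show ?thesis .
qed

lemma cdf_pf_stat_bounds:
  assumes "n > 0" "t \<ge> 0"
  shows "spread_cdf n (t * sqrt (real n)) \<le> cdf (pf_stat_distr n) t"
    and "cdf (pf_stat_distr n) t \<le> spread_cdf n (t * sqrt (real n) + 1)"
proof -
  let ?x = "t * sqrt (real n)"
  have "bij_betw (\<lambda>p. \<lambda>t\<in>{..<n}. p ! t - 1) {p \<in> PF n. pf_stat n p \<le> t} {f \<in> parking n. range_high n f - 1 \<le> ?x}"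
  proof (rule bij_betwI')
    fix p q assume "p \<in> {p \<in> PF n. pf_stat n p \<le> t}" "q \<in> {p \<in> PF n. pf_stat n p \<le> t}"
    then show "((\<lambda>t\<in>{..<n}. p ! t - 1) = (\<lambda>t\<in>{..<n}. q ! t - 1)) = (p = q)"
      using bij_betw_imp_inj_on[OF bij_betw_PF[of n]] by (auto dest: inj_onD)
  next
    fix p assume "p \<in> {p \<in> PF n. pf_stat n p \<le> t}"
    then show "(\<lambda>t\<in>{..<n}. p ! t - 1) \<in> {f \<in> parking n. range_high n f - 1 \<le> ?x}"
      using bij_betw_imp_surj_on[OF bij_betw_PF[of n]] pf_stat_le_iff[of p n t] assms by blast
  next
    fix f assume f: "f \<in> {f \<in> parking n. range_high n f - 1 \<le> ?x}"
    then obtain p where "p \<in> PF n" "f = (\<lambda>t\<in>{..<n}. p ! t - 1)"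
      using bij_betw_imp_surj_on[OF bij_betw_PF[of n]] by blast
    then show "\<exists>p\<in>{p \<in> PF n. pf_stat n p \<le> t}. f = (\<lambda>t\<in>{..<n}. p ! t - 1)"
      using pf_stat_le_iff[of p n t] assms f by blast
  qed
  then have eq: "card {p \<in> PF n. pf_stat n p \<le> t} = card {f \<in> parking n. range_high n f - 1 \<le> ?x}"
    by (rule bij_betw_same_card)
  have cdf: "cdf (pf_stat_distr n) t
      = real (card {f \<in> parking n. range_high n f - 1 \<le> ?x} * Suc n) / real (card (paths n))"
    unfolding cdf_pf_stat_distr eq PF_card(2) card_parking of_nat_mult by (rule mult_divide_mult_cancel_right[symmetric]) simp
  show "spread_cdf n ?x \<le> cdf (pf_stat_distr n) t" "cdf (pf_stat_distr n) t \<le> spread_cdf n (?x + 1)"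
    unfolding cdf spread_cdf_def
    by (intro divide_right_mono of_nat_mono parking_spread_bounds; simp)+
qed

text \<open>From u to v the function t \<mapsto> max 0 (t - y) gains v - u if y \<le> u, nothing if
  y \<ge> v, and something in between otherwise. Averaging over y = spread/s gives both
  bounds.\<close>

lemma mean_excess_diff:
  fixes n :: nat and s u v :: real
  assumes "u < v" and s: "s > 0"
  defines "A \<equiv> \<lambda>t. (\<Sum>f\<in>paths n. max 0 (t - spread n f / s)) / real (card (paths n))"
  shows "(v - u) * spread_cdf n (u * s) \<le> A v - A u" "A v - A u \<le> (v - u) * spread_cdf n (v * s)"
proof -
  have c: "real (card (paths n)) > 0" by (simp add: card_paths)
  have cnt: "real (card {f \<in> paths n. spread n f \<le> x}) = (\<Sum>f\<in>paths n. if spread n f \<le> x then 1 else 0)" for x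
    by (simp add: sum.If_cases Int_def)
  have diff: "A v - A u = (\<Sum>f\<in>paths n. max 0 (v - spread n f / s) - max 0 (u - spread n f / s)) / real (card (paths n))"
    by (simp add: A_def sum_subtractf diff_divide_distrib)
  have le: "spread n f \<le> w * s \<longleftrightarrow> spread n f / s \<le> w" for f w using s by (simp add: pos_divide_le_eq)
  show "(v - u) * spread_cdf n (u * s) \<le> A v - A u"
    unfolding diff spread_cdf_def cnt times_divide_eq_right sum_distrib_left
    using assms(1) by (intro divide_right_mono sum_mono) (auto simp: le max_def)
  show "A v - A u \<le> (v - u) * spread_cdf n (v * s)"
    unfolding diff spread_cdf_def cnt times_divide_eq_right sum_distrib_left
    using assms(1) by (intro divide_right_mono sum_mono) (auto simp: le max_def)
qed

text \<open>The limit of the mean excess is convex in the level with derivative \<^const>\<open>M_cdf\<close>, and difference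
  quotients of the mean excess enclose the distribution function.\<close>

lemma cdf_pf_stat_lim:
  assumes t: "t > 0"
  shows "(\<lambda>n. cdf (pf_stat_distr n) t) \<longlonglongrightarrow> M_cdf t"
proof (rule LIMSEQ_I)
  fix e :: real assume e: "e > 0"
  define H where "H u = u * theta u - gauss_mass" for u
  define A where "A n u = (\<Sum>f\<in>paths n. max 0 (u - spread n f / sqrt (real (Suc n)))) / real (card (paths n))" for n u
  have A: "(\<lambda>n. A n u) \<longlonglongrightarrow> H u" if "u > 0" for u
    unfolding A_def H_def by (rule mean_excess_lim[OF that])
  have "(H has_field_derivative M_cdf t) (at t)"
    unfolding H_def[abs_def] using DERIV_diff[OF theta_deriv[OF t] DERIV_const] by simp
  then have "(\<lambda>h. (H (t + h) - H t) / h) \<midarrow>0\<rightarrow> M_cdf t" by (rule DERIV_D)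
  \<comment> \<open>Increments of length at most 2h then cost at most h e / 4 each; every quotient
    below uses two of them, which leaves a slack of e / 2.\<close>
  from LIM_D[OF this, of "e / 8"] e obtain s where s: "s > 0"
    "\<And>h. h \<noteq> 0 \<Longrightarrow> \<bar>h\<bar> < s \<Longrightarrow> \<bar>(H (t + h) - H t) / h - M_cdf t\<bar> < e / 8" by auto
  \<comment> \<open>The quotients are taken over [t - 2h, t - h] and [t + h, t + 2h]. The gap h next
    to t absorbs the difference of sqrt n and sqrt (n + 1) and the shift by 1 in
    \<open>cdf_pf_stat_bounds\<close>.\<close>
  define h where "h = min (s / 4) (t / 4)"
  have h: "h > 0" "2 * h < s" "2 * h < t" using s t by (auto simp: h_def min_def)
  have q: "\<bar>H (t + h * c) - H t - h * c * M_cdf t\<bar> \<le> h * (e / 4)" if "c \<in> {1, 2, -1, -2}" for c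
  proof -
    have hc: "h * c \<noteq> 0" "\<bar>h * c\<bar> < s" "\<bar>h * c\<bar> \<le> 2 * h" using that h by (auto simp: abs_mult)
    have "H (t + h * c) - H t - h * c * M_cdf t = (h * c) * ((H (t + h * c) - H t) / (h * c) - M_cdf t)"
    proof -
      have "D - w * M = w * (D / w - M)" if "w \<noteq> 0" for D w M :: real using that by (simp add: field_simps)
      from this[OF hc(1)] show ?thesis .
    qed
    then have "\<bar>H (t + h * c) - H t - h * c * M_cdf t\<bar> = \<bar>h * c\<bar> * \<bar>(H (t + h * c) - H t) / (h * c) - M_cdf t\<bar>"
      by (simp only: abs_mult)
    also have "\<dots> \<le> (2 * h) * (e / 8)" using s(2)[OF hc(1,2)] hc by (intro mult_mono) auto
    finally show ?thesis by (simp add: mult.commute)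
  qed
  have q1: "\<bar>H (t + h) - H t - h * M_cdf t\<bar> \<le> h * (e / 4)" "\<bar>H (t - h) - H t + h * M_cdf t\<bar> \<le> h * (e / 4)"
    using q[of 1] q[of "-1"] by simp_all
  have q2: "\<bar>H (t + 2 * h) - H t - 2 * (h * M_cdf t)\<bar> \<le> h * (e / 4)"
    "\<bar>H (t - 2 * h) - H t + 2 * (h * M_cdf t)\<bar> \<le> h * (e / 4)"
    using q[of 2] q[of "-2"] by (simp_all add: mult.commute mult.left_commute)
  have "h * (M_cdf t - e / 2) = h * M_cdf t - 2 * (h * (e / 4))" by (simp add: algebra_simps)
  then have lower: "H (t - h) - H (t - 2 * h) \<ge> h * (M_cdf t - e / 2)"
    using q1(2) q2(2) unfolding abs_le_iff by linarith
  have "h * (M_cdf t + e / 2) = h * M_cdf t + 2 * (h * (e / 4))" by (simp add: algebra_simps)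
  then have upper: "H (t + 2 * h) - H (t + h) \<le> h * (M_cdf t + e / 2)"
    using q1(1) q2(1) unfolding abs_le_iff by linarith
  have "(\<lambda>n. A n (t - h) - A n (t - 2 * h)) \<longlonglongrightarrow> H (t - h) - H (t - 2 * h)"
    using h by (intro tendsto_diff A) auto
  moreover have "h * (M_cdf t - e) < H (t - h) - H (t - 2 * h)"
  proof -
    have "h * (M_cdf t - e) < h * (M_cdf t - e / 2)" using h e by simp
    then show ?thesis using lower by linarith
  qed
  ultimately have ev1: "\<forall>\<^sub>F n in sequentially. h * (M_cdf t - e) < A n (t - h) - A n (t - 2 * h)"
    by (rule order_tendstoD(1))
  have "(\<lambda>n. A n (t + 2 * h) - A n (t + h)) \<longlonglongrightarrow> H (t + 2 * h) - H (t + h)"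
    using h t by (intro tendsto_diff A) auto
  moreover have "H (t + 2 * h) - H (t + h) < h * (M_cdf t + e)"
  proof -
    have "h * (M_cdf t + e / 2) < h * (M_cdf t + e)" using h e by simp
    then show ?thesis using upper by linarith
  qed
  ultimately have ev2: "\<forall>\<^sub>F n in sequentially. A n (t + 2 * h) - A n (t + h) < h * (M_cdf t + e)"
    by (rule order_tendstoD(2))
  have ev3: "\<forall>\<^sub>F n in sequentially. (t - h) * sqrt (real (Suc n)) \<le> t * sqrt (real n)"
    using h t by real_asymp
  have ev4: "\<forall>\<^sub>F n in sequentially. t * sqrt (real n) + 1 \<le> (t + h) * sqrt (real (Suc n))"
    using h t by real_asymp
  have "\<forall>\<^sub>F n in sequentially. norm (cdf (pf_stat_distr n) t - M_cdf t) < e"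
    using ev1 ev2 ev3 ev4 eventually_gt_at_top[of 0]
  proof eventually_elim
    case (elim n)
    let ?s = "sqrt (real (Suc n))"
    have s: "?s > 0" by simp
    have "A n (t - h) - A n (t - 2 * h) \<le> h * spread_cdf n ((t - h) * ?s)"
      using mean_excess_diff(2)[of "t - 2 * h" "t - h" ?s n] h s by (simp add: A_def del: of_nat_Suc)
    with elim(1) have "h * (M_cdf t - e) < h * spread_cdf n ((t - h) * ?s)" by linarith
    then have "M_cdf t - e < spread_cdf n ((t - h) * ?s)" using h by simp
    also have "\<dots> \<le> spread_cdf n (t * sqrt (real n))" by (rule spread_cdf_mono[OF elim(3)])
    also have "\<dots> \<le> cdf (pf_stat_distr n) t" by (rule cdf_pf_stat_bounds) (use elim t in auto)
    finally have 1: "M_cdf t - e < cdf (pf_stat_distr n) t" .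
    have "cdf (pf_stat_distr n) t \<le> spread_cdf n (t * sqrt (real n) + 1)"
      by (rule cdf_pf_stat_bounds) (use elim t in auto)
    also have "\<dots> \<le> spread_cdf n ((t + h) * ?s)" by (rule spread_cdf_mono[OF elim(4)])
    finally have "h * cdf (pf_stat_distr n) t \<le> h * spread_cdf n ((t + h) * ?s)"
      using h by (intro mult_left_mono) auto
    also have "\<dots> \<le> A n (t + 2 * h) - A n (t + h)"
      using mean_excess_diff(1)[of "t + h" "t + 2 * h" ?s n] h s by (simp add: A_def del: of_nat_Suc)
    also have "\<dots> < h * (M_cdf t + e)" by (rule elim(2))
    finally have "cdf (pf_stat_distr n) t < M_cdf t + e" using h by simp
    then show ?case using 1 by (simp add: abs_less_iff)
  qed
  then show "\<exists>no. \<forall>n\<ge>no. norm (cdf (pf_stat_distr n) t - M_cdf t) < e" by (simp add: eventually_sequentially)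
qed

section \<open>The limit law and weak convergence\<close>

lemma M_cdf_mono:
  assumes "0 < x" "x \<le> y"
  shows "M_cdf x \<le> M_cdf y"
proof (rule LIMSEQ_le[OF cdf_pf_stat_lim cdf_pf_stat_lim])
  \<comment> \<open>Monotonicity, hard to see on the series, is inherited from the distribution
    functions that converge to it.\<close>
  have "cdf (pf_stat_distr n) x \<le> cdf (pf_stat_distr n) y" for n
    unfolding cdf_pf_stat_distr using assms PF_card(1)[of n] by (intro divide_right_mono of_nat_mono card_mono) auto
  then show "\<exists>N. \<forall>n\<ge>N. cdf (pf_stat_distr n) x \<le> cdf (pf_stat_distr n) y" by blast
qed (use assms in auto)

lemma cdf_pf_stat_nonneg: "0 \<le> cdf (pf_stat_distr n) x"
  by (simp add: cdf_pf_stat_distr)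

lemma M_cdf_nonneg: "0 < x \<Longrightarrow> 0 \<le> M_cdf x"
  by (rule tendsto_lowerbound[OF cdf_pf_stat_lim]) (auto simp: cdf_pf_stat_nonneg)

lemma cdf_pf_stat_neg:
  assumes "x < 0"
  shows "(\<lambda>n. cdf (pf_stat_distr n) x) \<longlonglongrightarrow> 0"
proof (rule tendsto_eventually)
  show "\<forall>\<^sub>F n in sequentially. cdf (pf_stat_distr n) x = 0"
    using eventually_gt_at_top[of 0]
  proof eventually_elim
    case (elim n)
    then have empty: "{p \<in> PF n. pf_stat n p \<le> x} = {}" using pf_stat_nonneg[of _ n] assms by fastforce
    show ?case unfolding cdf_pf_stat_distr empty by simp
  qed
qed

text \<open>No value of the limit law at 0 has to be computed: by right continuity it is the infimum below,
  and an atom at 0 would only make 0 a discontinuity point.\<close>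

definition limit_cdf :: "real \<Rightarrow> real" where
  "limit_cdf x = (if x < 0 then 0 else if x = 0 then (INF y\<in>{0<..}. M_cdf y) else M_cdf x)"

lemma INF_M_cdf_le: "0 < y \<Longrightarrow> (INF y\<in>{0<..}. M_cdf y) \<le> M_cdf y"
  by (rule cINF_lower) (auto intro!: bdd_belowI2[of _ 0] M_cdf_nonneg)

lemma INF_M_cdf_nonneg: "0 \<le> (INF y\<in>{0<..}. M_cdf y)"
proof (rule cINF_greatest)
  have "(1 :: real) \<in> {0<..}" by simp
  then show "{0::real<..} \<noteq> {}" by blast
qed (simp add: M_cdf_nonneg)

lemma limit_cdf_mono: "x \<le> y \<Longrightarrow> limit_cdf x \<le> limit_cdf y"
  unfolding limit_cdf_def using INF_M_cdf_le[of y] INF_M_cdf_nonneg M_cdf_nonneg[of y] M_cdf_mono[of x y] by auto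

lemma limit_cdf_right_continuous: "continuous (at_right a) limit_cdf"
proof -
  consider "a < 0" | "a = 0" | "a > 0" by linarith
  then show ?thesis
  proof cases
    case 1
    have "\<forall>\<^sub>F x in at_right a. limit_cdf x = 0"
      using 1 by (auto simp: eventually_at_right_field limit_cdf_def intro!: exI[of _ 0])
    then show ?thesis using 1 by (simp add: continuous_within limit_cdf_def tendsto_eventually)
  next
    case 2
    let ?c = "INF y\<in>{0<..}. M_cdf y"
    have "(limit_cdf \<longlongrightarrow> ?c) (at_right 0)"
    proof (rule order_tendstoI)
      fix l assume l: "l < ?c"
      show "\<forall>\<^sub>F x in at_right 0. l < limit_cdf x"
        using eventually_at_right_less[of 0]
      proof eventually_elim
        case (elim x)
        then show ?case using l INF_M_cdf_le[of x] by (simp add: limit_cdf_def)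
      qed
    next
      fix u assume u: "?c < u"
      have "\<exists>y\<in>{0<..}. M_cdf y < u"
      proof (rule ccontr)
        assume "\<not> ?thesis"
        then have "u \<le> ?c" by (intro cINF_greatest) (auto simp: not_less intro: exI[of _ 1])
        then show False using u by simp
      qed
      then obtain y where y: "0 < y" "M_cdf y < u" by auto
      show "\<forall>\<^sub>F x in at_right 0. limit_cdf x < u"
        unfolding eventually_at_right_field
      proof (intro exI[of _ y] conjI allI impI)
        fix x :: real assume "0 < x" "x < y"
        then show "limit_cdf x < u" using M_cdf_mono[of x y] y by (simp add: limit_cdf_def)
      qed (rule y)
    qed
    then show ?thesis using 2 by (simp add: continuous_within limit_cdf_def)
  next
    case 3
    have "\<forall>\<^sub>F x in nhds a. x \<in> {0<..}" using 3 by (intro eventually_nhds_in_open) auto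
    then have "\<forall>\<^sub>F x in nhds a. limit_cdf x = M_cdf x"
      by eventually_elim (simp add: limit_cdf_def)
    then have "isCont limit_cdf a" using isCont_cong isCont_M_cdf[OF 3] by blast
    then show ?thesis by (rule continuous_at_imp_continuous_at_within)
  qed
qed

theorem theorem12:
  shows "\<exists>M. real_distribution M \<and> (\<forall>t>0. cdf M t = M_cdf t) \<and> weak_conv_m pf_stat_distr M"
proof (intro exI conjI)
  let ?M = "interval_measure limit_cdf"
  have bot: "(limit_cdf \<longlongrightarrow> 0) at_bot"
    by (rule tendsto_eventually) (auto simp: eventually_at_bot_linorder limit_cdf_def intro!: exI[of _ "-1"])
  have "\<forall>\<^sub>F x in at_top. M_cdf x = limit_cdf x"
    using eventually_gt_at_top[of 0] by eventually_elim (simp add: limit_cdf_def)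
  then have top: "(limit_cdf \<longlongrightarrow> 1) at_top" using M_cdf_at_top by (rule Lim_transform_eventually[rotated])
  show "real_distribution ?M"
    by (rule real_distribution_interval_measure[OF limit_cdf_mono limit_cdf_right_continuous bot top])
  have cdf: "cdf ?M = limit_cdf"
    by (rule cdf_interval_measure[OF limit_cdf_mono limit_cdf_right_continuous bot])
  show "\<forall>t>0. cdf ?M t = M_cdf t" by (simp add: cdf limit_cdf_def)
  show "weak_conv_m pf_stat_distr ?M"
    unfolding weak_conv_m_def weak_conv_def cdf
  proof (intro allI impI)
    fix x assume cont: "isCont limit_cdf x"
    consider "x < 0" | "x = 0" | "x > 0" by linarith
    then show "(\<lambda>n. cdf (pf_stat_distr n) x) \<longlonglongrightarrow> limit_cdf x"
    proof cases
      case 1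
      then show ?thesis using cdf_pf_stat_neg by (simp add: limit_cdf_def)
    next
      case 3
      then show ?thesis using cdf_pf_stat_lim by (simp add: limit_cdf_def)
    next
      case 2
      \<comment> \<open>Continuity at 0 forces the value 0 there. For small y > 0 the limit at y is
        then small, and the distribution functions at 0 lie below those at y.\<close>
      have "(limit_cdf \<longlongrightarrow> limit_cdf 0) (at_left 0)"
        using cont 2 by (simp add: continuous_within filterlim_at_split)
      moreover have "(limit_cdf \<longlongrightarrow> 0) (at_left 0)"
        by (rule tendsto_eventually) (auto simp: eventually_at_left_field limit_cdf_def intro!: exI[of _ "-1"])
      ultimately have zero: "limit_cdf 0 = 0" by (rule tendsto_unique[rotated]) simp
      have right: "(limit_cdf \<longlongrightarrow> 0) (at_right 0)"
        using limit_cdf_right_continuous[of 0] by (simp add: continuous_within zero)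
      have "(\<lambda>n. cdf (pf_stat_distr n) 0) \<longlonglongrightarrow> 0"
      proof (rule order_tendstoI)
        fix l :: real assume "l < 0"
        then show "\<forall>\<^sub>F n in sequentially. l < cdf (pf_stat_distr n) 0"
          by (intro always_eventually allI) (rule less_le_trans[OF _ cdf_pf_stat_nonneg])
      next
        fix u :: real assume "0 < u"
        from eventually_conj[OF order_tendstoD(2)[OF right this] eventually_at_right_less]
        obtain y where y: "limit_cdf y < u" "0 < y"
          using eventually_happens'[OF trivial_limit_at_right_real] by blast
        have "\<forall>\<^sub>F n in sequentially. cdf (pf_stat_distr n) y < u"
          using y by (intro order_tendstoD(2)[OF cdf_pf_stat_lim]) (auto simp: limit_cdf_def)
        then show "\<forall>\<^sub>F n in sequentially. cdf (pf_stat_distr n) 0 < u"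
        proof eventually_elim
          case (elim n)
          have "cdf (pf_stat_distr n) 0 \<le> cdf (pf_stat_distr n) y"
            unfolding cdf_pf_stat_distr using y PF_card(1)[of n]
            by (intro divide_right_mono of_nat_mono card_mono) auto
          then show ?case using elim by linarith
        qed
      qed
      then show ?thesis using 2 zero by simp
    qed
  qed
qed

end
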